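(* Let $F$ be a finite field with $q$ elements, and let $UT_3$ be the algebra of $3\times 3$ upper triangular matrices over $F$ with the $\mathbb{Z}_2$-grading $\mathcal{B}^{(0)}=\mathrm{span}_F\{e_{11},e_{22},e_{33},e_{13}\}$, $\mathcal{B}^{(1)}=\mathrm{span}_F\{e_{12},e_{23}\}$. Let $\Omega_1=\{[y_1,y_2],\,y_2^q-y_2\}$ and $\Omega_2=\{[y_3,y_4],\,y_4^q-y_4\}$. Then a basis of the superidentities of $UT_3$ with this grading is given by the polynomials $$z_1z_2z_3,\qquad z_1w_1,\qquad w_1z_1,\qquad w_1w_2\qquad (w_1\in\Omega_1,\ w_2\in\Omega_2),$$ i.e. these polynomials generate $\mathrm{Id}(\mathcal{B}^{(0)},\mathcal{B}^{(1)})$ as a $T_2$-ideal. Moreover, a linear basis of the vector space $F\langle Y\cup Z\rangle/\mathrm{Id}(\mathcal{B}^{(0)},\mathcal{B}^{(1)})$ is given by the images of the (distinct) polynomials of the forms $$\text{(a)}\quad y_1^{r_1}\cdots y_m^{r_m}\,p^{\theta},\qquad\qquad \text{(b)}\quad y_1^{r_1}\cdots y_m^{r_m}\,[z_j,y_1^{(s_1)},\ldots,y_m^{(s_m)}]\,[z_k,y_1^{(t_1)},\ldots,y_m^{(t_m)}]^{\mu},$$ where $m,j,k\in\mathbb{N}$, $0\le r_i,s_i,t_i<q$, $p$ is an ordered $q$-commutator, $\theta,\mu\in\{0,1\}$, and in (a) $\sum_{i=1}^m r_i+\theta\ge 1$.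
   Context: $F\langle Y\cup Z\rangle$ is the free non-unitary associative $F$-algebra freely generated by $Y\cup Z$, $Y=\{y_1,y_2,\ldots\}$, $Z=\{z_1,z_2,\ldots\}$. It is a superalgebra ($\mathbb{Z}_2$-graded algebra) $\mathcal{F}^{(0)}\oplus\mathcal{F}^{(1)}$, where $\mathcal{F}^{(1)}$ is spanned by monomials with an odd number of occurrences of variables from $Z$ and $\mathcal{F}^{(0)}$ by the remaining monomials. A homomorphism of superalgebras is an algebra homomorphism preserving the grading. A $T_2$-ideal is a two-sided ideal invariant under all superalgebra endomorphisms of $F\langle Y\cup Z\rangle$; a set $S$ is a basis of a $T_2$-ideal $I$ if $I$ is the $T_2$-ideal $\langle S\rangle_{T_2}$ generated by $S$. A polynomial $f(y_1,\ldots,y_m,z_1,\ldots,z_n)$ is a polynomial superidentity of a superalgebra $\mathcal{B}^{(0)}\oplus\mathcal{B}^{(1)}$ if it vanishes whenever each $y_i$ is replaced by an element of $\mathcal{B}^{(0)}$ and each $z_i$ by an element of $\mathcal{B}^{(1)}$; $\mathrm{Id}(\mathcal{B}^{(0)},\mathcal{B}^{(1)})$ is the $T_2$-ideal of all its superidentities. Commutators are left normed: $[u_1,u_2]=u_1u_2-u_2u_1$, $[u_1,\ldots,u_m]=[[u_1,\ldots,u_{m-1}],u_m]$ for $m>2$. Inside commutators, $[u,v^{(0)}]=u$ and $[u,v^{(r)}]=[[u,v^{(r-1)}],v]$ for $r\ge 1$ (so $[z_j,y_1^{(0)},\ldots,y_m^{(0)}]=z_j$). A factor with exponent $0$ in a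 product is omitted. $e_{ij}$ denote the elementary matrices. An ordered $q$-commutator is a polynomial $p$ in variables from $Y$ of one of the two forms: (i) $p=[y_{j_1},y_{j_2}^{(s_2)},y_{j_1}^{(s_1-1)},y_{j_3}^{(s_3)},\ldots,y_{j_n}^{(s_n)}]$ with $n\ge 2$, distinct indices $j_i$, $j_1>j_2<j_3<\cdots<j_n$, and $1\le s_1,\ldots,s_n<q$; or (ii) $p=[y_{l_1}^q-y_{l_1},y_{l_2}^{(t_2)},\ldots,y_{l_k}^{(t_k)}]$ with $k\ge 1$, distinct indices $l_i$, $l_2<\cdots<l_k$, and $0\le t_2,\ldots,t_k<q$ (so $y_{l_1}^q-y_{l_1}$ itself is included). *)

theory Defs
  imports "HOL-Analysis.Analysis" "HOL-Library.Poly_Mapping"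
begin

section \<open>The free superalgebra\<close>

text \<open>Variables are numbered from 0: \<open>Y i\<close> and \<open>Z i\<close> stand for the variables usually written
  \<open>y\<^sub>i\<^sub>+\<^sub>1\<close> and \<open>z\<^sub>i\<^sub>+\<^sub>1\<close>.\<close>

datatype var = Y nat | Z nat

datatype word = Word (letters: "var list")

instantiation word :: monoid_add
begin

definition zero_word :: word where "0 = Word []"

definition plus_word :: "word \<Rightarrow> word \<Rightarrow> word" where "u + v = Word (letters u @ letters v)"

instance
  by standard (simp_all add: zero_word_def plus_word_def)

end

text \<open>Multiplication of \<^typ>\<open>word \<Rightarrow>\<^sub>0 'f\<close> is convolution over concatenation of words, so this type is
  the free \<^emph>\<open>unital\<close> associative algebra. The free non-unitary algebra is its subset
  \<open>free_alg\<close> below; the unit only serves to write empty products.\<close>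

type_synonym 'f ncpoly = "word \<Rightarrow>\<^sub>0 'f"

definition nc_scale :: "'f::field \<Rightarrow> 'f ncpoly \<Rightarrow> 'f ncpoly" where
  "nc_scale c f = Poly_Mapping.map ((*) c) f"

lemma nc_scale_conv_mult: "nc_scale c f = Poly_Mapping.single 0 c * f"
  by (simp add: nc_scale_def mult_map_scale_conv_mult)

lemma lookup_nc_scale [simp]: "Poly_Mapping.lookup (nc_scale c f) w = c * Poly_Mapping.lookup f w"
  unfolding nc_scale_def by (simp add: Poly_Mapping.map.rep_eq when_def)

global_interpretation ncpoly: vector_space "nc_scale :: 'f::field \<Rightarrow> 'f ncpoly \<Rightarrow> 'f ncpoly"
  by unfold_locales
    (auto simp: nc_scale_conv_mult algebra_simps single_add mult_single simp flip: mult.assoc)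

definition yvar :: "nat \<Rightarrow> 'f::field ncpoly" where
  "yvar i = Poly_Mapping.single (Word [Y i]) 1"

definition zvar :: "nat \<Rightarrow> 'f::field ncpoly" where
  "zvar i = Poly_Mapping.single (Word [Z i]) 1"

definition free_alg :: "'f::field ncpoly set" where
  "free_alg = {f. Poly_Mapping.lookup f 0 = 0}"

definition zdeg :: "word \<Rightarrow> nat" where
  "zdeg w = length (filter (\<lambda>v. \<exists>i. v = Z i) (letters w))"

definition free_even :: "'f::field ncpoly set" where
  "free_even = ncpoly.span {Poly_Mapping.single w 1 | w. w \<noteq> 0 \<and> even (zdeg w)}"

definition free_odd :: "'f::field ncpoly set" where
  "free_odd = ncpoly.span {Poly_Mapping.single w 1 | w. w \<noteq> 0 \<and> odd (zdeg w)}"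

text \<open>Only the restriction of \<open>h\<close> to \<open>free_alg\<close> matters here.\<close>

definition super_endo :: "('f::field ncpoly \<Rightarrow> 'f ncpoly) \<Rightarrow> bool" where
  "super_endo h \<longleftrightarrow>
     h ` free_alg \<subseteq> free_alg \<and>
     (\<forall>f\<in>free_alg. \<forall>g\<in>free_alg. h (f + g) = h f + h g) \<and>
     (\<forall>c. \<forall>f\<in>free_alg. h (nc_scale c f) = nc_scale c (h f)) \<and>
     (\<forall>f\<in>free_alg. \<forall>g\<in>free_alg. h (f * g) = h f * h g) \<and>
     h ` free_even \<subseteq> free_even \<and> h ` free_odd \<subseteq> free_odd"

text \<open>The T2-ideal generated by \<open>S\<close> is \<open>T2_ideal hull S\<close>.\<close>

definition T2_ideal :: "'f::field ncpoly set \<Rightarrow> bool" where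
  "T2_ideal I \<longleftrightarrow>
     I \<subseteq> free_alg \<and> ncpoly.subspace I \<and>
     (\<forall>f\<in>I. \<forall>g\<in>free_alg. f * g \<in> I \<and> g * f \<in> I) \<and>
     (\<forall>h. super_endo h \<longrightarrow> h ` I \<subseteq> I)"


section \<open>Superidentities of graded matrix algebras\<close>

definition mat_scale :: "'f::field \<Rightarrow> 'f^'n^'m \<Rightarrow> 'f^'n^'m" where
  "mat_scale c A = (\<chi> i j. c * A $ i $ j)"

global_interpretation mats: vector_space "mat_scale :: 'f::field \<Rightarrow> 'f^'n^'m \<Rightarrow> 'f^'n^'m"
  by unfold_locales (simp_all add: mat_scale_def vec_eq_iff algebra_simps)

definition elem_mat :: "'m \<Rightarrow> 'n \<Rightarrow> 'f::field^'n^'m" where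
  "elem_mat i j = axis i (axis j 1)"

definition eval_word :: "(var \<Rightarrow> 'f::field^'n^'n) \<Rightarrow> word \<Rightarrow> 'f^'n^'n" where
  "eval_word \<phi> w = foldr (\<lambda>v M. \<phi> v ** M) (letters w) (mat 1)"

definition nc_eval :: "(var \<Rightarrow> 'f::field^'n^'n) \<Rightarrow> 'f ncpoly \<Rightarrow> 'f^'n^'n" where
  "nc_eval \<phi> f = (\<Sum>w\<in>Poly_Mapping.keys f. mat_scale (Poly_Mapping.lookup f w) (eval_word \<phi> w))"

definition superids :: "('f::field^'n^'n) set \<Rightarrow> ('f^'n^'n) set \<Rightarrow> 'f ncpoly set" where
  "superids B0 B1 = {f \<in> free_alg.
     \<forall>\<phi>. (\<forall>i. \<phi> (Y i) \<in> B0) \<and> (\<forall>i. \<phi> (Z i) \<in> B1) \<longrightarrow> nc_eval \<phi> f = 0}"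

text \<open>In the index type \<^typ>\<open>3\<close> the numerals 1, 2, 3 denote its three distinct elements (with
  \<open>3 = 0\<close>), so they serve as labels of the rows and columns; the order of that type is not used.\<close>

definition UT3_even :: "('f::field^3^3) set" where
  "UT3_even = mats.span {elem_mat 1 1, elem_mat 2 2, elem_mat 3 3, elem_mat 1 3}"

definition UT3_odd :: "('f::field^3^3) set" where
  "UT3_odd = mats.span {elem_mat 1 2, elem_mat 2 3}"

abbreviation UT3_superids :: "'f::field ncpoly set" where
  "UT3_superids \<equiv> superids UT3_even UT3_odd"


section \<open>The relatively free algebra as a quotient vector space\<close>

lemma nc_eval_superset:
  assumes "finite W" "Poly_Mapping.keys f \<subseteq> W"
  shows "nc_eval \<phi> f = (\<Sum>w\<in>W. mat_scale (Poly_Mapping.lookup f w) (eval_word \<phi> w))"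
  unfolding nc_eval_def using assms
  by (intro sum.mono_neutral_left) (auto simp: in_keys_iff)

lemma nc_eval_add: "nc_eval \<phi> (f + g) = nc_eval \<phi> f + nc_eval \<phi> g"
proof -
  let ?W = "Poly_Mapping.keys f \<union> Poly_Mapping.keys g"
  have "nc_eval \<phi> (f + g) =
      (\<Sum>w\<in>?W. mat_scale (Poly_Mapping.lookup (f + g) w) (eval_word \<phi> w))"
    by (rule nc_eval_superset) (use Poly_Mapping.keys_add[of f g] in auto)
  also have "\<dots> = nc_eval \<phi> f + nc_eval \<phi> g"
    by (simp add: nc_eval_superset[of ?W] lookup_add mats.scale_left_distrib sum.distrib)
  finally show ?thesis .
qed

lemma nc_eval_scale: "nc_eval \<phi> (nc_scale c f) = mat_scale c (nc_eval \<phi> f)"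
proof -
  have "nc_eval \<phi> (nc_scale c f) =
      (\<Sum>w\<in>Poly_Mapping.keys f. mat_scale (Poly_Mapping.lookup (nc_scale c f) w) (eval_word \<phi> w))"
    by (rule nc_eval_superset) (auto simp: in_keys_iff)
  then show ?thesis
    by (simp add: nc_eval_def mats.scale_sum_right)
qed

lemma subspace_free_alg: "ncpoly.subspace free_alg"
  by (auto simp: ncpoly.subspace_def free_alg_def lookup_add)

lemma subspace_superids: "ncpoly.subspace (superids B0 B1)"
  using subspace_free_alg
  by (auto simp: ncpoly.subspace_def superids_def nc_eval_add nc_eval_scale)
    (simp add: nc_eval_def)

lemma subspace_UT3_superids: "ncpoly.subspace (UT3_superids :: 'f::field ncpoly set)"
  by (rule subspace_superids)

definition cong_UT3 :: "'f::field ncpoly \<Rightarrow> 'f ncpoly \<Rightarrow> bool" where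
  "cong_UT3 f g \<longleftrightarrow> f \<in> free_alg \<and> g \<in> free_alg \<and> f - g \<in> UT3_superids"

lemma part_equivp_cong_UT3: "part_equivp (cong_UT3 :: 'f::field ncpoly \<Rightarrow> _)"
proof (rule part_equivpI)
  have "cong_UT3 0 (0 :: 'f ncpoly)"
    using ncpoly.subspace_0[OF subspace_free_alg] ncpoly.subspace_0[OF subspace_UT3_superids]
    by (auto simp: cong_UT3_def)
  then show "\<exists>f :: 'f ncpoly. cong_UT3 f f" ..
  show "symp (cong_UT3 :: 'f ncpoly \<Rightarrow> _)"
  proof (rule sympI)
    fix f g :: "'f ncpoly"
    assume "cong_UT3 f g"
    then show "cong_UT3 g f"
      using ncpoly.subspace_neg[OF subspace_UT3_superids, of "f - g"] by (simp add: cong_UT3_def)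
  qed
  show "transp (cong_UT3 :: 'f ncpoly \<Rightarrow> _)"
  proof (rule transpI)
    fix f g h :: "'f ncpoly"
    assume "cong_UT3 f g" "cong_UT3 g h"
    then show "cong_UT3 f h"
      using ncpoly.subspace_add[OF subspace_UT3_superids, of "f - g" "g - h"]
      by (simp add: cong_UT3_def)
  qed
qed

text \<open>The quotient of \<open>free_alg\<close> by the superidentities of the graded algebra; the projection is
  \<open>abs_relfree\<close>, which is meaningful on \<open>free_alg\<close> only.\<close>

quotient_type (overloaded) 'f relfree = "'f::field ncpoly" / partial: cong_UT3
  by (rule part_equivp_cong_UT3)

instantiation relfree :: (field) ab_group_add
begin

lift_definition zero_relfree :: "'a relfree" is 0
  using ncpoly.subspace_0[OF subspace_free_alg] ncpoly.subspace_0[OF subspace_UT3_superids]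
  by (auto simp: cong_UT3_def)

lift_definition plus_relfree :: "'a relfree \<Rightarrow> 'a relfree \<Rightarrow> 'a relfree" is "(+)"
proof -
  fix f f' g g' :: "'a ncpoly"
  assume "cong_UT3 f f'" "cong_UT3 g g'"
  then show "cong_UT3 (f + g) (f' + g')"
    using ncpoly.subspace_add[OF subspace_UT3_superids, of "f - f'" "g - g'"]
    by (simp add: cong_UT3_def ncpoly.subspace_add[OF subspace_free_alg] add_diff_add)
qed

lift_definition uminus_relfree :: "'a relfree \<Rightarrow> 'a relfree" is uminus
proof -
  fix f f' :: "'a ncpoly"
  assume "cong_UT3 f f'"
  then show "cong_UT3 (- f) (- f')"
    using ncpoly.subspace_neg[OF subspace_UT3_superids, of "f - f'"]
    by (simp add: cong_UT3_def ncpoly.subspace_neg[OF subspace_free_alg])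
qed

definition minus_relfree :: "'a relfree \<Rightarrow> 'a relfree \<Rightarrow> 'a relfree" where
  "x - y = x + - (y :: 'a relfree)"

instance
proof
  fix a b c :: "'a relfree"
  have zero: "(0 :: 'a ncpoly) \<in> UT3_superids"
    by (rule ncpoly.subspace_0[OF subspace_UT3_superids])
  note closed = ncpoly.subspace_add[OF subspace_free_alg] ncpoly.subspace_neg[OF subspace_free_alg]
    ncpoly.subspace_0[OF subspace_free_alg]
  show "a + b + c = a + (b + c)"
    by transfer (auto simp: cong_UT3_def zero closed add.assoc)
  show "a + b = b + a"
    by transfer (auto simp: cong_UT3_def zero closed add.commute)
  show "0 + a = a"
    by transfer (auto simp: cong_UT3_def zero closed)
  show "- a + a = 0"
    by transfer (auto simp: cong_UT3_def zero closed)
  show "a - b = a + - b"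
    by (rule minus_relfree_def)
qed

end

lift_definition relfree_scale :: "'f::field \<Rightarrow> 'f relfree \<Rightarrow> 'f relfree" is nc_scale
proof -
  fix c :: 'f and f f' :: "'f ncpoly"
  assume "cong_UT3 f f'"
  then show "cong_UT3 (nc_scale c f) (nc_scale c f')"
    using ncpoly.subspace_scale[OF subspace_UT3_superids, of "f - f'" c]
    by (simp add: cong_UT3_def ncpoly.subspace_scale[OF subspace_free_alg]
        ncpoly.scale_right_diff_distrib)
qed

global_interpretation relfree: vector_space "relfree_scale :: 'f::field \<Rightarrow> 'f relfree \<Rightarrow> 'f relfree"
proof
  fix a b :: 'f and x y :: "'f relfree"
  have zero: "(0 :: 'f ncpoly) \<in> UT3_superids"
    by (rule ncpoly.subspace_0[OF subspace_UT3_superids])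
  note closed = ncpoly.subspace_add[OF subspace_free_alg] ncpoly.subspace_scale[OF subspace_free_alg]
  show "relfree_scale a (x + y) = relfree_scale a x + relfree_scale a y"
    by transfer (auto simp: cong_UT3_def zero closed ncpoly.scale_right_distrib)
  show "relfree_scale (a + b) x = relfree_scale a x + relfree_scale b x"
    by transfer (auto simp: cong_UT3_def zero closed ncpoly.scale_left_distrib)
  show "relfree_scale a (relfree_scale b x) = relfree_scale (a * b) x"
    by transfer (auto simp: cong_UT3_def zero closed)
  show "relfree_scale 1 x = x"
    by transfer (auto simp: cong_UT3_def zero closed)
qed


section \<open>Commutators and normal forms\<close>

definition comm :: "'a::ring \<Rightarrow> 'a \<Rightarrow> 'a" where
  "comm u v = u * v - v * u"

text \<open>\<open>lcomm u [v\<^sub>1, \<dots>, v\<^sub>n]\<close> is the left normed commutator \<open>[u, v\<^sub>1, \<dots>, v\<^sub>n]\<close>; an entry \<open>v\<^sup>(\<^sup>r\<^sup>)\<close>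
  becomes \<open>replicate r v\<close>.\<close>

definition lcomm :: "'a::ring \<Rightarrow> 'a list \<Rightarrow> 'a" where
  "lcomm u vs = foldl comm u vs"

definition ordered_comms :: "nat \<Rightarrow> 'f::field ncpoly set" where
  "ordered_comms q =
     {lcomm (yvar (j 1)) (replicate (s 2) (yvar (j 2)) @ replicate (s 1 - 1) (yvar (j 1)) @
        concat (map (\<lambda>i. replicate (s i) (yvar (j i))) [3..<n + 1])) | (n::nat) j s.
        n \<ge> 2 \<and> inj_on j {1..n} \<and> j 2 < j 1 \<and> strict_mono_on {2..n} j \<and>
        (\<forall>i\<in>{1..n}. 1 \<le> s i \<and> s i < q)}
     \<union>
     {lcomm (yvar (l 1) ^ q - yvar (l 1))
        (concat (map (\<lambda>i. replicate (t i) (yvar (l i))) [2..<k + 1])) | (k::nat) l t.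
        k \<ge> 1 \<and> inj_on l {1..k} \<and> strict_mono_on {2..k} l \<and> (\<forall>i\<in>{2..k}. t i < q)}"

definition ymonom :: "nat \<Rightarrow> (nat \<Rightarrow> nat) \<Rightarrow> 'f::field ncpoly" where
  "ymonom m r = prod_list (map (\<lambda>i. yvar i ^ r i) [0..<m])"

definition zcomm :: "nat \<Rightarrow> nat \<Rightarrow> (nat \<Rightarrow> nat) \<Rightarrow> 'f::field ncpoly" where
  "zcomm m j s = lcomm (zvar j) (concat (map (\<lambda>i. replicate (s i) (yvar i)) [0..<m]))"

definition normal_forms :: "nat \<Rightarrow> 'f::field ncpoly set" where
  "normal_forms q =
     {ymonom m r * p ^ \<theta> | m r p \<theta>.
        (\<forall>i<m. r i < q) \<and> p \<in> ordered_comms q \<and> \<theta> \<in> {0, 1} \<and> (\<Sum>i<m. r i) + \<theta> \<ge> 1}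
     \<union>
     {ymonom m r * zcomm m j s * zcomm m k t ^ \<mu> | m r j s k t \<mu>.
        (\<forall>i<m. r i < q \<and> s i < q \<and> t i < q) \<and> \<mu> \<in> {0, 1}}"

definition Omega :: "nat \<Rightarrow> nat \<Rightarrow> nat \<Rightarrow> 'f::field ncpoly set" where
  "Omega q i j = {comm (yvar i) (yvar j), yvar j ^ q - yvar j}"

end

theory Submission
  imports Defs
begin

text \<open>Modulo the ideal \<open>I\<close> generated by the identities, every element of the ideal spanned by
  commutators \<open>[u, v]\<close> of even elements and by \<open>y\<^sub>i\<^sup>q - y\<^sub>i\<close>, and every odd element, is annihilated
  from both sides by this ideal. On such elements left multiplications by the \<open>y\<^sub>i\<close> commute and
  satisfy \<open>L\<^sup>q = L\<close>, and so do the inner derivations \<open>D\<close> by the \<open>y\<^sub>i\<close>, because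
  \<open>[u, v\<^sup>(\<^sup>q\<^sup>)] = [u, v\<^sup>q]\<close> over a field with \<open>q\<close> elements. Together with the Jacobi identity this
  shows that the normal forms span modulo \<open>I\<close>. Conversely the entries of a normal form, evaluated
  at generic graded upper triangular matrices, are reduced monomial functions or differences of two
  such, so that a linear combination of normal forms which is a superidentity is trivial. Hence \<open>I\<close>
  is the whole ideal of superidentities and the normal forms are a basis of the quotient.\<close>

section \<open>Commutators in rings\<close>

text \<open>The delicate point is exponent overflow. In a commutator of type (i) the two head
  variables count towards the exponents, so reducing the later entries below \<open>q\<close> is not
  enough: a total exponent can still reach q. Then [y_i, y_m^(q)] = [y_i, y_m] - [y_m^q - y_m, y_i],
  and this is where type (ii) enters. Independence mirrors this. Let d_i be the corner entry of y_i
  and x_i the difference of its outer diagonal entries. In the corner, type (i) has the terms d_i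
  x^(S-i) and d_m x^(S-m), with m the least variable, and type (ii) is d_l (x_l^(q-1) - 1) x^T. No
  term of type (i) reaches the exponent q-1 of x_l next to d_l, so the coefficients of type (ii)
  vanish first; then d_i with non-minimal i singles out each form of type (i). All computations take
  place in unital rings. The unit is therefore one more form, discarded at the end by comparing
  constant terms.\<close>

lemma lcomm_Nil [simp]: "lcomm u [] = u"
  and lcomm_Cons [simp]: "lcomm u (v # vs) = lcomm (comm u v) vs"
  and lcomm_append: "lcomm u (vs @ ws) = lcomm (lcomm u vs) ws"
  by (simp_all add: lcomm_def)

lemma lcomm_add: "lcomm (u + u') vs = lcomm u vs + lcomm u' vs"
proof (induction vs arbitrary: u u')
  case (Cons v vs)
  have "comm (u + u') v = comm u v + comm u' v"
    by (simp add: comm_def algebra_simps)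
  then show ?case by (simp add: Cons.IH)
qed simp

lemma lcomm_zero [simp]: "lcomm 0 vs = 0"
  by (induction vs) (simp_all add: comm_def)

lemma lcomm_minus: "lcomm (- u) vs = - lcomm u vs"
  using lcomm_add[of u "- u" vs] by (simp add: eq_neg_iff_add_eq_0 add.commute)

lemma lcomm_diff: "lcomm (u - u') vs = lcomm u vs - lcomm u' vs"
  using lcomm_add[of u "- u'" vs] by (simp add: lcomm_minus)

lemma comm_swap: "comm u v = - comm v u"
  by (simp add: comm_def)

lemma lcomm_replicate_Suc: "lcomm u (replicate (Suc n) v) = comm (lcomm u (replicate n v)) v"
proof -
  have "replicate (Suc n) v = replicate n v @ [v]"
    by (simp add: replicate_append_same)
  then show ?thesis by (simp only: lcomm_append lcomm_Cons lcomm_Nil)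
qed

text \<open>[u, v^(n)] is (R - L)^n applied to u, where R and L are right and left multiplication by
  v. These commute, so the binomial theorem applies; the integer coefficients are central in every
  ring.\<close>

lemma lcomm_replicate_eq_sum:
  fixes u v :: "'a::ring_1"
  shows "lcomm u (replicate n v) =
    (\<Sum>k\<le>n. of_int ((-1) ^ k * int (n choose k)) * (v ^ k * u * v ^ (n - k)))"
proof (induction n)
  case (Suc n)
  define c where "c k = (of_int ((-1) ^ k * int (n choose k)) :: 'a)" for k
  define t where "t k = v ^ k * u * v ^ (Suc n - k)" for k
  have c_left: "v * (c k * x) = c k * (v * x)" for k x
    unfolding c_def by (metis mult.assoc mult_of_int_commute)
  have c_Suc: "c (Suc k) - c k = of_int ((-1) ^ Suc k * int (Suc n choose Suc k))" for k
  proof -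
    have "c (Suc k) - c k = of_int ((-1) ^ Suc k * int (n choose Suc k) - (-1) ^ k * int (n choose k))"
      by (simp only: c_def of_int_diff)
    also have "(-1) ^ Suc k * int (n choose Suc k) - (-1) ^ k * int (n choose k) =
        (-1) ^ Suc k * int (Suc n choose Suc k)"
      by (simp add: algebra_simps)
    finally show ?thesis .
  qed
  have "lcomm u (replicate (Suc n) v) =
      (\<Sum>k\<le>n. c k * (v ^ k * u * v ^ (n - k))) * v - v * (\<Sum>k\<le>n. c k * (v ^ k * u * v ^ (n - k)))"
    unfolding lcomm_replicate_Suc Suc.IH c_def comm_def ..
  also have "\<dots> = (\<Sum>k\<le>n. c k * t k) - (\<Sum>k\<le>n. c k * t (Suc k))"
    unfolding sum_distrib_left sum_distrib_right t_def
    by (intro arg_cong2[of _ _ _ _ "(-)"] sum.cong)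
      (simp_all add: c_left mult.assoc Suc_diff_le power_commutes)
  also have "(\<Sum>k\<le>n. c k * t k) = (\<Sum>k\<le>Suc n. c k * t k)"
    by (simp add: c_def binomial_eq_0)
  also have "\<dots> = c 0 * t 0 + (\<Sum>k\<le>n. c (Suc k) * t (Suc k))"
    by (rule sum.atMost_Suc_shift)
  also have "\<dots> - (\<Sum>k\<le>n. c k * t (Suc k)) =
      c 0 * t 0 + (\<Sum>k\<le>n. (c (Suc k) - c k) * t (Suc k))"
    by (simp add: sum_subtractf left_diff_distrib)
  also have "\<dots> = (\<Sum>k\<le>Suc n. of_int ((-1) ^ k * int (Suc n choose k)) * t k)"
    unfolding sum.atMost_Suc_shift by (simp only: c_Suc) (simp add: c_def)
  finally show ?case by (simp add: t_def)
qed simp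

text \<open>Only the outer terms k = 0 and k = q of the binomial expansion survive. Asking for
  (-1)^q = -1 rather than for odd q also covers characteristic 2.\<close>

lemma lcomm_replicate_eq_comm_power:
  fixes u v :: "'a::ring_1"
  assumes "q > 0" "\<And>k. 0 < k \<Longrightarrow> k < q \<Longrightarrow> of_nat (q choose k) = (0 :: 'a)"
    and "(- 1) ^ q = (- 1 :: 'a)"
  shows "lcomm u (replicate q v) = comm u (v ^ q)"
proof -
  have "lcomm u (replicate q v) =
      (\<Sum>k\<in>{0, q}. of_int ((-1) ^ k * int (q choose k)) * (v ^ k * u * v ^ (q - k)))"
    unfolding lcomm_replicate_eq_sum
    using assms(2) by (intro sum.mono_neutral_right) auto
  also have "\<dots> = comm u (v ^ q)"
    using assms(1,3) by (simp add: comm_def)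
  finally show ?thesis .
qed

text \<open>The Jacobi identity, in the form that measures how far two neighbouring commutator
  entries are from commuting.\<close>

lemma comm_comm: "comm (comm u v) w - comm (comm u w) v = comm u (comm v w)"
  by (simp add: comm_def algebra_simps)


section \<open>Normal forms indexed by multisets\<close>

definition qred :: "nat \<Rightarrow> 'v multiset \<Rightarrow> bool" where
  "qred q M \<longleftrightarrow> (\<forall>v. count M v < q)"

definition ypow :: "(nat \<Rightarrow> 'a::monoid_mult) \<Rightarrow> nat list \<Rightarrow> 'a" where
  "ypow y xs = prod_list (map y xs)"

lemma ypow_simps [simp]: "ypow y [] = 1" "ypow y (x # xs) = y x * ypow y xs"
  "ypow y (xs @ ys) = ypow y xs * ypow y ys" "ypow y (replicate n x) = y x ^ n"
  by (simp_all add: ypow_def)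

text \<open>The index \<open>Com M S i\<close> encodes \<open>y\<^sup>M\<close> times the ordered commutator of type (i) whose variables
  with multiplicities form \<open>S\<close> and whose first variable is \<open>y i\<close>; \<open>Frob M l T\<close> encodes those of
  type (ii).\<close>

datatype index =
    Pow "nat multiset"
  | Com "nat multiset" "nat multiset" nat
  | Frob "nat multiset" nat "nat multiset"
  | One "nat multiset" nat "nat multiset"
  | Two "nat multiset" nat "nat multiset" nat "nat multiset"

text \<open>In type (i) the index j_2 is smaller than all others, so it is the minimum of the
  support and only the first index \<open>i\<close> remains to be chosen; \<open>i\<close> differing
  from the minimum also forces two distinct variables. The unit \<open>Pow {#}\<close> counts as
  valid.\<close>

primrec valid :: "nat \<Rightarrow> index \<Rightarrow> bool" where
  "valid q (Pow M) \<longleftrightarrow> qred q M"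
| "valid q (Com M S i) \<longleftrightarrow> qred q M \<and> qred q S \<and> i \<in># S \<and> i \<noteq> Min (set_mset S)"
| "valid q (Frob M l T) \<longleftrightarrow> qred q M \<and> qred q T \<and> l \<notin># T"
| "valid q (One M j S) \<longleftrightarrow> qred q M \<and> qred q S"
| "valid q (Two M j S k T) \<longleftrightarrow> qred q M \<and> qred q S \<and> qred q T"

abbreviation slist :: "nat multiset \<Rightarrow> nat list" where
  "slist \<equiv> sorted_list_of_multiset"

text \<open>One copy of \<open>i\<close> heads the commutator and is not part of the list, hence
  \<open>count S i - 1\<close>.\<close>

definition com_list :: "nat multiset \<Rightarrow> nat \<Rightarrow> nat list" where
  "com_list S i = (let m = Min (set_mset S) in
     replicate (count S m) m @ replicate (count S i - 1) i @
     slist (filter_mset (\<lambda>x. x \<noteq> m \<and> x \<noteq> i) S))"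

text \<open>Stated over an arbitrary unital ring so that the same expression can be read in the free
  algebra, in its quotient and in the matrices, with homomorphisms carrying one reading to
  another.\<close>

primrec form :: "nat \<Rightarrow> (nat \<Rightarrow> 'a::ring_1) \<Rightarrow> (nat \<Rightarrow> 'a) \<Rightarrow> index \<Rightarrow> 'a" where
  "form q y z (Pow M) = ypow y (slist M)"
| "form q y z (Com M S i) = ypow y (slist M) * lcomm (y i) (map y (com_list S i))"
| "form q y z (Frob M l T) = ypow y (slist M) * lcomm (y l ^ q - y l) (map y (slist T))"
| "form q y z (One M j S) = ypow y (slist M) * lcomm (z j) (map y (slist S))"
| "form q y z (Two M j S k T) =
     ypow y (slist M) * lcomm (z j) (map y (slist S)) * lcomm (z k) (map y (slist T))"


section \<open>Reduction to normal forms\<close>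

text \<open>Adjacent transpositions generate all permutations. The claim is proved behind an
  arbitrary prefix, which absorbs a letter once it is in its place.\<close>

lemma permute_adjacent:
  assumes swap: "\<And>as i j bs. Q (as @ i # j # bs) \<Longrightarrow> Q (as @ j # i # bs)"
    and "Q xs" "mset xs = mset ys"
  shows "Q ys"
proof -
  have move: "Q (as @ bs @ x # cs)" if "Q (as @ x # bs @ cs)" for as bs cs x
    using that
  proof (induction bs arbitrary: as)
    case (Cons b bs)
    then have "Q (as @ b # x # bs @ cs)"
      using swap[of as x b "bs @ cs"] by simp
    then show ?case
      using Cons.IH[of "as @ [b]"] by simp
  qed simp
  have "Q (as @ ys)" if "Q (as @ xs)" "mset xs = mset ys" for as
    using that
  proof (induction xs arbitrary: as ys)
    case (Cons x xs)
    then have "x \<in> set ys"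
      by (metis list.set_intros(1) set_mset_mset)
    then obtain us vs where ys: "ys = us @ x # vs"
      by (auto simp: in_set_conv_decomp)
    then have "Q ((as @ [x]) @ us @ vs)"
      using Cons.prems Cons.IH[of "as @ [x]" "us @ vs"] by simp
    then show ?case
      using move[of as x us vs] ys by simp
  qed simp
  from this[of "[]"] show ?thesis
    using assms(2,3) by simp
qed

text \<open>Induction on the length: if some letter occurs at least \<open>q\<close> times, then
  \<open>q\<close> copies can be gathered in front and replaced by a single one, which shortens the
  list because \<open>q\<close> is at least 2.\<close>

lemma reduce_list:
  assumes q: "q \<ge> 2"
    and swap: "\<And>as i j bs. Q (as @ i # j # bs) \<Longrightarrow> Q (as @ j # i # bs)"
    and power: "\<And>i xs. Q (i # xs) \<Longrightarrow> Q (replicate q i @ xs)"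
    and base: "\<And>M. qred q M \<Longrightarrow> Q (slist M)"
  shows "Q xs"
proof (induction xs rule: length_induct)
  case (1 xs)
  show ?case
  proof (cases "qred q (mset xs)")
    case True
    then show ?thesis
      using permute_adjacent[of Q "slist (mset xs)" xs] swap base[of "mset xs"] by simp
  next
    case False
    then obtain i where i: "q \<le> count (mset xs) i"
      by (auto simp: qred_def not_less)
    define M where "M = mset xs - replicate_mset q i"
    have M: "mset xs = replicate_mset q i + M"
      using i unfolding M_def by (simp add: count_le_replicate_mset_subset_eq[symmetric] subset_mset.add_diff_inverse)
    have "length xs = q + size M"
      using arg_cong[OF M, of size] by simp
    then have "length (i # slist M) < length xs"
      using q by (metis One_nat_def Suc_1 Suc_le_lessD add_less_mono1 length_Cons mset_sorted_list_of_multiset plus_1_eq_Suc size_mset)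
    then have "Q (replicate q i @ slist M)"
      using 1 power by blast
    then show ?thesis
      using M swap by (intro permute_adjacent[of Q "replicate q i @ slist M" xs]) auto
  qed
qed


text \<open>The properties of the free algebra modulo the generated ideal on which the reduction
  rests. \<open>Ev\<close> and \<open>Od\<close> are the images of the even and odd parts, constants
  counting as even. \<open>V\<close> will be the span of the forms; the rewriting below has only
  coefficients 1 and -1, so \<open>V\<close> appears with sums and differences.\<close>

locale graded_quotient =
  fixes q :: nat and y z :: "nat \<Rightarrow> 'a::ring_1" and Ev Od Om V :: "'a set"
  assumes q: "2 \<le> q"
    and lcomm_power: "lcomm (u :: 'a) (replicate q v) = comm u (v ^ q)"
    and Ev: "1 \<in> Ev" "y i \<in> Ev" "e \<in> Ev \<Longrightarrow> e' \<in> Ev \<Longrightarrow> e - e' \<in> Ev" "e \<in> Ev \<Longrightarrow> e' \<in> Ev \<Longrightarrow> e * e' \<in> Ev"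
    and Od: "z i \<in> Od" "o1 \<in> Od \<Longrightarrow> o2 \<in> Od \<Longrightarrow> o1 - o2 \<in> Od" "e \<in> Ev \<Longrightarrow> o1 \<in> Od \<Longrightarrow> e * o1 \<in> Od"
      "o1 \<in> Od \<Longrightarrow> e \<in> Ev \<Longrightarrow> o1 * e \<in> Od"
    and Om_def: "Om = {comm u v | u v. u \<in> Ev \<and> v \<in> Ev} \<union> {y i ^ q - y i | i. True}"
    and zzz: "o1 \<in> Od \<Longrightarrow> o2 \<in> Od \<Longrightarrow> o3 \<in> Od \<Longrightarrow> o1 * o2 * o3 = 0"
    and zw: "o1 \<in> Od \<Longrightarrow> w \<in> Om \<Longrightarrow> o1 * w = 0"
    and wz: "o1 \<in> Od \<Longrightarrow> w \<in> Om \<Longrightarrow> w * o1 = 0"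
    and ww: "w \<in> Om \<Longrightarrow> w' \<in> Om \<Longrightarrow> w * w' = 0"
    and V: "0 \<in> V" "a \<in> V \<Longrightarrow> b \<in> V \<Longrightarrow> a + b \<in> V" "a \<in> V \<Longrightarrow> b \<in> V \<Longrightarrow> a - b \<in> V"
    and form_V: "valid q ix \<Longrightarrow> form q y z ix \<in> V"
begin

section \<open>The elements annihilated by commutators and by y_i^q - y_i\<close>

lemma comm_Om: "u \<in> Ev \<Longrightarrow> v \<in> Ev \<Longrightarrow> comm u v \<in> Om"
  and frob_Om: "y i ^ q - y i \<in> Om"
  by (auto simp: Om_def)

lemma ypow_Ev: "ypow y xs \<in> Ev"
  by (induction xs) (auto intro: Ev)

lemma power_Ev: "e \<in> Ev \<Longrightarrow> e ^ n \<in> Ev"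
  by (induction n) (auto intro: Ev)

lemma Om_Ev: "w \<in> Om \<Longrightarrow> w \<in> Ev"
  by (auto simp: Om_def comm_def intro!: Ev power_Ev)

text \<open>An even factor in between is absorbed by [u, v] e = [u, v e] - v [u, e], and w e =
  [w, e] + e w reduces every w to this case.\<close>

lemma Om_Ev_Om:
  assumes "w \<in> Om" "e \<in> Ev" "w' \<in> Om"
  shows "w * e * w' = 0"
proof -
  have comm: "comm u v * e * w' = 0" if "u \<in> Ev" "v \<in> Ev" "e \<in> Ev" for u v e
  proof -
    have "comm u v * e * w' = comm u (v * e) * w' - v * (comm u e * w')"
      by (simp add: comm_def algebra_simps)
    then show ?thesis
      using that ww[OF comm_Om \<open>w' \<in> Om\<close>] by (simp add: Ev)
  qed
  have "w * e * w' = comm w e * 1 * w' + e * (w * w')"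
    by (simp add: comm_def algebra_simps)
  then show ?thesis
    using assms comm[of w e 1] Om_Ev[of w] ww by (simp add: Ev)
qed

text \<open>The even factor in the middle makes \<open>N\<close> stable under multiplication by
  \<open>Ev\<close>, so that the products and commutators formed below are still annihilated by
  \<open>Om\<close>.\<close>

definition "N = {x. \<forall>w\<in>Om. \<forall>e\<in>Ev. w * e * x = 0 \<and> x * e * w = 0}"

lemma Om_N: "w \<in> Om \<Longrightarrow> w \<in> N"
  by (auto simp: N_def Om_Ev_Om)

lemma Od_N: "o1 \<in> Od \<Longrightarrow> o1 \<in> N"
  by (auto simp: N_def mult.assoc wz zw Od) (simp add: zw Od flip: mult.assoc)

lemma N_mult:
  assumes "x \<in> N" "e \<in> Ev"
  shows "e * x \<in> N" "x * e \<in> N"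
proof -
  show "e * x \<in> N"
    unfolding N_def
  proof (safe)
    fix w e' assume "w \<in> Om" "e' \<in> Ev"
    then have "w * (e' * e) * x = 0" "x * e' * w = 0"
      using assms Ev(4) by (auto simp: N_def)
    then show "w * e' * (e * x) = 0" "e * x * e' * w = 0"
      by (simp_all add: mult.assoc)
  qed
  show "x * e \<in> N"
    unfolding N_def
  proof (safe)
    fix w e' assume "w \<in> Om" "e' \<in> Ev"
    then have "x * (e * e') * w = 0" "w * e' * x = 0"
      using assms Ev(4) by (auto simp: N_def)
    then show "x * e * e' * w = 0" "w * e' * (x * e) = 0"
      by (simp add: mult.assoc, simp flip: mult.assoc)
  qed
qed

lemma N_diff: "x \<in> N \<Longrightarrow> x' \<in> N \<Longrightarrow> x - x' \<in> N"
  by (simp add: N_def algebra_simps)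

lemma lcomm_N: "x \<in> N \<Longrightarrow> lcomm x (map y xs) \<in> N"
  by (induction xs arbitrary: x) (simp_all add: comm_def N_diff N_mult Ev)

lemma lcomm_Od: "x \<in> Od \<Longrightarrow> lcomm x (map y xs) \<in> Od"
  by (induction xs arbitrary: x) (simp_all add: comm_def Od Ev)

lemma comm_N_Om:
  assumes "x \<in> N" "w \<in> Om"
  shows "x * w = 0" "w * x = 0"
  using assms Ev(1) by (force simp: N_def)+

section \<open>Normalizing left factors and commutator entries\<close>

lemma left_swap:
  assumes "x \<in> N"
  shows "ypow y (as @ i # j # bs) * x = ypow y (as @ j # i # bs) * x"
proof -
  have "comm (y i) (y j) * (ypow y bs * x) = 0"
    using assms comm_Om[OF Ev(2) Ev(2)] by (intro comm_N_Om N_mult ypow_Ev)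
  then have "ypow y as * (y i * y j * (ypow y bs * x)) = ypow y as * (y j * y i * (ypow y bs * x))"
    by (simp add: comm_def algebra_simps)
  then show ?thesis by (simp add: mult.assoc)
qed

lemma left_power:
  assumes "x \<in> N"
  shows "ypow y (replicate q i @ bs) * x = ypow y (i # bs) * x"
proof -
  have "(y i ^ q - y i) * (ypow y bs * x) = 0"
    using assms frob_Om by (intro comm_N_Om N_mult ypow_Ev)
  then show ?thesis by (simp add: algebra_simps)
qed

text \<open>The trailing factor \<open>x'\<close> is the second commutator of a form
  \<open>Two\<close>; it is untouched while the powers on the left are normalized.\<close>

lemma left_norm:
  assumes "\<And>M. qred q M \<Longrightarrow> ypow y (slist M) * x * x' \<in> V" "x \<in> N"
  shows "ypow y xs * x * x' \<in> V"
proof (rule reduce_list[OF q])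
  show "ypow y (as @ j # i # bs) * x * x' \<in> V" if "ypow y (as @ i # j # bs) * x * x' \<in> V" for as bs i j
    using that by (simp only: left_swap[OF assms(2)])
  show "ypow y (replicate q i @ bs) * x * x' \<in> V" if "ypow y (i # bs) * x * x' \<in> V" for i bs
    using that by (simp only: left_power[OF assms(2)])
qed (rule assms(1))

text \<open>By the Jacobi identity, exchanging the two entries costs the commutator of an element of
  \<open>N\<close> with [y_i, y_j], and both of its products vanish.\<close>

lemma lcomm_swap:
  assumes "x \<in> N"
  shows "lcomm x (map y (as @ i # j # bs)) = lcomm x (map y (as @ j # i # bs))"
proof -
  let ?X = "lcomm x (map y as)"
  have "comm (comm ?X (y i)) (y j) = comm (comm ?X (y j)) (y i)"
    using comm_comm[of ?X "y i" "y j"] comm_N_Om[OF lcomm_N[OF assms] comm_Om[OF Ev(2) Ev(2)]]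
    by (simp add: comm_def[of ?X "comm _ _"])
  then show ?thesis by (simp add: lcomm_append)
qed

text \<open>\<open>lcomm_power\<close> turns q entries y_i into one entry y_i^q, and y_i^q - y_i
  annihilates \<open>N\<close> from both sides.\<close>

lemma lcomm_q:
  assumes "x \<in> N"
  shows "lcomm x (map y (replicate q i @ bs)) = lcomm x (map y (i # bs))"
proof -
  have "comm x (y i ^ q) = comm x (y i)"
    using comm_N_Om[OF assms frob_Om] by (simp add: comm_def algebra_simps)
  then show ?thesis by (simp add: lcomm_append lcomm_power)
qed

lemma lcomm_perm:
  assumes "x \<in> N" "mset xs = mset ys"
  shows "lcomm x (map y xs) = lcomm x (map y ys)"
  by (rule permute_adjacent[of "\<lambda>us. lcomm x (map y xs) = lcomm x (map y us)", OF _ refl assms(2)])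
    (simp only: lcomm_swap[OF assms(1)])

text \<open>The support is recorded because the validity of \<open>Frob\<close> and the position of
  the least variable depend on it.\<close>

lemma lcomm_norm:
  assumes "x \<in> N"
  obtains M where "qred q M" "set_mset M = set xs" "lcomm x (map y xs) = lcomm x (map y (slist M))"
proof -
  have "\<exists>M. qred q M \<and> set_mset M = set xs \<and> lcomm x (map y xs) = lcomm x (map y (slist M))"
  proof (rule reduce_list[OF q])
    fix as bs i j
    show "\<exists>M. qred q M \<and> set_mset M = set (as @ j # i # bs) \<and>
          lcomm x (map y (as @ j # i # bs)) = lcomm x (map y (slist M))"
      if "\<exists>M. qred q M \<and> set_mset M = set (as @ i # j # bs) \<and>
          lcomm x (map y (as @ i # j # bs)) = lcomm x (map y (slist M))"
      using that unfolding lcomm_swap[OF assms, of as j i bs] by (simp add: insert_commute)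
    show "\<exists>M. qred q M \<and> set_mset M = set (replicate q i @ bs) \<and>
          lcomm x (map y (replicate q i @ bs)) = lcomm x (map y (slist M))"
      if "\<exists>M. qred q M \<and> set_mset M = set (i # bs) \<and>
          lcomm x (map y (i # bs)) = lcomm x (map y (slist M))"
      using that q unfolding lcomm_q[OF assms] by simp
  qed auto
  then show ?thesis using that by blast
qed

text \<open>Quantifying over all left factors allows commutators to be rewritten without carrying
  the powers along. By \<open>G_I\<close>, an element of \<open>N\<close> has to be tested on
  reduced sorted powers only.\<close>

definition "G = {t. \<forall>xs. ypow y xs * t \<in> V}"

lemma G_closed: "0 \<in> G" "s \<in> G \<Longrightarrow> t \<in> G \<Longrightarrow> s + t \<in> G" "s \<in> G \<Longrightarrow> t \<in> G \<Longrightarrow> s - t \<in> G"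
  by (simp_all add: G_def V algebra_simps)

lemma G_I:
  assumes "\<And>M. qred q M \<Longrightarrow> ypow y (slist M) * x \<in> V" "x \<in> N"
  shows "x \<in> G"
  using left_norm[of x 1] assms by (simp add: G_def)

text \<open>An entry y_l can be moved to the front, where it commutes with y_l^q - y_l and kills the
  commutator; without such an entry a form \<open>Frob\<close> results.\<close>

lemma frob_G: "lcomm (y l ^ q - y l) (map y ys) \<in> G"
proof (cases "l \<in> set ys")
  case True
  then have "mset ys = mset (l # remove1 l ys)"
    by simp
  then have "lcomm (y l ^ q - y l) (map y ys) = lcomm (y l ^ q - y l) (map y (l # remove1 l ys))"
    by (intro lcomm_perm Om_N frob_Om)
  also have "\<dots> = 0"
    by (simp add: comm_def algebra_simps power_commutes)
  finally show ?thesis by (simp add: G_closed)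
next
  case False
  obtain T where T: "qred q T" "set_mset T = set ys"
    "lcomm (y l ^ q - y l) (map y ys) = lcomm (y l ^ q - y l) (map y (slist T))"
    using lcomm_norm[OF Om_N[OF frob_Om]] by metis
  show ?thesis
    unfolding T(3)
  proof (rule G_I)
    show "ypow y (slist M) * lcomm (y l ^ q - y l) (map y (slist T)) \<in> V" if "qred q M" for M
      using form_V[of "Frob M l T"] that T False by simp
  qed (intro lcomm_N Om_N frob_Om)
qed

text \<open>The case without overflow: the heads \<open>i\<close> and \<open>m\<close> add one to
  each of the two exponents, hence the bounds q - 1.\<close>

lemma com_form_G:
  assumes "qred q M" "count M i < q - 1" "count M m < q - 1" "m < i" "\<And>x. x \<in># M \<Longrightarrow> m \<le> x"
  shows "lcomm (comm (y i) (y m)) (map y (slist M)) \<in> G"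
proof -
  define S where "S = M + {#i, m#}"
  have Min: "Min (set_mset S) = m"
    using assms by (intro Min_eqI) (auto simp: S_def)
  define rest where "rest = replicate (count M m) m @ replicate (count M i) i @
     slist (filter_mset (\<lambda>x. x \<noteq> m \<and> x \<noteq> i) S)"
  have com: "com_list S i = m # rest"
    using assms(4) by (simp add: com_list_def Min rest_def) (simp add: S_def)
  have "mset rest = M"
    using assms(4) by (auto simp: rest_def S_def multiset_eq_iff)
  then have "lcomm (comm (y i) (y m)) (map y (slist M)) = lcomm (comm (y i) (y m)) (map y rest)"
    by (intro lcomm_perm Om_N comm_Om Ev) simp
  then have eq: "lcomm (comm (y i) (y m)) (map y (slist M)) = lcomm (y i) (map y (com_list S i))"
    by (simp add: com)
  show ?thesis
  proof (rule G_I)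
    fix M' :: "nat multiset" assume M': "qred q M'"
    have "qred q S"
      using assms q by (auto simp: qred_def S_def)
    then have "valid q (Com M' S i)"
      using M' Min assms(4) by (simp add: S_def)
    from form_V[OF this] show "ypow y (slist M') * lcomm (comm (y i) (y m)) (map y (slist M)) \<in> V"
      by (simp add: eq)
  qed (intro lcomm_N Om_N comm_Om Ev)
qed

lemma comm_N: "comm (y i) (y j) \<in> N"
  by (intro Om_N comm_Om Ev)

text \<open>A full power \<open>q - 1\<close> of an entry already occurring in the commutator turns
  \<open>[y\<^sub>i, y\<^sub>m]\<close> into \<open>[y\<^sub>i, y\<^sub>m\<^sup>q]\<close>, which is traded for a commutator of type (ii).\<close>

lemma lcomm_full:
  "lcomm (comm (y i) (y m)) (replicate (q - 1) (y m)) =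
    comm (y i) (y m) - comm (y m ^ q - y m) (y i)"
proof -
  have "lcomm (comm (y i) (y m)) (replicate (q - 1) (y m)) = lcomm (y i) (replicate (Suc (q - 1)) (y m))"
    by simp
  also have "\<dots> = comm (y i) (y m ^ q)"
    using q lcomm_power by simp
  finally show ?thesis by (simp add: comm_def algebra_simps)
qed

text \<open>For reduced \<open>M\<close>, q - 1 is the multiplicity at which the head y_m makes the
  total exponent overflow. Those entries are brought to the front, where \<open>lcomm_full\<close>
  removes them all.\<close>

lemma lcomm_full_mset:
  assumes "count M m = q - 1"
  shows "lcomm (comm (y i) (y m)) (map y (slist M)) =
    lcomm (comm (y i) (y m)) (map y (slist (M - replicate_mset (q - 1) m))) -
    lcomm (y m ^ q - y m) (map y (i # slist (M - replicate_mset (q - 1) m)))"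
proof -
  let ?R = "M - replicate_mset (q - 1) m"
  have "M = replicate_mset (q - 1) m + ?R"
    using assms by (simp add: count_le_replicate_mset_subset_eq[symmetric] subset_mset.add_diff_inverse)
  then have "mset (slist M) = mset (replicate (q - 1) m @ slist ?R)"
    by simp
  then have "lcomm (comm (y i) (y m)) (map y (slist M)) =
      lcomm (comm (y i) (y m)) (map y (replicate (q - 1) m @ slist ?R))"
    by (rule lcomm_perm[OF comm_N])
  then show ?thesis
    by (simp only: map_append map_replicate list.map lcomm_append lcomm_full lcomm_diff lcomm_Cons)
qed

text \<open>Both heads can overflow: \<open>step1\<close> repairs the exponent of \<open>m\<close>,
  \<open>step2\<close> that of \<open>i\<close>. A repair removes q - 1 copies, hence all of them,
  so each is needed at most once.\<close>

lemma com_Min_G: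
  assumes "m < i" "\<And>x. x \<in> set ts \<Longrightarrow> m \<le> x"
  shows "lcomm (comm (y i) (y m)) (map y ts) \<in> G"
proof -
  have step1: "lcomm (comm (y i) (y m)) (map y (slist M)) \<in> G"
    if M: "qred q M" "count M i < q - 1" "\<And>x. x \<in># M \<Longrightarrow> m \<le> x" for M
  proof (cases "count M m < q - 1")
    case True
    then show ?thesis
      using M assms by (intro com_form_G) auto
  next
    case False
    then have c: "count M m = q - 1"
      using M(1) by (metis Suc_diff_1 less_antisym qred_def not_less_zero gr_zeroI)
    let ?R = "M - replicate_mset (q - 1) m"
    have R: "qred q ?R" "count ?R i < q - 1" "count ?R m < q - 1" "\<And>x. x \<in># ?R \<Longrightarrow> m \<le> x"
      using M assms c q by (auto simp: qred_def intro: less_imp_diff_less dest: in_diffD)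
    have "lcomm (comm (y i) (y m)) (map y (slist ?R)) \<in> G"
      using com_form_G[OF R(1-3) assms(1) R(4)] .
    then show ?thesis
      unfolding lcomm_full_mset[OF c] by (intro G_closed frob_G)
  qed
  have step2: "lcomm (comm (y i) (y m)) (map y (slist M)) \<in> G"
    if M: "qred q M" "\<And>x. x \<in># M \<Longrightarrow> m \<le> x" for M
  proof (cases "count M i < q - 1")
    case True
    then show ?thesis
      using M by (intro step1) auto
  next
    case False
    then have c: "count M i = q - 1"
      using M(1) by (metis Suc_diff_1 less_antisym qred_def not_less_zero gr_zeroI)
    let ?R = "M - replicate_mset (q - 1) i"
    have R: "qred q ?R" "count ?R i < q - 1" "\<And>x. x \<in># ?R \<Longrightarrow> m \<le> x"
      using M c q by (auto simp: qred_def intro: less_imp_diff_less dest: in_diffD)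
    have "lcomm (comm (y i) (y m)) (map y (slist ?R)) \<in> G"
      using step1[OF R] .
    \<comment> \<open>This is \<open>lcomm_full_mset\<close> with the heads exchanged; antisymmetry
      makes y_i the second head and the correction term positive.\<close>
    moreover have "lcomm (comm (y i) (y m)) (map y (slist M)) =
      lcomm (comm (y i) (y m)) (map y (slist ?R)) +
      lcomm (y i ^ q - y i) (map y (m # slist ?R))"
      using lcomm_full_mset[OF c, of m] unfolding comm_swap[of "y m" "y i"] lcomm_minus
      by (metis (no_types, lifting) add.inverse_inverse minus_diff_eq diff_minus_eq_add add.commute)
    ultimately show ?thesis
      by (simp add: G_closed frob_G del: list.map)
  qed
  obtain M where "qred q M" "set_mset M = set ts"
    "lcomm (comm (y i) (y m)) (map y ts) = lcomm (comm (y i) (y m)) (map y (slist M))"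
    using lcomm_norm[OF comm_N] by metis
  then show ?thesis
    using step2[of M] assms by simp
qed

text \<open>The least index has to become the second head. It is there already, or gets there by
  antisymmetry, or, from among the later entries, by the Jacobi identity.\<close>

lemma com_G: "lcomm (comm (y i) (y j)) (map y ts) \<in> G"
proof -
  define m where "m = Min (set (i # j # ts))"
  have "m \<le> x" if "x \<in> set (i # j # ts)" for x
    unfolding m_def by (rule Min_le[OF finite_set that])
  moreover have "m \<in> set (i # j # ts)"
    unfolding m_def by (rule Min_in) simp_all
  ultimately have m: "m \<le> i" "m \<le> j" "\<And>x. x \<in> set ts \<Longrightarrow> m \<le> x" "m \<in> set (i # j # ts)"
    by simp_all
  have self: "lcomm (comm (y k) (y m)) (map y us) \<in> G" if "m \<le> k" "\<And>x. x \<in> set us \<Longrightarrow> m \<le> x" for k us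
    using that com_Min_G[of m k us] G_closed(1) by (cases "k = m") (auto simp: comm_def)
  consider "m = j" | "m = i" | "m \<in> set ts"
    using m by auto
  then show ?thesis
  proof cases
    case 1
    then show ?thesis using self m by simp
  next
    case 2
    have "lcomm (comm (y i) (y j)) (map y ts) = 0 - lcomm (comm (y j) (y m)) (map y ts)"
      by (simp add: 2 comm_swap[of "y i"] lcomm_minus)
    then show ?thesis
      using self[of j ts] m G_closed by metis
  next
    case 3
    then have "lcomm (comm (y i) (y j)) (map y ts) = lcomm (comm (y i) (y j)) (map y (m # remove1 m ts))"
      by (intro lcomm_perm comm_N) simp
    also have "comm (comm (y i) (y j)) (y m) = comm (comm (y i) (y m)) (y j) - comm (comm (y j) (y m)) (y i)"
      by (simp add: comm_def algebra_simps)
    then have "lcomm (comm (y i) (y j)) (map y (m # remove1 m ts)) =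
        lcomm (comm (y i) (y m)) (map y (j # remove1 m ts)) - lcomm (comm (y j) (y m)) (map y (i # remove1 m ts))"
      by (simp add: lcomm_diff)
    also have "\<dots> \<in> G"
      using m set_remove1_subset[of m ts] by (intro G_closed self) auto
    finally show ?thesis .
  qed
qed

section \<open>Multiplying forms by variables on the right\<close>

lemma lcomm_times_y: "lcomm x (map y ys) * y i = y i * lcomm x (map y ys) + lcomm x (map y (ys @ [i]))"
  by (simp add: lcomm_append comm_def)

lemma ypow_snoc: "ypow y (xs @ [i]) = ypow y xs * y i"
  by simp

text \<open>Each y_b on the right moves left by c y_b = y_b c + [c, y_b], at the price of a longer
  commutator; hence the assumption for all \<open>ys\<close>.\<close>

lemma G_times_ypow:
  assumes "\<And>ys. lcomm w (map y ys) \<in> G"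
  shows "ypow y xs * lcomm w (map y ys) * ypow y bs \<in> V"
proof (induction bs arbitrary: xs ys)
  case Nil
  show ?case using assms by (simp add: G_def)
next
  case (Cons b bs)
  have "ypow y xs * lcomm w (map y ys) * ypow y (b # bs) = ypow y xs * (lcomm w (map y ys) * y b) * ypow y bs"
    by (simp add: mult.assoc)
  also have "\<dots> = ypow y (xs @ [b]) * lcomm w (map y ys) * ypow y bs +
      ypow y xs * lcomm w (map y (ys @ [b])) * ypow y bs"
    unfolding lcomm_times_y ypow_snoc by (simp only: distrib_left distrib_right mult.assoc)
  finally show ?case
    using V(2)[OF Cons.IH[of "xs @ [b]" ys] Cons.IH[of xs "ys @ [b]"]] by (simp only:)
qed

text \<open>Unlike on \<open>N\<close>, sorting or reducing a bare power product leaves a remainder,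
  a product containing [y_j, y_i] or y_i^q - y_i, which \<open>G_times_ypow\<close> places in
  \<open>V\<close>.\<close>

lemma ypow_V: "ypow y xs \<in> V"
proof (rule reduce_list[OF q])
  fix as bs i j
  have "ypow y as * lcomm (comm (y j) (y i)) (map y []) * ypow y bs \<in> V"
    using com_G by (rule G_times_ypow)
  moreover have "ypow y (as @ j # i # bs) = ypow y as * lcomm (comm (y j) (y i)) (map y []) * ypow y bs +
      ypow y (as @ i # j # bs)"
    by (simp add: comm_def algebra_simps)
  ultimately show "ypow y (as @ j # i # bs) \<in> V" if "ypow y (as @ i # j # bs) \<in> V"
    using that V(2) by simp
  have "ypow y [] * lcomm (y i ^ q - y i) (map y []) * ypow y bs \<in> V"
    using frob_G by (rule G_times_ypow)
  moreover have "ypow y (replicate q i @ bs) = ypow y [] * lcomm (y i ^ q - y i) (map y []) * ypow y bs +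
      ypow y (i # bs)"
    by (simp add: algebra_simps)
  ultimately show "ypow y (replicate q i @ bs) \<in> V" if "ypow y (i # bs) \<in> V"
    using that V(2) by simp
  show "ypow y (slist M) \<in> V" if "qred q M" for M
    using form_V[of "Pow M"] that by simp
qed

lemma z_N: "z j \<in> N"
  by (intro Od_N Od)

lemma one_V: "ypow y xs * lcomm (z j) (map y ys) \<in> V"
proof -
  obtain S where S: "qred q S" "lcomm (z j) (map y ys) = lcomm (z j) (map y (slist S))"
    using lcomm_norm[OF z_N] by metis
  have "lcomm (z j) (map y ys) \<in> G"
  proof (rule G_I)
    show "ypow y (slist M) * lcomm (z j) (map y ys) \<in> V" if "qred q M" for M
      using form_V[of "One M j S"] that S by simp
  qed (intro lcomm_N z_N)
  then show ?thesis by (simp add: G_def)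
qed

lemma two_V: "ypow y xs * lcomm (z j) (map y ys) * lcomm (z k) (map y ts) \<in> V"
proof -
  obtain S where S: "qred q S" "lcomm (z j) (map y ys) = lcomm (z j) (map y (slist S))"
    using lcomm_norm[OF z_N] by metis
  obtain T where T: "qred q T" "lcomm (z k) (map y ts) = lcomm (z k) (map y (slist T))"
    using lcomm_norm[OF z_N] by metis
  show ?thesis
  proof (rule left_norm)
    show "ypow y (slist M) * lcomm (z j) (map y ys) * lcomm (z k) (map y ts) \<in> V" if "qred q M" for M
      using form_V[of "Two M j S k T"] that S T by simp
  qed (intro lcomm_N z_N)
qed

text \<open>Annihilating \<open>Od\<close> from the left survives bracketing with y_a, because y_a
  times an odd element is again odd.\<close>

lemma lcomm_z_zero:
  assumes "\<And>o1. o1 \<in> Od \<Longrightarrow> x * o1 = 0"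
  shows "lcomm x (map y xs) * z j = 0"
proof -
  have "lcomm x (map y xs) * o1 = 0" if "o1 \<in> Od" for o1
    using assms that
  proof (induction xs arbitrary: x o1)
    case (Cons a xs)
    have "comm x (y a) * o2 = 0" if "o2 \<in> Od" for o2
      using Cons.prems(1) that by (simp add: comm_def left_diff_distrib mult.assoc Od Ev)
    then show ?case
      using Cons.IH Cons.prems(2) by simp
  qed simp
  then show ?thesis by (simp add: Od)
qed

lemma com_list_nonempty: "i \<in># S \<Longrightarrow> com_list S i \<noteq> []"
proof -
  assume "i \<in># S"
  then have "Min (set_mset S) \<in># S"
    by (intro Min_in) auto
  then show ?thesis
    by (simp add: com_list_def Let_def)
qed

text \<open>Together with \<open>form_times_z\<close> this makes the span of the forms, which
  contains the unit \<open>Pow {#}\<close>, stable under right multiplication by variables, so that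
  every word reduces to forms.\<close>

lemma form_times_y: "valid q ix \<Longrightarrow> form q y z ix * y i \<in> V"
proof (cases ix)
  case (Pow M)
  then show ?thesis
    using ypow_V[of "slist M @ [i]"] by simp
next
  case (Com M S j)
  then have "com_list S j \<noteq> [] \<Longrightarrow> ?thesis"
    using G_times_ypow[OF com_G, of "slist M" j "hd (com_list S j)" "tl (com_list S j)" "[i]"]
    by (cases "com_list S j") auto
  moreover assume "valid q ix"
  then have "com_list S j \<noteq> []"
    using Com com_list_nonempty by simp
  ultimately show ?thesis by blast
next
  case (Frob M l T)
  then show ?thesis
    using G_times_ypow[OF frob_G, of "slist M" l "slist T" "[i]"] by simp
next
  case (One M j S)
  have "form q y z ix * y i = ypow y (slist M @ [i]) * lcomm (z j) (map y (slist S)) +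
      ypow y (slist M) * lcomm (z j) (map y (slist S @ [i]))"
    using lcomm_times_y[of "z j" "slist S" i]
    by (simp add: One mult.assoc distrib_left)
  then show ?thesis
    by (simp only: V(2)[OF one_V one_V])
next
  case (Two M j S k T)
  let ?X = "lcomm (z j) (map y (slist S))" and ?Z = "lcomm (z k) (map y (slist T))"
  \<comment> \<open>On its way to the left y_i passes both odd commutators and leaves a bracket in
    each, which gives three terms.\<close>
  have "form q y z ix * y i = ypow y (slist M) * (?X * y i) * ?Z +
      ypow y (slist M) * ?X * lcomm (z k) (map y (slist T @ [i]))"
    using lcomm_times_y[of "z k" "slist T" i]
    by (simp add: Two mult.assoc distrib_left)
  also have "ypow y (slist M) * (?X * y i) * ?Z =
      ypow y (slist M @ [i]) * ?X * ?Z + ypow y (slist M) * lcomm (z j) (map y (slist S @ [i])) * ?Z"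
    unfolding lcomm_times_y[of "z j" "slist S" i] ypow_snoc
    by (simp only: mult.assoc distrib_left distrib_right)
  finally show ?thesis
    by (simp only: V(2)[OF V(2)[OF two_V two_V] two_V])
qed

lemma form_times_z: "valid q ix \<Longrightarrow> form q y z ix * z k \<in> V"
proof (cases ix)
  case (Pow M)
  then show ?thesis
    using one_V[of "slist M" k "[]"] by simp
next
  case (Com M S j)
  \<comment> \<open>The innermost bracket lies in \<open>Om\<close>, hence kills odd elements, and
    the outer brackets inherit this.\<close>
  then have *: "com_list S j \<noteq> [] \<Longrightarrow> ?thesis"
    using lcomm_z_zero[of "comm (y j) (y (hd (com_list S j)))" "tl (com_list S j)" k] V(1)
    by (cases "com_list S j") (auto simp: mult.assoc wz comm_Om Ev)
  assume "valid q ix"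
  then have "com_list S j \<noteq> []"
    using Com com_list_nonempty by simp
  then show ?thesis using * by blast
next
  case (Frob M l T)
  then show ?thesis
    using lcomm_z_zero[of "y l ^ q - y l" "slist T" k] V(1) wz frob_Om by (simp add: mult.assoc)
next
  case (One M j S)
  then show ?thesis
    using two_V[of "slist M" j "slist S" k "[]"] by simp
next
  case (Two M j S l T)
  then show ?thesis
    using zzz[OF lcomm_Od[OF Od(1)] lcomm_Od[OF Od(1)] Od(1), of j "slist S" l "slist T" k] V(1)
    by (simp add: mult.assoc)
qed

end


section \<open>Finite fields\<close>

lemma card_field_ge_2: "2 \<le> CARD('f::{finite,field})"
proof -
  have "card {0, 1 :: 'f} \<le> CARD('f)"
    by (intro card_mono) auto
  then show ?thesis by simp
qed

text \<open>Multiplication by x permutes the nonzero elements and so preserves their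
  product.\<close>

lemma power_card_minus_1:
  fixes x :: "'f::{finite,field}"
  assumes "x \<noteq> 0"
  shows "x ^ (CARD('f) - 1) = 1"
proof -
  have "(\<Prod>t\<in>-{0}. x * t) = (\<Prod>t\<in>-{0}. t)"
    by (rule prod.reindex_bij_witness[of _ "\<lambda>t. t / x" "\<lambda>t. x * t"]) (use assms in auto)
  moreover have "(\<Prod>t\<in>-{0}. x * t) = x ^ (CARD('f) - 1) * (\<Prod>t\<in>-{0}. t)"
    by (simp add: prod.distrib Compl_eq_Diff_UNIV)
  ultimately show ?thesis
    by (simp add: prod_zero_iff)
qed

lemma power_card:
  fixes x :: "'f::{finite,field}"
  shows "x ^ CARD('f) = x"
proof -
  have "x ^ CARD('f) = x * x ^ (CARD('f) - 1)"
    using card_field_ge_2[where 'f='f] by (simp flip: power_Suc)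
  then show ?thesis
    using power_card_minus_1[of x] by (cases "x = 0") auto
qed

text \<open>The polynomial (X + 1)^q - X^q - 1 has degree below q and vanishes at all q elements of
  the field, so its coefficients, the inner binomials, are zero.\<close>

lemma of_nat_card_choose:
  assumes "0 < k" "k < CARD('f::{finite,field})"
  shows "of_nat (CARD('f) choose k) = (0 :: 'f)"
proof -
  let ?q = "CARD('f)"
  define p where "p = (\<Sum>k\<in>{0<..<?q}. monom (of_nat (?q choose k) :: 'f) k)"
  have "poly p x = poly 0 x" for x
  proof -
    have split: "{..?q} = insert 0 (insert ?q {0<..<?q})"
      using card_field_ge_2[where 'f='f] by auto
    have "(x + 1) ^ ?q = (\<Sum>k\<le>?q. of_nat (?q choose k) * x ^ k)"
      by (simp add: binomial_ring)
    also have "\<dots> = 1 + x ^ ?q + poly p x"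
      unfolding split using card_field_ge_2[where 'f='f]
      by (simp add: p_def poly_sum poly_monom)
    finally show ?thesis
      by (simp add: power_card)
  qed
  moreover have "degree p < ?q"
    unfolding p_def using card_field_ge_2[where 'f='f]
    by (intro degree_sum_less) (auto intro: le_less_trans[OF degree_monom_le])
  ultimately have "p = 0"
    by (intro poly_eqI_degree[of UNIV]) auto
  then have "coeff p k = 0"
    by simp
  also have "coeff p k = of_nat (?q choose k)"
    using assms by (simp add: p_def coeff_sum)
  finally show ?thesis .
qed


section \<open>Evaluation homomorphisms of the free algebra\<close>

lemma ncpoly_eq_sum:
  "f = (\<Sum>w\<in>Poly_Mapping.keys f. Poly_Mapping.single w (Poly_Mapping.lookup f w))"
  by (rule poly_mapping_eqI) (auto simp: lookup_sum lookup_single when_def in_keys_iff)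

text \<open>The case \<open>single\<close> is restricted to words of \<open>f\<close>, which keeps
  properties such as being nonempty or of given parity available.\<close>

lemma ncpoly_induct [case_names zero single add]:
  fixes f :: "'f::field ncpoly"
  assumes zero: "P 0"
    and single: "\<And>w c. w \<in> Poly_Mapping.keys f \<Longrightarrow> P (Poly_Mapping.single w c)"
    and add: "\<And>g h. P g \<Longrightarrow> P h \<Longrightarrow> P (g + h)"
  shows "P f"
proof -
  have "P (\<Sum>w\<in>W. Poly_Mapping.single w (Poly_Mapping.lookup f w))"
    if "finite W" "W \<subseteq> Poly_Mapping.keys f" for W
    using that by (induction W) (auto intro: assms)
  then show ?thesis
    using ncpoly_eq_sum[of f] by (metis finite_keys order_refl)
qed

lemma nc_scale_single: "nc_scale c (Poly_Mapping.single w a) = Poly_Mapping.single w (c * a)"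
  by (rule poly_mapping_eqI) (simp add: lookup_single when_def)

lemma nc_scale_mult_left: "nc_scale c f * g = nc_scale c (f * g)"
  by (simp add: nc_scale_conv_mult mult.assoc)

lemma single_0_commute:
  fixes f :: "'f::field ncpoly"
  shows "Poly_Mapping.single 0 c * f = f * Poly_Mapping.single 0 c"
  by (induction f rule: ncpoly_induct) (simp_all add: mult_single algebra_simps)

lemma nc_scale_mult_right: "f * nc_scale c g = nc_scale c (f * g)"
  by (simp add: nc_scale_conv_mult single_0_commute mult.assoc)

lemma letters_0 [simp]: "letters 0 = []"
  and letters_add [simp]: "letters (u + v) = letters u @ letters v"
  by (simp_all add: zero_word_def plus_word_def)

lemma word_eq_0_iff: "w = 0 \<longleftrightarrow> letters w = []"
  by (cases w) (simp add: zero_word_def)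

text \<open>A central homomorphic image of the field turns the ring into an algebra, and
  \<open>ev\<close> is the homomorphism given by the universal property of the free unital algebra.
  It serves both for substitutions (\<open>nc\<close>) and for matrices (\<open>ut\<close>).\<close>

locale scalars =
  fixes C :: "'f::field \<Rightarrow> 'a::ring_1"
  assumes C_0 [simp]: "C 0 = 0" and C_1 [simp]: "C 1 = 1"
    and C_add: "C (s + t) = C s + C t" and C_mult: "C (s * t) = C s * C t"
    and C_commute: "C s * x = x * C s"
begin

definition ev :: "(var \<Rightarrow> 'a) \<Rightarrow> 'f ncpoly \<Rightarrow> 'a" where
  "ev \<phi> f = (\<Sum>w\<in>Poly_Mapping.keys f. C (Poly_Mapping.lookup f w) * prod_list (map \<phi> (letters w)))"

lemma ev_single: "ev \<phi> (Poly_Mapping.single w c) = C c * prod_list (map \<phi> (letters w))"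
  by (simp add: ev_def)

lemma ev_0 [simp]: "ev \<phi> 0 = 0"
  by (simp add: ev_def)

lemma ev_1 [simp]: "ev \<phi> 1 = 1"
  using ev_single[of \<phi> 0 1] by simp

lemma ev_add: "ev \<phi> (f + g) = ev \<phi> f + ev \<phi> g"
  unfolding ev_def by (rule setsum_keys_plus_distrib) (simp_all add: C_add distrib_right)

lemma ev_minus: "ev \<phi> (- f) = - ev \<phi> f"
  using ev_add[of \<phi> f "- f"] by (simp add: eq_neg_iff_add_eq_0 add.commute)

lemma ev_diff: "ev \<phi> (f - g) = ev \<phi> f - ev \<phi> g"
  using ev_add[of \<phi> f "- g"] by (simp add: ev_minus)

lemma ev_sum: "ev \<phi> (sum g T) = (\<Sum>t\<in>T. ev \<phi> (g t))"
  by (induction T rule: infinite_finite_induct) (simp_all add: ev_add)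

lemma ev_mult: "ev \<phi> (f * g) = ev \<phi> f * ev \<phi> g"
proof (induction f rule: ncpoly_induct)
  case (single w c)
  show ?case
  proof (induction g rule: ncpoly_induct)
    case (single w' c')
    have "C c * (C c' * (x * x')) = C c * (x * (C c' * x'))" for x x'
      by (metis C_commute mult.assoc)
    then show ?case
      by (simp add: ev_single mult_single C_mult mult.assoc)
  qed (simp_all add: distrib_left ev_add)
qed (simp_all add: distrib_right ev_add)

lemma ev_scale: "ev \<phi> (nc_scale c f) = C c * ev \<phi> f"
  by (simp add: nc_scale_conv_mult ev_mult ev_single)

lemma ev_power: "ev \<phi> (f ^ n) = ev \<phi> f ^ n"
  by (induction n) (simp_all add: ev_mult)

lemma ev_yvar [simp]: "ev \<phi> (yvar i) = \<phi> (Y i)"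
  and ev_zvar [simp]: "ev \<phi> (zvar i) = \<phi> (Z i)"
  by (simp_all add: yvar_def zvar_def ev_single)

lemma ev_comm: "ev \<phi> (comm f g) = comm (ev \<phi> f) (ev \<phi> g)"
  by (simp add: comm_def ev_mult ev_diff)

lemma ev_lcomm: "ev \<phi> (lcomm f gs) = lcomm (ev \<phi> f) (map (ev \<phi>) gs)"
  by (induction gs arbitrary: f) (simp_all add: ev_comm)

lemma ev_ypow: "ev \<phi> (ypow yvar xs) = ypow (\<lambda>i. \<phi> (Y i)) xs"
  by (induction xs) (simp_all add: ev_mult)

lemma ev_form: "ev \<phi> (form q yvar zvar ix) = form q (\<lambda>i. \<phi> (Y i)) (\<lambda>i. \<phi> (Z i)) ix"
  by (cases ix) (simp_all add: ev_mult ev_lcomm ev_ypow ev_diff ev_power comp_def)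

end


section \<open>The grading\<close>

text \<open>Unlike \<open>free_even\<close>, the even part includes the constants. With
  \<open>True\<close> for even, equality of Booleans is addition of degrees modulo 2.\<close>

definition parity_part :: "bool \<Rightarrow> 'f::field ncpoly set" where
  "parity_part b = {f. \<forall>w\<in>Poly_Mapping.keys f. even (zdeg w) = b}"

lemma zdeg_add [simp]: "zdeg (u + v) = zdeg u + zdeg v"
  and zdeg_0 [simp]: "zdeg 0 = 0"
  by (simp_all add: zdeg_def)

lemma free_alg_iff: "f \<in> free_alg \<longleftrightarrow> 0 \<notin> Poly_Mapping.keys f"
  by (simp add: free_alg_def in_keys_iff)

lemma odd_free_alg: "f \<in> parity_part False \<Longrightarrow> f \<in> free_alg"
  unfolding parity_part_def free_alg_iff by force

lemma subspace_keys: "ncpoly.subspace {f :: 'f::field ncpoly. \<forall>w\<in>Poly_Mapping.keys f. P w}"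
  unfolding ncpoly.subspace_def
  by (auto simp: in_keys_iff lookup_add)

lemma span_monomials:
  "ncpoly.span {Poly_Mapping.single w 1 | w. P w} = {f :: 'f::field ncpoly. \<forall>w\<in>Poly_Mapping.keys f. P w}"
proof (intro equalityI ncpoly.span_minimal subspace_keys subsetI)
  fix f :: "'f ncpoly" assume f: "f \<in> {f. \<forall>w\<in>Poly_Mapping.keys f. P w}"
  have piece: "Poly_Mapping.single w c \<in> ncpoly.span {Poly_Mapping.single w 1 | w. P w}"
    if "w \<in> Poly_Mapping.keys f" for w c
  proof -
    have "nc_scale c (Poly_Mapping.single w 1) \<in> ncpoly.span {Poly_Mapping.single w 1 | w. P w}"
      using f that by (intro ncpoly.span_scale ncpoly.span_base) auto
    then show ?thesis by (simp add: nc_scale_single)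
  qed
  show "f \<in> ncpoly.span {Poly_Mapping.single w 1 | w. P w}"
    by (induction f rule: ncpoly_induct) (auto intro: piece ncpoly.span_add ncpoly.span_zero)
qed auto

lemma free_even_eq: "free_even = parity_part True \<inter> free_alg"
  unfolding free_even_def span_monomials by (auto simp: parity_part_def free_alg_iff)

lemma free_odd_eq: "free_odd = parity_part False"
  unfolding free_odd_def span_monomials by (auto simp: parity_part_def)

lemma parity_part_closed:
  "0 \<in> parity_part b"
  "f \<in> parity_part b \<Longrightarrow> g \<in> parity_part b \<Longrightarrow> f + g \<in> parity_part b"
  "f \<in> parity_part b \<Longrightarrow> g \<in> parity_part b' \<Longrightarrow> f * g \<in> parity_part (b = b')"
  "Poly_Mapping.single 0 c \<in> parity_part True"
  "yvar i \<in> parity_part True" "zvar i \<in> parity_part False"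
proof -
  show "f * g \<in> parity_part (b = b')" if "f \<in> parity_part b" "g \<in> parity_part b'"
    using that keys_mult[of f g] unfolding parity_part_def by fastforce
  show "f + g \<in> parity_part b" if "f \<in> parity_part b" "g \<in> parity_part b"
    using that keys_add[of f g] unfolding parity_part_def by fastforce
qed (auto simp: parity_part_def yvar_def zvar_def zdeg_def)

lemma parity_part_diff:
  "f \<in> parity_part b \<Longrightarrow> g \<in> parity_part b \<Longrightarrow> f - g \<in> parity_part b"
  using keys_diff[of f g] unfolding parity_part_def by fastforce

lemma free_alg_mult:
  fixes f g :: "'f::field ncpoly"
  assumes "f \<in> free_alg \<or> g \<in> free_alg"
  shows "f * g \<in> free_alg"
proof -
  have zero: "u = 0 \<and> v = 0" if "u + v = 0" for u v :: word
    using that unfolding word_eq_0_iff by simp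
  have "0 \<notin> Poly_Mapping.keys (f * g)"
  proof
    assume "0 \<in> Poly_Mapping.keys (f * g)"
    then have "0 \<in> {u + v | u v. u \<in> Poly_Mapping.keys f \<and> v \<in> Poly_Mapping.keys g}"
      by (rule subsetD[OF keys_mult])
    then obtain u v where uv: "0 = u + v" "u \<in> Poly_Mapping.keys f" "v \<in> Poly_Mapping.keys g"
      by blast
    with zero[OF uv(1)[symmetric]] show False
      using assms by (simp add: free_alg_iff)
  qed
  then show ?thesis
    by (simp add: free_alg_iff)
qed

context scalars
begin

text \<open>The grading \<open>S\<close> of the target is abstract, so one argument covers
  substitutions in the free algebra and evaluations at matrices.\<close>

lemma ev_parity:
  assumes "\<And>b. 0 \<in> S b" "\<And>b x x'. x \<in> S b \<Longrightarrow> x' \<in> S b \<Longrightarrow> x + x' \<in> S b"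
    and mult: "\<And>b b' x x'. x \<in> S b \<Longrightarrow> x' \<in> S b' \<Longrightarrow> x * x' \<in> S (b = b')"
    and C: "\<And>c. C c \<in> S True"
    and "\<And>i. \<phi> (Y i) \<in> S True" "\<And>i. \<phi> (Z i) \<in> S False"
    and f: "f \<in> parity_part b"
  shows "ev \<phi> f \<in> S b"
proof -
  have words: "prod_list (map \<phi> vs) \<in> S (even (zdeg (Word vs)))" for vs
  proof (induction vs)
    case Nil
    show ?case using C[of 1] by (simp add: zdeg_def)
  next
    case (Cons v vs)
    have "\<phi> v \<in> S (even (zdeg (Word [v])))"
      using assms by (cases v) (auto simp: zdeg_def)
    from mult[OF this Cons.IH] show ?case
      by (cases v) (simp_all add: zdeg_def)
  qed
  have piece: "C c * prod_list (map \<phi> (letters w)) \<in> S b" if "w \<in> Poly_Mapping.keys f" for w c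
    using mult[OF C words[of "letters w"], of c] that f by (simp add: parity_part_def)
  show ?thesis
    by (induction f rule: ncpoly_induct) (auto simp: ev_add ev_single assms intro: piece)
qed

end

interpretation nc: scalars "Poly_Mapping.single 0 :: 'f::field \<Rightarrow> 'f ncpoly"
  by unfold_locales (simp_all add: single_add mult_single single_0_commute)

lemma super_endo_ev:
  fixes \<phi> :: "var \<Rightarrow> 'f::field ncpoly"
  assumes "\<And>i. \<phi> (Y i) \<in> free_even" "\<And>i. \<phi> (Z i) \<in> free_odd"
  shows "super_endo (nc.ev \<phi>)"
proof -
  have alg: "\<phi> v \<in> free_alg" for v
    using assms by (cases v) (auto simp: free_even_eq free_odd_eq odd_free_alg)
  have words: "prod_list (map \<phi> vs) \<in> free_alg" if "vs \<noteq> []" for vs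
    using that alg by (cases vs) (auto intro: free_alg_mult)
  have free: "nc.ev \<phi> f \<in> free_alg" if "f \<in> free_alg" for f
  proof -
    have piece: "Poly_Mapping.single 0 c * prod_list (map \<phi> (letters w)) \<in> free_alg"
      if "w \<in> Poly_Mapping.keys f" for w c
    proof -
      have "letters w \<noteq> []"
        using that \<open>f \<in> free_alg\<close> unfolding word_eq_0_iff[symmetric] by (auto simp: free_alg_iff)
      then show ?thesis
        by (intro free_alg_mult disjI2 words)
    qed
    show ?thesis
      by (induction f rule: ncpoly_induct)
        (auto simp: nc.ev_add nc.ev_single ncpoly.subspace_0[OF subspace_free_alg]
          intro: piece ncpoly.subspace_add[OF subspace_free_alg])
  qed
  have par: "nc.ev \<phi> f \<in> parity_part b" if "f \<in> parity_part b" for f b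
    by (rule nc.ev_parity[OF _ _ _ _ _ _ that])
      (use assms in \<open>auto simp: parity_part_closed free_even_eq free_odd_eq\<close>)
  show ?thesis
    unfolding super_endo_def
    using free par by (auto simp: nc.ev_add nc.ev_mult nc_scale_conv_mult nc.ev_single free_even_eq free_odd_eq)
qed


section \<open>Upper triangular matrices\<close>

text \<open>A type of its own provides a ring whose \<open>*\<close> is the matrix product, so that
  \<open>form\<close> and \<open>ev\<close> apply. The first four entries make up the even part, the
  last two the odd part.\<close>

datatype 'f ut = UT (ut11: 'f) (ut22: 'f) (ut33: 'f) (ut13: 'f) (ut12: 'f) (ut23: 'f)

instantiation ut :: (comm_ring_1) ring_1
begin

definition "0 = UT 0 0 0 0 0 0"
definition "1 = UT 1 1 1 0 0 0"
definition "A + B = UT (ut11 A + ut11 B) (ut22 A + ut22 B) (ut33 A + ut33 B)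
  (ut13 A + ut13 B) (ut12 A + ut12 B) (ut23 A + ut23 B)"
definition "A - B = UT (ut11 A - ut11 B) (ut22 A - ut22 B) (ut33 A - ut33 B)
  (ut13 A - ut13 B) (ut12 A - ut12 B) (ut23 A - ut23 B)"
definition "- A = UT (- ut11 A) (- ut22 A) (- ut33 A) (- ut13 A) (- ut12 A) (- ut23 A)"
definition "A * B = UT (ut11 A * ut11 B) (ut22 A * ut22 B) (ut33 A * ut33 B)
  (ut11 A * ut13 B + ut12 A * ut23 B + ut13 A * ut33 B)
  (ut11 A * ut12 B + ut12 A * ut22 B) (ut22 A * ut23 B + ut23 A * ut33 B)"

instance
  by standard
    (simp_all add: zero_ut_def one_ut_def plus_ut_def minus_ut_def uminus_ut_def times_ut_def algebra_simps
      ut.expand)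

end

lemma ut_sel [simp]:
  "ut11 0 = 0" "ut22 0 = 0" "ut33 0 = 0" "ut13 0 = 0" "ut12 0 = 0" "ut23 0 = 0"
  "ut11 1 = 1" "ut22 1 = 1" "ut33 1 = 1" "ut13 1 = 0" "ut12 1 = 0" "ut23 1 = 0"
  "ut11 (A + B) = ut11 A + ut11 B" "ut22 (A + B) = ut22 A + ut22 B" "ut33 (A + B) = ut33 A + ut33 B"
  "ut13 (A + B) = ut13 A + ut13 B" "ut12 (A + B) = ut12 A + ut12 B" "ut23 (A + B) = ut23 A + ut23 B"
  "ut11 (A - B) = ut11 A - ut11 B" "ut22 (A - B) = ut22 A - ut22 B" "ut33 (A - B) = ut33 A - ut33 B"
  "ut13 (A - B) = ut13 A - ut13 B" "ut12 (A - B) = ut12 A - ut12 B" "ut23 (A - B) = ut23 A - ut23 B"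
  "ut11 (A * B) = ut11 A * ut11 B" "ut22 (A * B) = ut22 A * ut22 B" "ut33 (A * B) = ut33 A * ut33 B"
  "ut13 (A * B) = ut11 A * ut13 B + ut12 A * ut23 B + ut13 A * ut33 B"
  "ut12 (A * B) = ut11 A * ut12 B + ut12 A * ut22 B" "ut23 (A * B) = ut22 A * ut23 B + ut23 A * ut33 B"
  by (simp_all add: zero_ut_def one_ut_def plus_ut_def minus_ut_def times_ut_def)

lemma ut_eq_iff: "A = B \<longleftrightarrow> ut11 A = ut11 B \<and> ut22 A = ut22 B \<and> ut33 A = ut33 B \<and>
    ut13 A = ut13 B \<and> ut12 A = ut12 B \<and> ut23 A = ut23 B"
  by (cases A; cases B) simp

lemma ut_sel_power [simp]:
  "ut11 (A ^ n) = ut11 A ^ n" "ut22 (A ^ n) = ut22 A ^ n" "ut33 (A ^ n) = ut33 A ^ n"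
  by (induction n) simp_all

definition ut_const :: "'f \<Rightarrow> 'f::comm_ring_1 ut" where
  "ut_const c = UT c c c 0 0 0"

interpretation ut: scalars "ut_const :: 'f::field \<Rightarrow> 'f ut"
  by unfold_locales (simp_all add: ut_const_def ut_eq_iff)

definition ut_part :: "bool \<Rightarrow> 'f::comm_ring_1 ut set" where
  "ut_part b = (if b then {A. ut12 A = 0 \<and> ut23 A = 0}
     else {A. ut11 A = 0 \<and> ut22 A = 0 \<and> ut33 A = 0 \<and> ut13 A = 0})"

definition graded :: "(var \<Rightarrow> 'f::comm_ring_1 ut) \<Rightarrow> bool" where
  "graded \<phi> \<longleftrightarrow> (\<forall>i. \<phi> (Y i) \<in> ut_part True \<and> \<phi> (Z i) \<in> ut_part False)"

lemma ev_ut_part: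
  assumes "graded \<phi>" "f \<in> parity_part b"
  shows "ut.ev \<phi> f \<in> ut_part b"
  by (rule ut.ev_parity[OF _ _ _ _ _ _ assms(2)])
    (use assms(1) in \<open>auto simp: ut_part_def graded_def ut_const_def split: if_splits\<close>)

section \<open>Comparison with the graded matrix algebra\<close>

definition ut_mat :: "'f::field ut \<Rightarrow> 'f^3^3" where
  "ut_mat A = mat_scale (ut11 A) (elem_mat 1 1) + mat_scale (ut22 A) (elem_mat 2 2) +
     mat_scale (ut33 A) (elem_mat 3 3) + mat_scale (ut13 A) (elem_mat 1 3) +
     mat_scale (ut12 A) (elem_mat 1 2) + mat_scale (ut23 A) (elem_mat 2 3)"

lemma ut_mat_nth:
  "ut_mat A $ 1 $ 1 = ut11 A" "ut_mat A $ 1 $ 2 = ut12 A" "ut_mat A $ 1 $ 3 = ut13 A"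
  "ut_mat A $ 2 $ 1 = 0" "ut_mat A $ 2 $ 2 = ut22 A" "ut_mat A $ 2 $ 3 = ut23 A"
  "ut_mat A $ 3 $ 1 = 0" "ut_mat A $ 3 $ 2 = 0" "ut_mat A $ 3 $ 3 = ut33 A"
  by (simp_all add: ut_mat_def mat_scale_def elem_mat_def axis_def)

lemma mat3_eq_iff: "A = B \<longleftrightarrow> (\<forall>i\<in>{1,2,3}. \<forall>j\<in>{1,2,3}. A $ i $ j = B $ i $ j)"
  for A B :: "'f^3^3"
  by (simp add: vec_eq_iff forall_3)

lemma ut_mat_mult: "ut_mat (A * B) = ut_mat A ** ut_mat B"
  by (simp add: mat3_eq_iff ut_mat_nth matrix_matrix_mult_def sum_3)

lemma ut_mat_1: "ut_mat 1 = mat 1"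
  by (simp add: mat3_eq_iff ut_mat_nth mat_def)

lemma ut_mat_0: "ut_mat 0 = 0"
  by (simp add: mat3_eq_iff ut_mat_nth)

lemma ut_mat_add: "ut_mat (A + B) = ut_mat A + ut_mat B"
  by (simp add: mat3_eq_iff ut_mat_nth)

lemma ut_mat_const: "ut_mat (ut_const c * A) = mat_scale c (ut_mat A)"
  by (simp add: mat3_eq_iff ut_mat_nth mat_scale_def) (simp add: ut_const_def)

lemma ut_mat_inject: "ut_mat A = ut_mat B \<longleftrightarrow> A = B"
  by (auto simp: mat3_eq_iff ut_mat_nth ut_eq_iff)

lemma nc_eval_ut_mat: "nc_eval (\<lambda>v. ut_mat (\<phi> v)) f = ut_mat (ut.ev \<phi> f)"
proof -
  have words: "foldr (\<lambda>v. (**) (ut_mat (\<phi> v))) vs (mat 1) = ut_mat (prod_list (map \<phi> vs))" for vs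
    by (induction vs) (simp_all add: ut_mat_mult ut_mat_1)
  have sums: "ut_mat (sum g W) = (\<Sum>w\<in>W. ut_mat (g w))" for g and W :: "word set"
    by (induction W rule: infinite_finite_induct) (simp_all add: ut_mat_0 ut_mat_add)
  show ?thesis
    by (simp add: nc_eval_def eval_word_def ut.ev_def sums words ut_mat_const)
qed

lemma elem_mat_eq_ut_mat:
  "elem_mat 1 1 = ut_mat (UT 1 0 0 0 0 0)" "elem_mat 2 2 = ut_mat (UT 0 1 0 0 0 0)"
  "elem_mat 3 3 = ut_mat (UT 0 0 1 0 0 0)" "elem_mat 1 3 = ut_mat (UT 0 0 0 1 0 0)"
  "elem_mat 1 2 = ut_mat (UT 0 0 0 0 1 0)" "elem_mat 2 3 = ut_mat (UT 0 0 0 0 0 1)"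
  by (simp_all add: ut_mat_def)

lemma UT3_even_eq: "UT3_even = ut_mat ` ut_part True"
proof
  show "UT3_even \<subseteq> ut_mat ` (ut_part True :: 'a ut set)"
    unfolding UT3_even_def
  proof (rule mats.span_minimal)
    show "{elem_mat 1 1, elem_mat 2 2, elem_mat 3 3, elem_mat 1 3} \<subseteq> ut_mat ` (ut_part True :: 'a ut set)"
      unfolding elem_mat_eq_ut_mat by (auto simp: ut_part_def)
    show "mats.subspace (ut_mat ` (ut_part True :: 'a ut set))"
      unfolding mats.subspace_def
    proof (intro conjI ballI allI)
      show "0 \<in> ut_mat ` (ut_part True :: 'a ut set)"
        using ut_mat_0 by (force simp: ut_part_def)
      show "x + x' \<in> ut_mat ` ut_part True" if "x \<in> ut_mat ` ut_part True" "x' \<in> ut_mat ` ut_part True"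
        for x x' :: "'a^3^3"
        using that by (auto simp: ut_part_def simp flip: ut_mat_add)
      show "mat_scale c x \<in> ut_mat ` ut_part True" if "x \<in> ut_mat ` ut_part True" for c and x :: "'a^3^3"
        using that by (auto simp: ut_part_def ut_const_def simp flip: ut_mat_const)
    qed
  qed
  show "ut_mat ` (ut_part True :: 'a ut set) \<subseteq> UT3_even"
    unfolding UT3_even_def ut_mat_def
    by (auto simp: ut_part_def) (intro mats.span_add mats.span_scale; simp add: mats.span_base)
qed

lemma UT3_odd_eq: "UT3_odd = ut_mat ` ut_part False"
proof
  show "UT3_odd \<subseteq> ut_mat ` (ut_part False :: 'a ut set)"
    unfolding UT3_odd_def
  proof (rule mats.span_minimal)
    show "{elem_mat 1 2, elem_mat 2 3} \<subseteq> ut_mat ` (ut_part False :: 'a ut set)"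
      unfolding elem_mat_eq_ut_mat by (auto simp: ut_part_def)
    show "mats.subspace (ut_mat ` (ut_part False :: 'a ut set))"
      unfolding mats.subspace_def
    proof (intro conjI ballI allI)
      show "0 \<in> ut_mat ` (ut_part False :: 'a ut set)"
        using ut_mat_0 by (force simp: ut_part_def)
      show "x + x' \<in> ut_mat ` ut_part False" if "x \<in> ut_mat ` ut_part False" "x' \<in> ut_mat ` ut_part False"
        for x x' :: "'a^3^3"
        using that by (auto simp: ut_part_def simp flip: ut_mat_add)
      show "mat_scale c x \<in> ut_mat ` ut_part False" if "x \<in> ut_mat ` ut_part False" for c and x :: "'a^3^3"
        using that by (auto simp: ut_part_def ut_const_def simp flip: ut_mat_const)
    qed
  qed
  show "ut_mat ` (ut_part False :: 'a ut set) \<subseteq> UT3_odd"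
    unfolding UT3_odd_def ut_mat_def
    by (auto simp: ut_part_def) (intro mats.span_add mats.span_scale; simp add: mats.span_base)
qed

text \<open>\<open>ut_mat\<close> is injective and maps the graded parts onto
  \<open>UT3_even\<close> and \<open>UT3_odd\<close>, so the graded assignments on the two sides
  correspond.\<close>

lemma UT3_superids_iff:
  "f \<in> UT3_superids \<longleftrightarrow> f \<in> free_alg \<and> (\<forall>\<phi>. graded \<phi> \<longrightarrow> ut.ev \<phi> f = 0)"
proof -
  have "ut.ev \<phi> f = 0" if "f \<in> UT3_superids" "graded \<phi>" for \<phi>
  proof -
    have "nc_eval (\<lambda>v. ut_mat (\<phi> v)) f = 0"
      using that by (auto simp: superids_def graded_def UT3_even_eq UT3_odd_eq)
    then show ?thesis
      using ut_mat_inject[of "ut.ev \<phi> f" 0] by (simp add: nc_eval_ut_mat ut_mat_0)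
  qed
  moreover have "nc_eval \<psi> f = 0"
    if *: "\<forall>\<phi>. graded \<phi> \<longrightarrow> ut.ev \<phi> f = 0" and \<psi>: "\<forall>i. \<psi> (Y i) \<in> UT3_even" "\<forall>i. \<psi> (Z i) \<in> UT3_odd" for \<psi>
  proof -
    have ex: "\<exists>A. \<psi> v = ut_mat A \<and> A \<in> ut_part (case v of Y _ \<Rightarrow> True | Z _ \<Rightarrow> False)" for v
      using \<psi> by (cases v) (auto simp: UT3_even_eq UT3_odd_eq)
    then obtain \<phi> where \<phi>: "\<And>v. \<psi> v = ut_mat (\<phi> v)"
      "\<And>v. \<phi> v \<in> ut_part (case v of Y _ \<Rightarrow> True | Z _ \<Rightarrow> False)"
      by metis
    then have "graded \<phi>"
      unfolding graded_def by (metis var.simps(5,6))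
    with * have "ut.ev \<phi> f = 0" by blast
    then show ?thesis
      using nc_eval_ut_mat[of \<phi> f] by (simp add: ut_mat_0 flip: \<phi>(1))
  qed
  ultimately show ?thesis
    by (auto simp: superids_def)
qed

section \<open>Invariance of the superidentities under superendomorphisms\<close>

lemma super_endoD:
  assumes "super_endo h"
  shows "f \<in> free_alg \<Longrightarrow> h f \<in> free_alg"
    "f \<in> free_alg \<Longrightarrow> g \<in> free_alg \<Longrightarrow> h (f + g) = h f + h g"
    "f \<in> free_alg \<Longrightarrow> h (nc_scale c f) = nc_scale c (h f)"
    "f \<in> free_alg \<Longrightarrow> g \<in> free_alg \<Longrightarrow> h (f * g) = h f * h g"
    "f \<in> free_even \<Longrightarrow> h f \<in> free_even" "f \<in> free_odd \<Longrightarrow> h f \<in> free_odd"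
  using assms by (simp_all add: super_endo_def image_subset_iff)

text \<open>On nonempty words a superendomorphism is determined by its values at the variables, so
  following it by an evaluation gives another evaluation.\<close>

lemma super_endo_eq_ev:
  assumes h: "super_endo h" and f: "f \<in> free_alg"
  shows "ut.ev \<phi> (h f) = ut.ev (\<lambda>v. ut.ev \<phi> (h (Poly_Mapping.single (Word [v]) 1))) f"
proof -
  let ?\<psi> = "\<lambda>v. ut.ev \<phi> (h (Poly_Mapping.single (Word [v]) 1))"
  have alg: "Poly_Mapping.single w c \<in> free_alg" if "letters w \<noteq> []" for w and c :: 'a
    using that by (auto simp: free_alg_iff)
  \<comment> \<open>Only nonempty words are treated: nothing is known about the value of
    \<open>h\<close> at the unit.\<close>
  have words: "ut.ev \<phi> (h (Poly_Mapping.single (Word (v # vs)) 1)) = prod_list (map ?\<psi> (v # vs))" for v vs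
  proof (induction vs arbitrary: v)
    case (Cons v' vs)
    have "Poly_Mapping.single (Word (v # v' # vs)) (1::'a) =
        Poly_Mapping.single (Word [v]) 1 * Poly_Mapping.single (Word (v' # vs)) 1"
      by (simp add: mult_single plus_word_def)
    moreover have "h (Poly_Mapping.single (Word [v]) 1 * Poly_Mapping.single (Word (v' # vs)) 1) =
        h (Poly_Mapping.single (Word [v]) 1) * h (Poly_Mapping.single (Word (v' # vs)) 1)"
      by (intro super_endoD(4)[OF h] alg) simp_all
    ultimately show ?case
      by (simp only: ut.ev_mult Cons.IH) simp
  qed simp
  have monom: "ut.ev \<phi> (h (Poly_Mapping.single w c)) = ut.ev ?\<psi> (Poly_Mapping.single w c)"
    if w: "letters w \<noteq> []" for w c
  proof -
    have "h (nc_scale c (Poly_Mapping.single w 1)) = nc_scale c (h (Poly_Mapping.single w 1))"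
      by (intro super_endoD(3)[OF h] alg that)
    moreover obtain v vs where "w = Word (v # vs)"
      using w by (metis word.collapse list.exhaust)
    ultimately show ?thesis
      using words[of v vs] by (simp add: nc_scale_single ut.ev_scale ut.ev_single)
  qed
  have zero: "h 0 = 0"
  proof -
    have "h (nc_scale 0 0) = nc_scale 0 (h 0)"
      by (intro super_endoD(3)[OF h] ncpoly.subspace_0[OF subspace_free_alg])
    then show ?thesis by simp
  qed
  \<comment> \<open>Membership in \<open>free_alg\<close> is carried along because \<open>h\<close>
    is additive only there.\<close>
  have "f \<in> free_alg \<and> ut.ev \<phi> (h f) = ut.ev ?\<psi> f"
  proof (induction f rule: ncpoly_induct)
    case (single w c)
    then have "letters w \<noteq> []"
      using f unfolding word_eq_0_iff[symmetric] by (auto simp: free_alg_iff)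
    then show ?case
      by (intro conjI alg monom)
  next
    case (add f g)
    then have "h (f + g) = h f + h g"
      by (intro super_endoD(2)[OF h]) simp_all
    then show ?case
      using add by (simp add: ut.ev_add ncpoly.subspace_add[OF subspace_free_alg])
  qed (simp add: zero ncpoly.subspace_0[OF subspace_free_alg])
  then show ?thesis by blast
qed

lemma T2_ideal_UT3_superids: "T2_ideal (UT3_superids :: 'f::field ncpoly set)"
  unfolding T2_ideal_def
proof (intro conjI ballI allI impI)
  show "(UT3_superids :: 'f ncpoly set) \<subseteq> free_alg"
    by (auto simp: superids_def)
  show "ncpoly.subspace (UT3_superids :: 'f ncpoly set)"
    by (rule subspace_UT3_superids)
  show "f * g \<in> UT3_superids" "g * f \<in> UT3_superids" if "f \<in> UT3_superids" for f g :: "'f ncpoly"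
    using that by (auto simp: UT3_superids_iff ut.ev_mult intro: free_alg_mult)
  show "h ` (UT3_superids :: 'f ncpoly set) \<subseteq> UT3_superids" if h: "super_endo h" for h
  proof
    fix g assume "g \<in> h ` (UT3_superids :: 'f ncpoly set)"
    then obtain f where f: "f \<in> UT3_superids" "g = h f" by blast
    then have "f \<in> free_alg" by (simp add: UT3_superids_iff)
    have vars: "(yvar i :: 'f ncpoly) \<in> free_even" "(zvar i :: 'f ncpoly) \<in> free_odd" for i
      by (auto simp: free_even_eq free_odd_eq parity_part_closed) (simp add: free_alg_iff yvar_def word_eq_0_iff)
    have "ut.ev \<phi> g = 0" if "graded \<phi>" for \<phi>
    proof -
      have "graded (\<lambda>v. ut.ev \<phi> (h (Poly_Mapping.single (Word [v]) 1)))"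
        unfolding graded_def yvar_def[symmetric] zvar_def[symmetric]
        using super_endoD(5,6)[OF h] vars ev_ut_part[OF that] by (simp add: free_even_eq free_odd_eq)
      then show ?thesis
        using f by (simp add: super_endo_eq_ev[OF h \<open>f \<in> free_alg\<close>] UT3_superids_iff)
    qed
    moreover have "g \<in> free_alg"
      unfolding f(2) by (rule super_endoD(1)[OF h \<open>f \<in> free_alg\<close>])
    ultimately show "g \<in> UT3_superids"
      by (simp add: UT3_superids_iff)
  qed
qed


section \<open>Reduced monomials as functions on a finite field\<close>

definition mon :: "('v \<Rightarrow> 'f::comm_monoid_mult) \<Rightarrow> 'v multiset \<Rightarrow> 'f" where
  "mon x M = prod_mset (image_mset x M)"

lemma mon_simps [simp]: "mon x {#} = 1" "mon x (add_mset v M) = x v * mon x M"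
  "mon x (M + N) = mon x M * mon x N" "mon x (replicate_mset n v) = x v ^ n"
  "mon x (image_mset f M') = mon (\<lambda>v. x (f v)) M'"
  by (simp_all add: mon_def multiset.map_comp comp_def)

lemma mon_cong: "(\<And>v. v \<in># M \<Longrightarrow> x v = x' v) \<Longrightarrow> mon x M = mon x' M"
  unfolding mon_def by (simp cong: image_mset_cong)

lemma mon_slist: "prod_list (map x (slist M)) = mon x M"
  unfolding mon_def by (metis mset_map mset_sorted_list_of_multiset prod_mset_prod_list)

lemma mset_split: "M = filter_mset (\<lambda>u. u \<noteq> v) M + replicate_mset (count M v) v"
  by (simp add: multiset_eq_iff)

text \<open>For fixed other coordinates the sum is a polynomial in the coordinate \<open>v\<close>
  of degree below q with q zeros, so each of its coefficients vanishes; this eliminates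
  \<open>v\<close>.\<close>

lemma mon_independent_on:
  fixes c :: "'v multiset \<Rightarrow> 'f::{finite,field}"
  assumes "finite V" "finite S" "\<And>M. M \<in> S \<Longrightarrow> qred CARD('f) M \<and> set_mset M \<subseteq> V"
    and "\<And>x. (\<Sum>M\<in>S. c M * mon x M) = 0" "M \<in> S"
  shows "c M = 0"
  using assms
proof (induction V arbitrary: S c M)
  case empty
  then have "S = {{#}}" "M = {#}" by auto
  then show ?case
    using empty.prems(3)[of undefined] by simp
next
  case (insert v V)
  \<comment> \<open>The coefficient that involves \<open>M\<close> collects the monomials with the
    same exponent of \<open>v\<close>; on these, deleting \<open>v\<close> is injective.\<close>
  define k where "k = count M v"
  define Sk where "Sk = {N\<in>S. count N v = k}"
  define r where "r N = filter_mset (\<lambda>u. u \<noteq> v) N" for N :: "'v multiset"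
  have r: "N = r N + replicate_mset (count N v) v" for N
    unfolding r_def by (rule mset_split)
  have "(\<Sum>N\<in>Sk. c N * mon x (r N)) = 0" for x
  proof -
    define p where "p = (\<Sum>N\<in>S. monom (c N * mon x (r N)) (count N v))"
    have "poly p t = poly 0 t" for t
    proof -
      have "mon (x(v := t)) N = mon x (r N) * t ^ count N v" for N
      proof -
        have "mon (x(v := t)) N = mon (x(v := t)) (r N) * t ^ count N v"
          by (subst r) simp
        also have "mon (x(v := t)) (r N) = mon x (r N)"
          by (rule mon_cong) (simp add: r_def)
        finally show ?thesis .
      qed
      then show ?thesis
        using insert.prems(3)[of "x(v := t)"]
        by (simp add: p_def poly_sum poly_monom mult.assoc del: fun_upd_apply)
    qed
    moreover have "degree p < CARD('f)"
      unfolding p_def using insert.prems(2) card_field_ge_2[where 'f='f]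
      by (intro degree_sum_less) (auto simp: qred_def intro: le_less_trans[OF degree_monom_le])
    ultimately have "p = 0"
      by (intro poly_eqI_degree[of UNIV]) auto
    then have "coeff p k = 0" by simp
    also have "coeff p k = (\<Sum>N\<in>S. if count N v = k then c N * mon x (r N) else 0)"
      by (simp add: p_def coeff_sum)
    also have "\<dots> = (\<Sum>N\<in>Sk. c N * mon x (r N))"
      using insert.prems(1) by (simp add: Sk_def sum.inter_filter)
    finally show ?thesis .
  qed
  moreover have inj: "inj_on r Sk"
  proof (rule inj_onI)
    fix N N' assume "N \<in> Sk" "N' \<in> Sk" "r N = r N'"
    then show "N = N'"
      using r[of N] r[of N'] by (simp add: Sk_def)
  qed
  moreover have c: "c N = c (r N + replicate_mset k v)" if "N \<in> Sk" for N
    using r[of N] that by (simp add: Sk_def)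
  ultimately have "(\<Sum>N\<in>r ` Sk. c (N + replicate_mset k v) * mon x N) = 0" for x
    by (simp add: sum.reindex)
  moreover have "qred CARD('f) N \<and> set_mset N \<subseteq> V" if "N \<in> r ` Sk" for N
    using that insert.prems(2) card_field_ge_2[where 'f='f] by (fastforce simp: Sk_def r_def qred_def)
  moreover have "finite (r ` Sk)" "M \<in> Sk"
    using insert.prems by (auto simp: Sk_def k_def)
  ultimately have "c (r M + replicate_mset k v) = 0"
    by (intro insert.IH[of "r ` Sk" "\<lambda>N. c (N + replicate_mset k v)" "r M"]) auto
  then show ?case
    using c \<open>M \<in> Sk\<close> by simp
qed

text \<open>Several indices may give the same monomial, so independence only controls the sum of the
  coefficients over a fibre of \<open>g\<close>.\<close>

lemma mon_coeff_eq_0: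
  fixes c :: "'t \<Rightarrow> 'f::{finite,field}" and g :: "'t \<Rightarrow> 'v multiset"
  assumes "finite T" "\<And>t. t \<in> T \<Longrightarrow> qred CARD('f) (g t)"
    and "\<And>x. (\<Sum>t\<in>T. c t * mon x (g t)) = 0"
  shows "(\<Sum>t\<in>{t\<in>T. g t = M}. c t) = 0"
proof (cases "M \<in> g ` T")
  case True
  have "(\<Sum>M\<in>g ` T. (\<Sum>t\<in>{t\<in>T. g t = M}. c t) * mon x M) = 0" for x
  proof -
    have "(\<Sum>t\<in>T. c t * mon x (g t)) = (\<Sum>M\<in>g ` T. \<Sum>t\<in>{t\<in>T. g t = M}. c t * mon x (g t))"
      using assms(1) by (rule sum.image_gen)
    also have "\<dots> = (\<Sum>M\<in>g ` T. (\<Sum>t\<in>{t\<in>T. g t = M}. c t) * mon x M)"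
      by (simp add: sum_distrib_right)
    finally show ?thesis
      using assms(3) by simp
  qed
  with True assms(1,2) show ?thesis
    by (intro mon_independent_on[of "\<Union>M\<in>g ` T. set_mset M" "g ` T" "\<lambda>M. \<Sum>t\<in>{t\<in>T. g t = M}. c t"]) auto
next
  case False
  then have empty: "{t\<in>T. g t = M} = {}" by auto
  show ?thesis unfolding empty by simp
qed

text \<open>Each binomial is split into two signed monomials indexed by a Boolean. Since the
  monomial \<open>P t\<close> arises only once, its fibre sum is \<open>c t\<close>.\<close>

lemma binomial_forms_independent:
  fixes c :: "'t \<Rightarrow> 'f::{finite,field}" and P Q :: "'t \<Rightarrow> 'v multiset"
  assumes "finite T" "\<And>t. t \<in> T \<Longrightarrow> qred CARD('f) (P t) \<and> qred CARD('f) (Q t)"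
    and sum: "\<And>x. (\<Sum>t\<in>T. c t * (mon x (P t) - mon x (Q t))) = 0"
    and t: "t \<in> T" and "\<And>t'. t' \<in> T \<Longrightarrow> P t' = P t \<Longrightarrow> t' = t" "\<And>t'. t' \<in> T \<Longrightarrow> Q t' \<noteq> P t"
  shows "c t = 0"
proof -
  define g where "g s = (if snd s then P (fst s) else Q (fst s))" for s
  define d where "d s = (if snd s then c (fst s) else - c (fst s))" for s
  have "(\<Sum>s\<in>{s\<in>T \<times> UNIV. g s = P t}. d s) = 0"
  proof (rule mon_coeff_eq_0)
    show "(\<Sum>s\<in>T \<times> UNIV. d s * mon x (g s)) = 0" for x
    proof -
      have "(\<Sum>s\<in>T \<times> UNIV. d s * mon x (g s)) = (\<Sum>t\<in>T. \<Sum>b\<in>UNIV. d (t, b) * mon x (g (t, b)))"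
        by (simp add: sum.cartesian_product)
      also have "\<dots> = (\<Sum>t\<in>T. c t * (mon x (P t) - mon x (Q t)))"
        by (intro sum.cong) (simp_all add: UNIV_bool d_def g_def algebra_simps)
      finally show ?thesis using sum by simp
    qed
  qed (use assms in \<open>auto simp: g_def\<close>)
  also have "{s\<in>T \<times> UNIV. g s = P t} = {(t, True)}"
    using assms(4-6) by (auto simp: g_def split: if_splits)
  finally show ?thesis by (simp add: d_def)
qed

text \<open>Peels off one kind \<open>R\<close> of forms by means of a matrix entry \<open>h\<close>
  in which these forms are monomials and all others vanish.\<close>

lemma mon_independent_stage:
  fixes c :: "'t \<Rightarrow> 'f::{finite,field}" and g :: "'t \<Rightarrow> 'v multiset"
  assumes "finite T" "\<And>t. t \<in> T \<Longrightarrow> R t \<Longrightarrow> qred CARD('f) (g t)"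
    and sum: "\<And>x. (\<Sum>t\<in>T. c t * h x t) = 0"
    and h: "\<And>x t. t \<in> T \<Longrightarrow> R t \<Longrightarrow> h x t = mon x (g t)"
    and zero: "\<And>x t. t \<in> T \<Longrightarrow> \<not> R t \<Longrightarrow> h x t = 0"
    and t: "t \<in> T" "R t" and inj: "\<And>t'. t' \<in> T \<Longrightarrow> R t' \<Longrightarrow> g t' = g t \<Longrightarrow> t' = t"
  shows "c t = 0"
proof -
  have "(\<Sum>s\<in>{s \<in> {s\<in>T. R s}. g s = g t}. c s) = 0"
  proof (rule mon_coeff_eq_0)
    show "(\<Sum>s\<in>{s\<in>T. R s}. c s * mon x (g s)) = 0" for x
    proof -
      have "(\<Sum>s\<in>{s\<in>T. R s}. c s * mon x (g s)) = (\<Sum>s\<in>T. c s * h x s)"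
        using assms(1) h zero by (intro sum.mono_neutral_cong_left) auto
      then show ?thesis using sum by simp
    qed
  qed (use assms in auto)
  also have "{s \<in> {s\<in>T. R s}. g s = g t} = {t}"
    using t inj by auto
  finally show ?thesis by simp
qed


section \<open>Linear independence of the normal forms\<close>

text \<open>Bracketing with y_i acts on e13, e12 and e23 by scalars: c - a, called \<open>x\<close>,
  then b - a and c - b. This is why commutators turn into monomials in these differences.\<close>

context
  fixes a b c d u v :: "nat \<Rightarrow> 'f::{finite,field}" and y z q x
  defines "y \<equiv> (\<lambda>i. UT (a i) (b i) (c i) (d i) 0 0)"
    and "z \<equiv> (\<lambda>j. UT 0 0 0 0 (u j) (v j))"
    and "q \<equiv> CARD('f)"
    and "x \<equiv> (\<lambda>i. c i - a i)"
begin

lemma ypow_entries: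
  "ut11 (ypow y (slist M)) = mon a M" "ut22 (ypow y (slist M)) = mon b M"
  "ut33 (ypow y (slist M)) = mon c M" "ut12 (ypow y (slist M)) = 0" "ut23 (ypow y (slist M)) = 0"
proof -
  have "ut11 (ypow y xs) = prod_list (map a xs) \<and> ut22 (ypow y xs) = prod_list (map b xs) \<and>
    ut33 (ypow y xs) = prod_list (map c xs) \<and> ut12 (ypow y xs) = 0 \<and> ut23 (ypow y xs) = 0" for xs
    by (induction xs) (simp_all add: y_def)
  then show "ut11 (ypow y (slist M)) = mon a M" "ut22 (ypow y (slist M)) = mon b M"
    "ut33 (ypow y (slist M)) = mon c M" "ut12 (ypow y (slist M)) = 0" "ut23 (ypow y (slist M)) = 0"
    by (simp_all add: mon_slist)
qed

lemma ypow_corner: "(\<And>i. d i = 0) \<Longrightarrow> ut13 (ypow y xs) = 0"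
proof -
  assume d: "\<And>i. d i = 0"
  have "ut13 (ypow y xs) = 0 \<and> ut12 (ypow y xs) = 0 \<and> ut23 (ypow y xs) = 0"
    by (induction xs) (simp_all add: y_def d)
  then show ?thesis by simp
qed

lemma lcomm_odd:
  "lcomm (UT 0 0 0 0 e e') (map y (slist S)) =
    UT 0 0 0 0 (e * mon (\<lambda>i. b i - a i) S) (e' * mon (\<lambda>i. c i - b i) S)"
proof -
  have "lcomm (UT 0 0 0 0 e e') (map y xs) =
    UT 0 0 0 0 (e * (\<Prod>i\<leftarrow>xs. b i - a i)) (e' * (\<Prod>i\<leftarrow>xs. c i - b i))" for xs
  proof (induction xs arbitrary: e e')
    case (Cons i xs)
    have "comm (UT 0 0 0 0 e e') (y i) = UT 0 0 0 0 (e * (b i - a i)) (e' * (c i - b i))"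
      by (simp add: comm_def ut_eq_iff y_def algebra_simps)
    then show ?case by (simp add: Cons.IH mult.assoc)
  qed simp
  then show ?thesis by (simp add: mon_slist)
qed

lemma lcomm_corner:
  "lcomm (UT 0 0 0 e 0 0) (map y xs) = UT 0 0 0 (e * mon x (mset xs)) 0 0"
proof (induction xs arbitrary: e)
  case (Cons i xs)
  have "comm (UT 0 0 0 e 0 0) (y i) = UT 0 0 0 (e * x i) 0 0"
    by (simp add: comm_def ut_eq_iff y_def x_def algebra_simps)
  then show ?case by (simp add: Cons.IH mult.assoc)
qed simp

text \<open>The corner of y_l^n is d times the divided difference (c^n - a^n)/(c - a). For n = q it
  is 1 if a and c differ and 0 otherwise, that is, (c - a)^(q-1).\<close>

lemma power_frob: "y l ^ q - y l = UT 0 0 0 (d l * (x l ^ (q - 1) - 1)) 0 0"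
proof -
  \<comment> \<open>\<open>e\<close> is the divided difference, described without division; at a = c
    it is the derivative n a^(n-1), which is zero for n = q.\<close>
  have pow: "\<exists>e. ut13 (y l ^ n) = d l * e \<and> ut12 (y l ^ n) = 0 \<and> ut23 (y l ^ n) = 0 \<and>
      (c l - a l) * e = c l ^ n - a l ^ n \<and> (a l = c l \<longrightarrow> e = of_nat n * a l ^ (n - 1))" for n
  proof (induction n)
    case 0
    show ?case by (auto intro: exI[of _ 0])
  next
    case (Suc n)
    then obtain e where e: "ut13 (y l ^ n) = d l * e" "ut12 (y l ^ n) = 0" "ut23 (y l ^ n) = 0"
      "(c l - a l) * e = c l ^ n - a l ^ n" "a l = c l \<Longrightarrow> e = of_nat n * a l ^ (n - 1)"
      by blast
    have "(c l - a l) * (a l * e + c l ^ n) = a l * ((c l - a l) * e) + (c l - a l) * c l ^ n"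
      by (simp add: algebra_simps)
    also have "\<dots> = c l ^ Suc n - a l ^ Suc n"
      unfolding e(4) by (simp add: algebra_simps)
    finally have "(c l - a l) * (a l * e + c l ^ n) = c l ^ Suc n - a l ^ Suc n" .
    moreover have "a l * e + c l ^ n = of_nat (Suc n) * a l ^ (Suc n - 1)" if "a l = c l"
      using e(5)[OF that] that by (cases n) (simp_all add: algebra_simps)
    ultimately show ?case
      using e by (intro exI[of _ "a l * e + c l ^ n"]) (simp add: y_def algebra_simps)
  qed
  obtain e where e: "ut13 (y l ^ q) = d l * e" "ut12 (y l ^ q) = 0" "ut23 (y l ^ q) = 0"
      "(c l - a l) * e = c l ^ q - a l ^ q" "a l = c l \<Longrightarrow> e = of_nat q * a l ^ (q - 1)"
    using pow[of q] by blast
  have "e = x l ^ (q - 1)"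
  proof (cases "a l = c l")
    case True
    have "of_nat q = (0 :: 'f)"
      using of_nat_card_choose[of 1, where 'f='f] card_field_ge_2[where 'f='f] by (simp add: q_def)
    moreover have "x l ^ (q - 1) = 0"
      using True card_field_ge_2[where 'f='f] by (simp add: x_def q_def)
    ultimately show ?thesis using e(5) True by simp
  next
    case False
    then have "e = 1"
      using e(4) by (simp add: q_def power_card)
    then show ?thesis
      using False power_card_minus_1[of "x l"] by (simp add: x_def q_def)
  qed
  then show ?thesis
    using e by (simp add: ut_eq_iff) (simp add: y_def q_def power_card algebra_simps)
qed

lemma form_Frob:
  "form q y z (Frob M l T) = UT 0 0 0 (mon a M * (d l * (x l ^ (q - 1) - 1) * mon x T)) 0 0"
  by (simp add: power_frob lcomm_corner ypow_entries ut_eq_iff)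

text \<open>The corner of [y_i, y_m] is d_i x_m - d_m x_i, and every further bracket multiplies by
  an x, so each term lacks one copy of the variable whose d it carries.\<close>

lemma form_Com:
  assumes "i \<in># S" "i \<noteq> Min (set_mset S)"
  shows "form q y z (Com M S i) = UT 0 0 0 (mon a M * (d i * mon x (S - {#i#}) -
      d (Min (set_mset S)) * mon x (S - {#Min (set_mset S)#}))) 0 0"
proof -
  define m where "m = Min (set_mset S)"
  have m: "m \<in># S" "i \<noteq> m"
    using assms unfolding m_def by (auto intro!: Min_in)
  define rest where "rest = replicate (count S m - 1) m @ replicate (count S i - 1) i @
     slist (filter_mset (\<lambda>x. x \<noteq> m \<and> x \<noteq> i) S)"
  have "replicate (count S m) m = m # replicate (count S m - 1) m"
    using m by (metis Suc_pred' count_greater_zero_iff replicate_Suc)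
  then have com: "com_list S i = m # rest"
    by (simp add: com_list_def rest_def Let_def flip: m_def)
  have rest: "S - {#i#} = add_mset m (mset rest)" "S - {#m#} = add_mset i (mset rest)"
    using m assms(1) by (auto simp: rest_def multiset_eq_iff)
  have "comm (y i) (y m) = UT 0 0 0 (d i * x m - d m * x i) 0 0"
    by (simp add: comm_def ut_eq_iff y_def x_def algebra_simps)
  then have "lcomm (y i) (map y (com_list S i)) =
      UT 0 0 0 (d i * mon x (S - {#i#}) - d m * mon x (S - {#m#})) 0 0"
    by (simp add: com lcomm_corner rest algebra_simps)
  then show ?thesis
    by (simp add: ypow_entries ut_eq_iff m_def)
qed

lemma form_One:
  "form q y z (One M j S) = UT 0 0 0 0 (mon a M * (u j * mon (\<lambda>i. b i - a i) S))
     (mon b M * (v j * mon (\<lambda>i. c i - b i) S))"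
  by (simp add: z_def lcomm_odd ypow_entries ut_eq_iff)

lemma form_Two:
  "form q y z (Two M j S k T) = UT 0 0 0 (mon a M * (u j * mon (\<lambda>i. b i - a i) S) *
     (v k * mon (\<lambda>i. c i - b i) T)) 0 0"
  by (simp add: z_def lcomm_odd ypow_entries ut_eq_iff)

end

text \<open>Coordinates of generic matrices: \<open>VA\<close> is the first diagonal entry of \<open>y\<^sub>i\<close>, \<open>VX\<close> and \<open>VT\<close> are
  differences of diagonal entries, \<open>VD\<close> is the corner entry, and \<open>VU\<close>, \<open>VW\<close> are the two entries of
  \<open>z\<^sub>j\<close>. In these coordinates the reduced exponents can be read off the normal forms.\<close>

datatype coord = VA nat | VX nat | VT nat | VD nat | VU nat | VW nat

definition enc :: "nat multiset \<Rightarrow> nat multiset \<Rightarrow> nat multiset \<Rightarrow> nat multiset \<Rightarrow> nat multiset \<Rightarrow>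
    nat multiset \<Rightarrow> coord multiset" where
  "enc M S T D U W = image_mset VA M + image_mset VX S + image_mset VT T +
     image_mset VD D + image_mset VU U + image_mset VW W"

lemma count_enc:
  "count (enc M S T D U W) r = (case r of VA i \<Rightarrow> count M i | VX i \<Rightarrow> count S i | VT i \<Rightarrow> count T i
     | VD i \<Rightarrow> count D i | VU i \<Rightarrow> count U i | VW i \<Rightarrow> count W i)"
proof -
  have inj: "count (image_mset f N) (f i) = count N i" if "inj f" for f :: "nat \<Rightarrow> coord" and N i
    using that by (induction N) (auto simp: inj_eq)
  have "inj VA" "inj VX" "inj VT" "inj VD" "inj VU" "inj VW"
    by (auto intro: injI)
  note inj' = this[THEN inj]
  have other: "count (image_mset f N) r' = 0" if "\<And>i. f i \<noteq> r'" for f :: "nat \<Rightarrow> coord" and N r'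
    using that by (auto simp: count_eq_zero_iff)
  show ?thesis
    by (cases r) (simp_all add: enc_def inj' other)
qed

lemma enc_eq_iff: "enc M S T D U W = enc M' S' T' D' U' W' \<longleftrightarrow>
    M = M' \<and> S = S' \<and> T = T' \<and> D = D' \<and> U = U' \<and> W = W'"
proof
  assume eq: "enc M S T D U W = enc M' S' T' D' U' W'"
  have "count (enc M S T D U W) r = count (enc M' S' T' D' U' W') r" for r
    by (simp add: eq)
  from this[of "VA _"] this[of "VX _"] this[of "VT _"] this[of "VD _"] this[of "VU _"] this[of "VW _"]
  show "M = M' \<and> S = S' \<and> T = T' \<and> D = D' \<and> U = U' \<and> W = W'"
    by (simp add: count_enc multiset_eq_iff)
qed simp

lemma qred_enc: "qred q (enc M S T D U W) \<longleftrightarrow>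
    qred q M \<and> qred q S \<and> qred q T \<and> qred q D \<and> qred q U \<and> qred q W"
proof
  assume q: "qred q (enc M S T D U W)"
  have "count (enc M S T D U W) r < q" for r
    using q by (simp add: qred_def)
  from this[of "VA _"] this[of "VX _"] this[of "VT _"] this[of "VD _"] this[of "VU _"] this[of "VW _"]
  show "qred q M \<and> qred q S \<and> qred q T \<and> qred q D \<and> qred q U \<and> qred q W"
    by (simp add: count_enc qred_def)
qed (auto simp: qred_def count_enc split: coord.split)

lemma mon_enc: "mon x (enc M S T D U W) = mon (\<lambda>i. x (VA i)) M * mon (\<lambda>i. x (VX i)) S *
    mon (\<lambda>i. x (VT i)) T * mon (\<lambda>i. x (VD i)) D * mon (\<lambda>i. x (VU i)) U * mon (\<lambda>i. x (VW i)) W"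
  by (simp add: enc_def)

lemma qred_small [simp]: "2 \<le> q \<Longrightarrow> qred q {#}" "2 \<le> q \<Longrightarrow> qred q {#i#}"
  by (auto simp: qred_def)

text \<open>Entry 11 sees only \<open>Pow\<close> and entry 12 only \<open>One\<close>. The corner
  sees only \<open>Two\<close> at the matrices \<open>\<alpha>\<close>, whose even values have
  corner 0; at the matrices \<open>\<beta>\<close>, without odd part, it then separates
  \<open>Com\<close> and \<open>Frob\<close>.\<close>

lemma forms_independent:
  fixes c :: "index \<Rightarrow> 'f::{finite,field}"
  defines "q \<equiv> CARD('f)"
  assumes T: "finite T" "\<And>ix. ix \<in> T \<Longrightarrow> valid q ix"
    and ids: "(\<Sum>ix\<in>T. nc_scale (c ix) (form q yvar zvar ix)) \<in> UT3_superids"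
    and ix: "ix \<in> T"
  shows "c ix = 0"
proof -
  have q: "2 \<le> q"
    unfolding q_def by (rule card_field_ge_2)
  define S where "S x = (\<Sum>ix\<in>T. ut_const (c ix) * form q (\<lambda>i. x (Y i)) (\<lambda>i. x (Z i)) ix)"
    for x :: "var \<Rightarrow> 'f ut"
  have S: "S x = 0" if "graded x" for x
    using ids that unfolding S_def by (simp add: UT3_superids_iff ut.ev_sum ut.ev_scale ut.ev_form)
  have entries: "ut11 (S x) = (\<Sum>ix\<in>T. c ix * ut11 (form q (\<lambda>i. x (Y i)) (\<lambda>i. x (Z i)) ix))"
    "ut12 (S x) = (\<Sum>ix\<in>T. c ix * ut12 (form q (\<lambda>i. x (Y i)) (\<lambda>i. x (Z i)) ix))"
    "ut13 (S x) = (\<Sum>ix\<in>T. c ix * ut13 (form q (\<lambda>i. x (Y i)) (\<lambda>i. x (Z i)) ix))" for x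
    unfolding S_def using T(1) by (induction T) (simp_all add: ut_const_def)
  \<comment> \<open>The diagonal is parametrized so that b - a and c - b are the independent
    coordinates \<open>VX\<close> and \<open>VT\<close>.\<close>
  define \<alpha> where "\<alpha> x r = (case r of
      Y i \<Rightarrow> UT (x (VA i)) (x (VA i) + x (VX i)) (x (VA i) + x (VX i) + x (VT i)) 0 0 0
    | Z j \<Rightarrow> UT 0 0 0 0 (x (VU j)) (x (VW j)))" for x :: "coord \<Rightarrow> 'f" and r
  \<comment> \<open>Now \<open>VX\<close> is c - a; the corner of a product of even matrices depends
    on the outer diagonal entries alone, so the middle one is 0.\<close>
  define \<beta> where "\<beta> x r = (case r of
      Y i \<Rightarrow> UT (x (VA i)) 0 (x (VA i) + x (VX i)) (x (VD i)) 0 0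
    | Z j \<Rightarrow> UT 0 0 0 0 0 0)" for x :: "coord \<Rightarrow> 'f" and r
  define F where "F x = form q (\<lambda>i. \<alpha> x (Y i)) (\<lambda>i. \<alpha> x (Z i))" for x
  define H where "H x = form q (\<lambda>i. \<beta> x (Y i)) (\<lambda>i. \<beta> x (Z i))" for x
  have "S (\<alpha> x) = 0" "S (\<beta> x) = 0" for x
    by (intro S, simp add: graded_def \<alpha>_def \<beta>_def ut_part_def)+
  with entries[of "\<alpha> _"] entries[of "\<beta> _"]
  have F: "(\<Sum>ix\<in>T. c ix * ut11 (F x ix)) = 0" "(\<Sum>ix\<in>T. c ix * ut12 (F x ix)) = 0"
    "(\<Sum>ix\<in>T. c ix * ut13 (F x ix)) = 0" and H: "(\<Sum>ix\<in>T. c ix * ut13 (H x ix)) = 0" for x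
    by (simp_all add: F_def H_def)
  note forms = form_Frob form_Com form_One form_Two
  have F_Pow: "ut11 (F x (Pow M)) = mon x (enc M {#} {#} {#} {#} {#})" "ut12 (F x (Pow M)) = 0"
    "ut13 (F x (Pow M)) = 0" for x M
    unfolding F_def \<alpha>_def by (simp_all add: ypow_entries ypow_corner mon_enc)
  have F_Com: "ut11 (F x (Com M N i)) = 0" "ut12 (F x (Com M N i)) = 0" "ut13 (F x (Com M N i)) = 0"
    if "valid q (Com M N i)" for x M N i
    using that unfolding F_def \<alpha>_def var.case q_def by (simp_all add: form_Com del: form.simps)
  have F_Frob: "ut11 (F x (Frob M i N)) = 0" "ut12 (F x (Frob M i N)) = 0" "ut13 (F x (Frob M i N)) = 0"
    for x M N i
    unfolding F_def \<alpha>_def var.case q_def by (simp_all add: form_Frob del: form.simps)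
  have F_One: "ut11 (F x (One M j N)) = 0" "ut12 (F x (One M j N)) = mon x (enc M N {#} {#} {#j#} {#})"
    "ut13 (F x (One M j N)) = 0" for x M N j
    unfolding F_def \<alpha>_def var.case q_def by (simp_all add: form_One mon_enc del: form.simps)
  have F_Two: "ut11 (F x (Two M j N k N')) = 0" "ut12 (F x (Two M j N k N')) = 0"
    "ut13 (F x (Two M j N k N')) = mon x (enc M N N' {#} {#j#} {#k#})" for x M N j k N'
    unfolding F_def \<alpha>_def var.case q_def by (simp_all add: form_Two mon_enc del: form.simps)
  have zero: "ut11 (F x t) = 0" if "t \<in> T" "\<not> (\<exists>M. t = Pow M)" for x t
    using that T(2)[OF that(1)] by (cases t) (auto simp: F_Pow F_Frob F_One F_Two F_Com simp del: valid.simps)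
  have Pow: "c (Pow M) = 0" if "Pow M \<in> T" for M
    by (rule mon_independent_stage[where R = "\<lambda>ix. \<exists>M. ix = Pow M" and T = T and
          h = "\<lambda>x ix. ut11 (F x ix)" and g = "\<lambda>ix. case ix of Pow M \<Rightarrow> enc M {#} {#} {#} {#} {#} | _ \<Rightarrow> {#}"])
      (use T q that F in \<open>auto simp: F_Pow F_Frob F_One F_Two F_Com enc_eq_iff qred_enc simp flip: q_def
        split: index.splits dest: T(2) intro: zero\<close>)
  have zero: "ut12 (F x t) = 0" if "t \<in> T" "\<not> (\<exists>M j N. t = One M j N)" for x t
    using that T(2)[OF that(1)] by (cases t) (auto simp: F_Pow F_Frob F_One F_Two F_Com simp del: valid.simps)
  have One: "c (One M j N) = 0" if "One M j N \<in> T" for M j N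
    by (rule mon_independent_stage[where R = "\<lambda>ix. \<exists>M j N. ix = One M j N" and T = T and
          h = "\<lambda>x ix. ut12 (F x ix)" and
          g = "\<lambda>ix. case ix of One M j N \<Rightarrow> enc M N {#} {#} {#j#} {#} | _ \<Rightarrow> {#}"])
      (use T q that F in \<open>auto simp: F_Pow F_Frob F_One F_Two F_Com enc_eq_iff qred_enc simp flip: q_def
        split: index.splits dest: T(2) intro: zero\<close>)
  have zero: "ut13 (F x t) = 0" if "t \<in> T" "\<not> (\<exists>M j N k N'. t = Two M j N k N')" for x t
    using that T(2)[OF that(1)] by (cases t) (auto simp: F_Pow F_Frob F_One F_Two F_Com simp del: valid.simps)
  have Two: "c (Two M j N k N') = 0" if "Two M j N k N' \<in> T" for M j N k N'
    by (rule mon_independent_stage[where R = "\<lambda>ix. \<exists>M j N k N'. ix = Two M j N k N'" and T = T and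
          h = "\<lambda>x ix. ut13 (F x ix)" and
          g = "\<lambda>ix. case ix of Two M j N k N' \<Rightarrow> enc M N N' {#} {#j#} {#k#} | _ \<Rightarrow> {#}"])
      (use T q that F in \<open>auto simp: F_Pow F_Frob F_One F_Two F_Com enc_eq_iff qred_enc simp flip: q_def
        split: index.splits dest: T(2) intro: zero\<close>)
  define m where "m N = Min (set_mset N)" for N :: "nat multiset"
  \<comment> \<open>The corner is the binomial P - Q, and \<open>P\<close> is the monomial that will
    isolate the coefficient; for \<open>Frob\<close> it carries x_l^(q-1).\<close>
  define P where "P ix = (case ix of
      Com M N i \<Rightarrow> enc M (N - {#i#}) {#} {#i#} {#} {#}
    | Frob M l N \<Rightarrow> enc M (N + replicate_mset (q - 1) l) {#} {#l#} {#} {#} | _ \<Rightarrow> {#})" for ix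
  define Q where "Q ix = (case ix of
      Com M N i \<Rightarrow> enc M (N - {#m N#}) {#} {#m N#} {#} {#}
    | Frob M l N \<Rightarrow> enc M N {#} {#l#} {#} {#} | _ \<Rightarrow> {#})" for ix
  have H_Com: "ut13 (H x (Com M N i)) = mon x (P (Com M N i)) - mon x (Q (Com M N i))"
    if "valid q (Com M N i)" for x M N i
    using that unfolding H_def \<beta>_def var.case q_def
    by (simp add: form_Com mon_enc P_def Q_def m_def algebra_simps del: form.simps)
  have H_Frob: "ut13 (H x (Frob M l N)) = mon x (P (Frob M l N)) - mon x (Q (Frob M l N))" for x M l N
    unfolding H_def \<beta>_def var.case q_def
    by (simp add: form_Frob mon_enc P_def Q_def q_def algebra_simps del: form.simps)
  define T' where "T' = {ix\<in>T. case ix of Com _ _ _ \<Rightarrow> True | Frob _ _ _ \<Rightarrow> True | _ \<Rightarrow> False}"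
  have T': "finite T'" "\<And>ix. ix \<in> T' \<Longrightarrow> valid q ix"
    using T by (auto simp: T'_def)
  have sum: "(\<Sum>ix\<in>T'. c ix * (mon x (P ix) - mon x (Q ix))) = 0" for x
  proof -
    have "(\<Sum>ix\<in>T'. c ix * (mon x (P ix) - mon x (Q ix))) = (\<Sum>ix\<in>T. c ix * ut13 (H x ix))"
    proof (intro sum.mono_neutral_cong_left T)
      show "\<forall>ix\<in>T - T'. c ix * ut13 (H x ix) = 0"
        using Pow One Two by (auto simp: T'_def split: index.splits)
      show "c ix * (mon x (P ix) - mon x (Q ix)) = c ix * ut13 (H x ix)" if "ix \<in> T'" for ix
        using that T(2)[of ix] H_Com H_Frob by (cases ix) (auto simp: T'_def simp del: valid.simps)
    qed (auto simp: T'_def)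
    then show ?thesis using H by simp
  qed
  have m: "m N \<in># N" if "i \<in># N" for i N
    using that unfolding m_def by (intro Min_in) auto
  have qred_P: "qred q (P ix) \<and> qred q (Q ix)" if "ix \<in> T'" for ix
  proof (cases ix)
    case (Com M N i)
    then show ?thesis
      using T'(2)[OF that] q by (simp add: P_def Q_def qred_enc) (auto simp: qred_def less_imp_diff_less)
  next
    case (Frob M l N)
    then show ?thesis
      using T'(2)[OF that] q by (simp add: P_def Q_def qred_enc) (auto simp: qred_def not_in_iff)
  qed (use that in \<open>auto simp: T'_def\<close>)
  \<comment> \<open>A \<open>Com\<close> term carrying d_l has lost one of its fewer than q copies
    of \<open>l\<close>, so its exponent of x_l is at most q - 2.\<close>
  have big: "N - {#l#} \<noteq> N' + replicate_mset (q - 1) l" if "qred q N" "l \<in># N" for N N' l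
  proof
    assume "N - {#l#} = N' + replicate_mset (q - 1) l"
    then have "count N l - 1 = count N' l + (q - 1)"
      by (metis count_diff count_replicate_mset count_single count_union)
    moreover have "0 < count N l" "count N l < q"
      using that by (simp_all add: qred_def)
    ultimately show False by linarith
  qed
  \<comment> \<open>A monomial equal to this P carries the same d_l. \<open>big\<close> excludes the
    \<open>Com\<close> terms, and the Q of a \<open>Frob\<close> has exponent 0 at x_l.\<close>
  have Frob: "c (Frob M l N) = 0" if t: "Frob M l N \<in> T'" for M l N
  proof (rule binomial_forms_independent[of T' P Q])
    have l: "l \<notin># N" using T'(2)[OF t] by simp
    show "t = Frob M l N" if "t \<in> T'" "P t = P (Frob M l N)" for t
      using that T'(2)[OF that(1)] by (cases t) (auto simp: T'_def P_def enc_eq_iff dest: big)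
    show "Q t \<noteq> P (Frob M l N)" if "t \<in> T'" for t
    proof (cases t)
      case (Com M' N' i)
      then show ?thesis
        using T'(2)[OF that] big[of N' "m N'" N] m[of i N'] by (auto simp: Q_def P_def enc_eq_iff)
    next
      case (Frob M' l' N')
      then show ?thesis
        using T'(2)[OF that] q by (auto simp: Q_def P_def enc_eq_iff)
    qed (use that in \<open>auto simp: T'_def\<close>)
  qed (use t sum T'(1) qred_P q_def in auto)
  have Com: "c (Com M N i) = 0" if t: "Com M N i \<in> T'" for M N i
  proof -
    define T'' where "T'' = {ix\<in>T'. case ix of Com _ _ _ \<Rightarrow> True | _ \<Rightarrow> False}"
    have i: "i \<in># N" "i \<noteq> m N"
      using T'(2)[OF t] by (simp_all add: m_def)
    have N: "N' = N \<and> i' = i" if "i' \<in># N'" "N' - {#i'#} = N - {#i#}" "i' = i" for N' i'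
      using that i by (metis insert_DiffM)
    show ?thesis
    proof (rule binomial_forms_independent[of T'' P Q])
      show "(\<Sum>ix\<in>T''. c ix * (mon x (P ix) - mon x (Q ix))) = 0" for x
      proof -
        have "(\<Sum>ix\<in>T''. c ix * (mon x (P ix) - mon x (Q ix))) =
            (\<Sum>ix\<in>T'. c ix * (mon x (P ix) - mon x (Q ix)))"
        proof (intro sum.mono_neutral_left T' ballI)
          show "c ix * (mon x (P ix) - mon x (Q ix)) = 0" if "ix \<in> T' - T''" for ix
            using that Frob by (cases ix) (auto simp: T''_def T'_def)
        qed (auto simp: T''_def)
        then show ?thesis using sum by simp
      qed
      show "t = Com M N i" if "t \<in> T''" "P t = P (Com M N i)" for t
        using that T'(2)[of t] N by (cases t) (auto simp: T''_def P_def enc_eq_iff)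
      \<comment> \<open>Equality would give the same d and the same remaining exponents, hence N' =
        N and i = Min N, against validity.\<close>
      show "Q t \<noteq> P (Com M N i)" if tT: "t \<in> T''" for t
      proof
        assume eq: "Q t = P (Com M N i)"
        obtain M' N' i' where t: "t = Com M' N' i'"
          using tT by (cases t) (auto simp: T''_def)
        then have "m N' \<in># N'"
          using tT T'(2)[of t] m[of i' N'] by (auto simp: T''_def)
        moreover have "N' - {#m N'#} = N - {#i#}" "m N' = i"
          using eq by (auto simp: t Q_def P_def enc_eq_iff)
        ultimately show False
          using N i(2) by metis
      qed
    qed (use t T'(1) qred_P q_def in \<open>auto simp: T''_def\<close>)
  qed
  show ?thesis
    using ix Pow One Two Frob Com by (cases ix) (auto simp: T'_def)
qed


section \<open>The normal forms of the theorem\<close>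

text \<open>The exponent notation at the level of indices, where sorting and multisets are available
  before variables are inserted.\<close>

definition expand :: "(nat \<Rightarrow> nat) \<Rightarrow> (nat \<Rightarrow> nat) \<Rightarrow> nat list \<Rightarrow> nat list" where
  "expand l s ns = concat (map (\<lambda>i. replicate (s i) (l i)) ns)"

lemma map_expand: "map f (expand l s ns) = concat (map (\<lambda>i. replicate (s i) (f (l i))) ns)"
  by (simp add: expand_def map_concat comp_def)

lemma in_set_expand: "x \<in> set (expand l s ns) \<longleftrightarrow> (\<exists>i\<in>set ns. x = l i \<and> 0 < s i)"
  by (auto simp: expand_def)

lemma sorted_expand:
  assumes "sorted ns" "mono_on (set ns) l"
  shows "sorted (expand l s ns)"
  using assms
proof (induction ns)
  case (Cons n ns)
  then have "mono_on (set ns) l" "\<And>i. i \<in> set ns \<Longrightarrow> l n \<le> l i"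
    by (auto simp: monotone_on_def)
  then show ?case
    using Cons by (auto simp: expand_def sorted_append)
qed (simp add: expand_def)

lemma sorted_expand_upt:
  assumes "strict_mono_on {k..n} j" "k \<le> k'"
  shows "sorted (expand j s [k'..<n + 1])"
proof (rule sorted_expand)
  show "mono_on (set [k'..<n + 1]) j"
    using assms(2)
    by (intro mono_on_subset[OF strict_mono_on_imp_mono_on[OF assms(1)]]) auto
qed (rule sorted_upt)

lemma count_expand:
  assumes "distinct ns" "inj_on l (set ns)" "i \<in> set ns"
  shows "count (mset (expand l s ns)) (l i) = s i"
  using assms
proof (induction ns)
  case (Cons n ns)
  have expand: "expand l s (n # ns) = replicate (s n) (l n) @ expand l s ns"
    by (simp add: expand_def)
  show ?case
  proof (cases "i = n")
    case True
    then have "l i \<notin> set (expand l s ns)"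
      using Cons.prems by (auto simp: in_set_expand inj_on_def)
    then show ?thesis
      using True by (simp add: expand count_eq_zero_iff flip: set_mset_mset)
  next
    case False
    then have "l i \<noteq> l n"
      using Cons.prems by (auto simp: inj_on_def)
    then show ?thesis
      using Cons False by (simp add: expand)
  qed
qed simp

lemma expand_mset_eqI:
  assumes "distinct ns" "inj_on l (set ns)" "\<And>i. i \<in> set ns \<Longrightarrow> s i = count M (l i)"
    and "set_mset M \<subseteq> l ` set ns"
  shows "mset (expand l s ns) = M"
proof (rule multiset_eqI)
  fix x
  show "count (mset (expand l s ns)) x = count M x"
  proof (cases "x \<in> l ` set ns")
    case True
    then show ?thesis
      using count_expand[OF assms(1,2)] assms(3) by auto
  next
    case False
    then have "x \<notin># M" "x \<notin> set (expand l s ns)"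
      using assms(4) by (auto simp: in_set_expand)
    then show ?thesis
      by (metis not_in_iff set_mset_mset)
  qed
qed

lemma qred_expand:
  assumes "distinct ns" "inj_on l (set ns)" "\<And>i. i \<in> set ns \<Longrightarrow> s i < q" "0 < q"
  shows "qred q (mset (expand l s ns))"
  unfolding qred_def
proof
  fix x
  show "count (mset (expand l s ns)) x < q"
  proof (cases "x \<in> l ` set ns")
    case True
    then show ?thesis
      using count_expand[OF assms(1,2)] assms(3) by auto
  next
    case False
    then have "x \<notin> set (expand l s ns)"
      by (auto simp: in_set_expand)
    then show ?thesis
      using assms(4) by (metis not_in_iff set_mset_mset)
  qed
qed

lemma slist_unique: "sorted xs \<Longrightarrow> mset xs = M \<Longrightarrow> slist M = xs"
  by (metis sorted_list_of_multiset_mset sorted_sort_id)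

lemma slist_mset_expand: "slist (mset (expand (\<lambda>i. i) r [0..<m])) = expand (\<lambda>i. i) r [0..<m]"
  by (intro slist_unique sorted_expand) (auto simp: monotone_on_def)

lemma qred_mset_expand: "\<forall>i<m. r i < q \<Longrightarrow> 0 < q \<Longrightarrow> qred q (mset (expand (\<lambda>i. i) r [0..<m]))"
  by (intro qred_expand) auto

lemma expand_count:
  assumes "\<And>x. x \<in># M \<Longrightarrow> x < m"
  shows "expand (\<lambda>i. i) (count M) [0..<m] = slist M"
proof -
  have "mset (expand (\<lambda>i. i) (count M) [0..<m]) = M"
    using assms by (intro expand_mset_eqI) auto
  then show ?thesis
    using slist_mset_expand[of "count M" m] by simp
qed

lemma ymonom_eq: "ymonom m r = ypow yvar (expand (\<lambda>i. i) r [0..<m])"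
proof -
  have "prod_list (map (\<lambda>i. yvar i ^ r i) ns) = ypow yvar (expand (\<lambda>i. i) r ns)" for ns
    by (induction ns) (simp_all add: expand_def)
  then show ?thesis by (simp add: ymonom_def)
qed

lemma zcomm_eq: "zcomm m j s = lcomm (zvar j) (map yvar (expand (\<lambda>i. i) s [0..<m]))"
  by (simp add: zcomm_def map_expand)

section \<open>Ordered commutators described by multisets\<close>

definition com1 :: "nat multiset \<Rightarrow> nat \<Rightarrow> 'f::field ncpoly" where
  "com1 S i = lcomm (yvar i) (map yvar (com_list S i))"

definition com2 :: "nat \<Rightarrow> nat \<Rightarrow> nat multiset \<Rightarrow> 'f::field ncpoly" where
  "com2 q l T = lcomm (yvar l ^ q - yvar l) (map yvar (slist T))"

lemma upt_123: "2 \<le> n \<Longrightarrow> [1..<n + 1] = 1 # 2 # [3..<n + 1]"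
  by (simp add: upt_conv_Cons numeral_2_eq_2 numeral_3_eq_3)

text \<open>Supplies the index function of an ordered commutator: a prescribed first variable, then
  the others in increasing order.\<close>

lemma enumerate_with_first:
  assumes "finite A" "i \<notin> (A :: nat set)"
  obtains j where "j 1 = i" "inj_on j {1..card A + 1}" "strict_mono_on {2..card A + 1} j"
    "j ` {2..card A + 1} = A"
proof -
  define xs where "xs = sorted_list_of_set A"
  have xs: "sorted_wrt (<) xs" "set xs = A" "length xs = card A"
    using assms(1) by (simp_all add: xs_def strict_sorted_list_of_set)
  define j where "j k = (if k = 1 then i else xs ! (k - 2))" for k
  have mono: "strict_mono_on {2..card A + 1} j"
    using xs(1) by (auto simp: j_def xs(3) sorted_wrt_iff_nth_less strict_mono_on_def)
  have img: "j ` {2..card A + 1} = A"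
  proof -
    have "j ` {2..card A + 1} = (!) xs ` {..<card A}"
    proof (intro equalityI subsetI)
      fix x assume "x \<in> (!) xs ` {..<card A}"
      then obtain k where "k < card A" "x = j (k + 2)"
        by (auto simp: j_def)
      then show "x \<in> j ` {2..card A + 1}" by auto
    qed (auto simp: j_def intro!: image_eqI)
    also have "\<dots> = A"
      using xs by (auto simp: set_conv_nth)
    finally show ?thesis .
  qed
  have "{1..card A + 1} = insert 1 {2..card A + 1}" by auto
  then have "inj_on j {1..card A + 1}"
    using strict_mono_on_imp_inj_on[OF mono] img assms(2) by (auto simp: j_def)
  moreover have "j 1 = i" by (simp add: j_def)
  ultimately show ?thesis using that mono img by blast
qed

text \<open>\<open>S\<close> collects all variables of type (i) with multiplicity, \<open>T\<close>
  those of type (ii) after the first. Conversely an increasing enumeration of the support recovers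
  the indices; the zero exponents allowed in (ii) leave no trace in \<open>T\<close>.\<close>

lemma ordered_comms_eq:
  assumes q: "2 \<le> q"
  shows "ordered_comms q = {com1 S i | S i. qred q S \<and> i \<in># S \<and> i \<noteq> Min (set_mset S)} \<union>
     {com2 q l T | l T. qred q T \<and> l \<notin># T}" (is "_ = ?A \<union> ?B")
proof (intro equalityI subsetI)
  fix p :: "'a ncpoly" assume "p \<in> ordered_comms q"
  then consider (1) n j s where "p = lcomm (yvar (j 1)) (replicate (s 2) (yvar (j 2)) @
        replicate (s 1 - 1) (yvar (j 1)) @ concat (map (\<lambda>i. replicate (s i) (yvar (j i))) [3..<n + 1]))"
      "n \<ge> 2" "inj_on j {1..n}" "j 2 < j 1" "strict_mono_on {2..n} j" "\<forall>i\<in>{1..n}. 1 \<le> s i \<and> s i < q"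
    | (2) k l t where "p = lcomm (yvar (l 1) ^ q - yvar (l 1))
        (concat (map (\<lambda>i. replicate (t i) (yvar (l i))) [2..<k + 1]))"
      "k \<ge> 1" "inj_on l {1..k}" "strict_mono_on {2..k} l" "\<forall>i\<in>{2..k}. t i < q"
    unfolding ordered_comms_def by blast
  then show "p \<in> ?A \<union> ?B"
  proof cases
    case (1 n j s)
    define S where "S = mset (expand j s [1..<n + 1])"
    have set: "set [1..<n + 1] = {1..n}" "distinct [1..<n + 1]" by auto
    have S: "count S (j i) = s i" if "i \<in> {1..n}" for i
      using count_expand[of "[1..<n + 1]" j i s] that 1(3) unfolding S_def set by simp
    have in_S: "x \<in># S \<Longrightarrow> \<exists>i\<in>{1..n}. x = j i" for x
      unfolding S_def set_mset_mset in_set_expand set by blast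
    have S_mem: "j i \<in># S" if "i \<in> {1..n}" for i
      using S[OF that] 1(6) that by (metis count_greater_zero_iff less_le_trans zero_less_one)
    have j2: "j 2 \<le> j i" if "i \<in> {1..n}" for i
    proof (cases "i = 1")
      case False
      then have "i \<in> {2..n}" using that by auto
      then show ?thesis
        using 1(2,5) by (cases "i = 2") (auto simp: strict_mono_on_def intro: less_imp_le)
    qed (use 1(4) in simp)
    have Min: "Min (set_mset S) = j 2"
      using in_S j2 S_mem[of 2] 1(2) by (intro Min_eqI) force+
    have filter: "filter_mset (\<lambda>x. x \<noteq> j 2 \<and> x \<noteq> j 1) S = mset (expand j s [3..<n + 1])"
    proof -
      have S_eq: "S = replicate_mset (s 1) (j 1) + replicate_mset (s 2) (j 2) + mset (expand j s [3..<n + 1])"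
        unfolding S_def by (simp only: upt_123[OF 1(2)]) (simp add: expand_def)
      have "j 2 \<noteq> j i \<and> j 1 \<noteq> j i" if "i \<in> set [3..<n + 1]" for i
        using that 1(2) inj_on_eq_iff[OF 1(3), of i 2] inj_on_eq_iff[OF 1(3), of i 1] by auto
      then have "filter_mset (\<lambda>x. x \<noteq> j 2 \<and> x \<noteq> j 1) (mset (expand j s [3..<n + 1])) =
          mset (expand j s [3..<n + 1])"
        by (intro filter_mset_eq_conv[THEN iffD2]) (auto simp: in_set_expand simp del: set_upt)
      moreover have "filter_mset (\<lambda>x. x \<noteq> j 2 \<and> x \<noteq> j 1) (replicate_mset c (j i)) = {#}"
        if "i = 1 \<or> i = 2" for c i
        using that by (auto simp: multiset_eq_iff)
      ultimately show ?thesis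
        unfolding S_eq by simp
    qed
    have "sorted (expand j s [3..<n + 1])"
      by (rule sorted_expand_upt[OF 1(5)]) simp
    then have "com_list S (j 1) = replicate (s 2) (j 2) @ replicate (s 1 - 1) (j 1) @ expand j s [3..<n + 1]"
      using S[of 1] S[of 2] 1(2) slist_unique[OF _ filter[symmetric]]
      by (simp add: com_list_def Min Let_def del: upt_Suc)
    then have "p = com1 S (j 1)"
      by (simp add: com1_def 1(1) map_expand)
    moreover have "qred q S"
      unfolding S_def using 1(3,6) q set by (intro qred_expand) auto
    ultimately have "p = com1 S (j 1) \<and> qred q S \<and> j 1 \<in># S \<and> j 1 \<noteq> Min (set_mset S)"
      using S_mem[of 1] 1(2,4) Min by auto
    then have "p \<in> ?A" by blast
    then show ?thesis by blast
  next
    case (2 k l t)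
    define T where "T = mset (expand l t [2..<k + 1])"
    have "sorted (expand l t [2..<k + 1])"
      by (rule sorted_expand_upt[OF 2(4)]) simp
    then have "p = com2 q (l 1) T"
      by (simp add: com2_def 2(1) T_def map_expand sorted_sort_id)
    moreover have "qred q T"
      unfolding T_def
    proof (rule qred_expand)
      show "inj_on l (set [2..<k + 1])"
        by (rule inj_on_subset[OF 2(3)]) auto
    qed (use 2(5) q in auto)
    moreover have "l 1 \<notin># T"
    proof
      assume "l 1 \<in># T"
      then obtain i where "i \<in> set [2..<k + 1]" "l 1 = l i"
        unfolding T_def set_mset_mset in_set_expand by blast
      then show False
        using 2(2) inj_on_eq_iff[OF 2(3), of 1 i] by auto
    qed
    ultimately have "p \<in> ?B" by blast
    then show ?thesis by blast
  qed
next
  fix p :: "'a ncpoly" assume "p \<in> ?A \<union> ?B"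
  then consider (1) S i where "p = com1 S i" "qred q S" "i \<in># S" "i \<noteq> Min (set_mset S)"
    | (2) l T where "p = com2 q l T" "qred q T" "l \<notin># T"
    by blast
  then show "p \<in> ordered_comms q"
  proof cases
    case (1 S i)
    define m where "m = Min (set_mset S)"
    have m: "m \<in># S" "\<And>x. x \<in># S \<Longrightarrow> m \<le> x"
      using 1(3) unfolding m_def by (auto intro!: Min_in)
    define n where "n = card (set_mset S - {i}) + 1"
    obtain j where j: "j 1 = i" "inj_on j {1..n}" "strict_mono_on {2..n} j" "j ` {2..n} = set_mset S - {i}"
      unfolding n_def using enumerate_with_first[of "set_mset S - {i}" i] by auto
    have "m \<in> set_mset S - {i}" using m 1(4) by (auto simp: m_def)
    then have n: "2 \<le> n"
      unfolding n_def by (metis Suc_1 Suc_eq_plus1 Suc_le_mono card_gt_0_iff empty_iff finite_Diff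
          finite_set_mset One_nat_def Suc_leI)
    obtain k where k: "k \<in> {2..n}" "j k = m"
      using \<open>m \<in> set_mset S - {i}\<close> j(4) by (metis imageE)
    have "j 2 \<in># S" using j(4) n by auto
    then have j2: "j 2 = m"
      using k strict_mono_onD[OF j(3), of 2 k] m(2)[of "j 2"] by (cases "k = 2") auto
    define s where "s k = count S (j k)" for k
    have "mset (expand j s [3..<n + 1]) = filter_mset (\<lambda>x. x \<noteq> m \<and> x \<noteq> i) S"
    proof (rule expand_mset_eqI)
      have ne: "j k \<noteq> m \<and> j k \<noteq> i" if "k \<in> set [3..<n + 1]" for k
        using that j(1) j2 n inj_on_eq_iff[OF j(2), of k 2] inj_on_eq_iff[OF j(2), of k 1] by auto
      then show "s k = count (filter_mset (\<lambda>x. x \<noteq> m \<and> x \<noteq> i) S) (j k)" if "k \<in> set [3..<n + 1]" for k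
        using that by (simp add: s_def)
      show "set_mset (filter_mset (\<lambda>x. x \<noteq> m \<and> x \<noteq> i) S) \<subseteq> j ` set [3..<n + 1]"
      proof
        fix x assume x: "x \<in> set_mset (filter_mset (\<lambda>x. x \<noteq> m \<and> x \<noteq> i) S)"
        then have "x \<in> j ` {2..n}" using j(4) by auto
        then obtain k where "k \<in> {2..n}" "x = j k" by blast
        moreover from this have "k \<noteq> 2" using x j2 by auto
        ultimately have "k \<in> set [3..<n + 1]" by auto
        then show "x \<in> j ` set [3..<n + 1]"
          unfolding \<open>x = j k\<close> by (rule imageI)
      qed
      show "inj_on j (set [3..<n + 1])"
        by (rule inj_on_subset[OF j(2)]) auto
    qed simp
    moreover have "sorted (expand j s [3..<n + 1])"
      by (rule sorted_expand_upt[OF j(3)]) simp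
    ultimately have "com_list S i = replicate (s 2) (j 2) @ replicate (s 1 - 1) (j 1) @ expand j s [3..<n + 1]"
      using slist_unique by (simp add: com_list_def j(1)[unfolded One_nat_def] j2 s_def flip: m_def)
    then have "p = lcomm (yvar (j 1)) (replicate (s 2) (yvar (j 2)) @
        replicate (s 1 - 1) (yvar (j 1)) @ concat (map (\<lambda>i. replicate (s i) (yvar (j i))) [3..<n + 1]))"
      by (simp add: 1(1) com1_def j(1)[unfolded One_nat_def] map_expand)
    moreover have "j 2 < j 1"
      using j2 j(1) m(2)[OF 1(3)] 1(4) by (simp add: m_def)
    moreover have "\<forall>k\<in>{1..n}. 1 \<le> s k \<and> s k < q"
    proof
      fix k assume "k \<in> {1..n}"
      then have "k = 1 \<or> k \<in> {2..n}" by auto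
      then have "j k \<in># S"
      proof
        assume "k \<in> {2..n}"
        then have "j k \<in> set_mset S - {i}" unfolding j(4)[symmetric] by (rule imageI)
        then show ?thesis by blast
      qed (simp only: j(1) 1(3))
      then show "1 \<le> s k \<and> s k < q"
        using 1(2) by (simp add: s_def qred_def Suc_le_eq)
    qed
    ultimately show ?thesis
      unfolding ordered_comms_def using n j(2,3) by blast
  next
    case (2 l T)
    define k where "k = card (set_mset T) + 1"
    obtain j where j: "j 1 = l" "inj_on j {1..k}" "strict_mono_on {2..k} j" "j ` {2..k} = set_mset T"
      unfolding k_def using enumerate_with_first[of "set_mset T" l] 2(3) by auto
    define t where "t i = count T (j i)" for i
    have img: "j ` set [2..<k + 1] = set_mset T"
      using j(4) by (metis atLeastLessThanSuc_atLeastAtMost set_upt Suc_eq_plus1)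
    have "mset (expand j t [2..<k + 1]) = T"
    proof (rule expand_mset_eqI)
      show "inj_on j (set [2..<k + 1])"
        by (rule inj_on_subset[OF j(2)]) auto
    qed (use img in \<open>simp_all add: t_def del: set_upt upt_Suc\<close>)
    moreover have "sorted (expand j t [2..<k + 1])"
      by (rule sorted_expand_upt[OF j(3)]) simp
    ultimately have "slist T = expand j t [2..<k + 1]"
      using slist_unique by simp
    then have "p = lcomm (yvar (j 1) ^ q - yvar (j 1))
        (concat (map (\<lambda>i. replicate (t i) (yvar (j i))) [2..<k + 1]))"
      by (simp add: 2(1) com2_def j(1)[unfolded One_nat_def] map_expand)
    moreover have "\<forall>i\<in>{2..k}. t i < q"
      using 2(2) by (simp add: t_def qred_def)
    moreover have "k \<ge> 1" by (simp add: k_def)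
    ultimately show ?thesis
      unfolding ordered_comms_def using j(2,3) by blast
  qed
qed

text \<open>The condition that the exponents and \<theta> add up to at least 1 excludes the unit
  \<open>Pow {#}\<close>. Conversely \<open>m\<close> may be any bound on the occurring indices,
  since the additional exponents are zero.\<close>

lemma normal_forms_eq:
  assumes q: "2 \<le> q"
  shows "normal_forms q = form q yvar zvar ` {ix. valid q ix \<and> ix \<noteq> Pow {#}}"
proof (intro equalityI subsetI)
  let ?I = "{ix. valid q ix \<and> ix \<noteq> Pow {#}}"
  let ?e = "\<lambda>r m. expand (\<lambda>i. i) r [0..<m]"
  fix f :: "'a ncpoly" assume "f \<in> normal_forms q"
  then consider (1) m r p \<theta> where "f = ymonom m r * p ^ \<theta>" "\<forall>i<m. r i < q" "p \<in> ordered_comms q"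
      "\<theta> \<in> {0, 1}" "(\<Sum>i<m. r i) + \<theta> \<ge> 1"
    | (2) m r j s k t \<mu> where "f = ymonom m r * zcomm m j s * zcomm m k t ^ \<mu>"
      "\<forall>i<m. r i < q \<and> s i < q \<and> t i < q" "\<mu> \<in> {0, 1 :: nat}"
    unfolding normal_forms_def by blast
  then show "f \<in> form q yvar zvar ` ?I"
  proof cases
    case (1 m r p \<theta>)
    let ?M = "mset (?e r m)"
    have M: "qred q ?M" "slist ?M = ?e r m"
      using 1(2) q by (intro qred_mset_expand slist_mset_expand; simp)+
    show ?thesis
    proof (cases "\<theta> = 0")
      case True
      have "\<exists>i<m. 0 < r i"
        using 1(5) True by (metis add_0_right gr0I lessThan_iff not_one_le_zero sum.neutral)
      then obtain i where "i \<in> set (?e r m)"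
        by (auto simp: in_set_expand)
      then have "?M \<noteq> {#}" by auto
      then show ?thesis
        using M True by (intro image_eqI[of _ _ "Pow ?M"]) (simp_all add: 1(1) ymonom_eq)
    next
      case False
      then have \<theta>: "\<theta> = 1" using 1(4) by simp
      from 1(3) consider (a) S i where "p = com1 S i" "qred q S" "i \<in># S" "i \<noteq> Min (set_mset S)"
        | (b) l T where "p = com2 q l T" "qred q T" "l \<notin># T"
        unfolding ordered_comms_eq[OF q] by blast
      then show ?thesis
      proof cases
        case (a S i)
        then show ?thesis
          using M by (intro image_eqI[of _ _ "Com ?M S i"]) (simp_all add: 1(1) ymonom_eq \<theta> com1_def)
      next
        case (b l T)
        then show ?thesis
          using M by (intro image_eqI[of _ _ "Frob ?M l T"]) (simp_all add: 1(1) ymonom_eq \<theta> com2_def)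
      qed
    qed
  next
    case (2 m r j s k t \<mu>)
    let ?M = "mset (?e r m)" and ?S = "mset (?e s m)" and ?T = "mset (?e t m)"
    have *: "qred q ?M" "slist ?M = ?e r m" "qred q ?S" "slist ?S = ?e s m" "qred q ?T" "slist ?T = ?e t m"
      using 2(2) q by (intro qred_mset_expand slist_mset_expand; simp)+
    show ?thesis
    proof (cases "\<mu> = 0")
      case True
      then show ?thesis
        using * by (intro image_eqI[of _ _ "One ?M j ?S"]) (simp_all add: 2(1) ymonom_eq zcomm_eq)
    next
      case False
      then have "\<mu> = 1" using 2(3) by simp
      then show ?thesis
        using * by (intro image_eqI[of _ _ "Two ?M j ?S k ?T"]) (simp_all add: 2(1) ymonom_eq zcomm_eq)
    qed
  qed
next
  fix f :: "'a ncpoly" assume "f \<in> form q yvar zvar ` {ix. valid q ix \<and> ix \<noteq> Pow {#}}"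
  then obtain ix where ix: "valid q ix" "ix \<noteq> Pow {#}" "f = form q yvar zvar ix" by blast
  have bound: "\<exists>m. \<forall>x. x \<in># M \<longrightarrow> x < m" for M :: "nat multiset"
    using finite_nat_set_iff_bounded[of "set_mset M"] by auto
  have ym: "ymonom m (count M) = ypow yvar (slist M)" if "\<forall>x. x \<in># M \<longrightarrow> x < m" for m M
    using that by (simp add: ymonom_eq expand_count)
  have zc: "zcomm m j (count M) = lcomm (zvar j) (map yvar (slist M))" if "\<forall>x. x \<in># M \<longrightarrow> x < m" for m j M
    using that by (simp add: zcomm_eq expand_count)
  have typeA: "ypow yvar (slist M) * p ^ \<theta> \<in> normal_forms q"
    if pM: "qred q M" "p \<in> ordered_comms q" "\<theta> = 1 \<or> \<theta> = 0 \<and> M \<noteq> {#}" for M \<theta> and p :: "'a ncpoly"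
  proof -
    obtain m where m: "\<forall>x. x \<in># M \<longrightarrow> x < m" using bound by blast
    have "(\<Sum>i<m. count M i) + \<theta> \<ge> 1"
    proof (cases "\<theta> = 1")
      case False
      then obtain x where "x \<in># M" using pM(3) by auto
      then have "1 \<le> count M x" "x \<in> {..<m}" using m by (simp_all add: Suc_le_eq)
      then show ?thesis
        by (meson finite_lessThan le_trans le_add1 member_le_sum zero_le)
    qed simp
    then show ?thesis
      unfolding normal_forms_def ym[OF m, symmetric] using that
      by (intro UnI1 CollectI exI[of _ m] exI[of _ "count M"] exI[of _ p] exI[of _ \<theta>]) (auto simp: qred_def)
  qed
  show "f \<in> normal_forms q"
  proof (cases ix)
    case (Pow M)
    \<comment> \<open>With \<theta> = 0 any ordered commutator may stand for p; the choice is y_1^q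
      - y_1.\<close>
    have "com2 q 0 {#} \<in> ordered_comms q"
      unfolding ordered_comms_eq[OF q] using q by (auto intro!: exI[of _ "{#}"])
    then show ?thesis
      using typeA[of M "com2 q 0 {#}" 0] ix Pow by simp
  next
    case (Com M S i)
    then have "com1 S i \<in> ordered_comms q"
      using ix(1) unfolding ordered_comms_eq[OF q] by auto
    then show ?thesis
      using typeA[of M "com1 S i" 1] ix Com by (simp add: com1_def)
  next
    case (Frob M l T)
    then have "com2 q l T \<in> ordered_comms q"
      using ix(1) unfolding ordered_comms_eq[OF q] by auto
    then show ?thesis
      using typeA[of M "com2 q l T" 1] ix Frob by (simp add: com2_def)
  next
    case (One M j S)
    obtain m where "\<forall>x. x \<in># M + S \<longrightarrow> x < m" using bound by blast
    \<comment> \<open>With \<mu> = 0 any second commutator will do, so the first one is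
      repeated.\<close>
    then have "f = ymonom m (count M) * zcomm m j (count S) * zcomm m j (count S) ^ 0"
      by (simp add: ym zc ix(3) One)
    moreover have "\<forall>i<m. count M i < q \<and> count S i < q \<and> count S i < q"
      using ix(1) One by (simp add: qred_def)
    ultimately show ?thesis
      unfolding normal_forms_def by blast
  next
    case (Two M j S k T)
    obtain m where "\<forall>x. x \<in># M + S + T \<longrightarrow> x < m" using bound by blast
    then have "f = ymonom m (count M) * zcomm m j (count S) * zcomm m k (count T) ^ 1"
      by (simp add: ym zc ix(3) Two)
    moreover have "\<forall>i<m. count M i < q \<and> count S i < q \<and> count T i < q"
      using ix(1) Two by (simp add: qred_def)
    ultimately show ?thesis
      unfolding normal_forms_def by blast
  qed
qed


section \<open>The T2-ideal generated by the four kinds of identities\<close>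

definition UT3_gens :: "'f::{finite,field} ncpoly set" where
  "UT3_gens = {zvar 0 * zvar 1 * zvar 2}
     \<union> {zvar 0 * w1 | w1. w1 \<in> Omega CARD('f) 0 1}
     \<union> {w1 * zvar 0 | w1. w1 \<in> Omega CARD('f) 0 1}
     \<union> {w1 * w2 | w1 w2. w1 \<in> Omega CARD('f) 0 1 \<and> w2 \<in> Omega CARD('f) 2 3}"

text \<open>Some T2-ideal above \<open>S\<close> must exist: an empty intersection would be the
  whole unital algebra, which is not contained in \<open>free_alg\<close>.\<close>

lemma T2_ideal_hull:
  assumes "T2_ideal J" "S \<subseteq> J"
  shows "T2_ideal (T2_ideal hull S)"
proof -
  have inter: "T2_ideal (\<Inter>\<J>)" if "\<J> \<noteq> {}" "\<And>K. K \<in> \<J> \<Longrightarrow> T2_ideal K" for \<J> :: "'a ncpoly set set"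
    unfolding T2_ideal_def
  proof (intro conjI allI impI ballI)
    show "\<Inter>\<J> \<subseteq> free_alg"
      using that by (force simp: T2_ideal_def)
    show "ncpoly.subspace (\<Inter>\<J>)"
      using that(2) by (intro ncpoly.subspace_Inter) (simp add: T2_ideal_def)
    show "f * g \<in> \<Inter>\<J>" "g * f \<in> \<Inter>\<J>" if "f \<in> \<Inter>\<J>" "g \<in> free_alg" for f g
      using that \<open>\<And>K. K \<in> \<J> \<Longrightarrow> T2_ideal K\<close> by (auto simp: T2_ideal_def)
    show "h ` \<Inter>\<J> \<subseteq> \<Inter>\<J>" if "super_endo h" for h
    proof
      fix g assume "g \<in> h ` \<Inter>\<J>"
      then obtain f where f: "f \<in> \<Inter>\<J>" "g = h f" by blast
      have "h f \<in> K" if "K \<in> \<J>" for K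
        using \<open>\<And>K. K \<in> \<J> \<Longrightarrow> T2_ideal K\<close>[OF that] \<open>super_endo h\<close> f(1) that
        unfolding T2_ideal_def by blast
      then show "g \<in> \<Inter>\<J>" using f(2) by blast
    qed
  qed
  show ?thesis
    unfolding hull_def using assms by (intro inter) auto
qed

lemma ut_part_TrueD: "A \<in> ut_part True \<Longrightarrow> ut12 A = 0 \<and> ut23 A = 0"
  and ut_part_FalseD: "A \<in> ut_part False \<Longrightarrow> ut11 A = 0 \<and> ut22 A = 0 \<and> ut33 A = 0 \<and> ut13 A = 0"
  by (auto simp: ut_part_def)

text \<open>Diagonal entries lie in a commutative field with t^q = t, so they cancel and only a
  multiple of e13 remains. Such multiples annihilate the odd part and each other.\<close>

lemma Omega_corner:
  fixes \<phi> :: "var \<Rightarrow> 'f::{finite,field} ut"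
  assumes "graded \<phi>" "w \<in> Omega CARD('f) i j"
  shows "ut11 (ut.ev \<phi> w) = 0 \<and> ut22 (ut.ev \<phi> w) = 0 \<and> ut33 (ut.ev \<phi> w) = 0 \<and>
    ut12 (ut.ev \<phi> w) = 0 \<and> ut23 (ut.ev \<phi> w) = 0"
proof -
  have even: "ut12 (\<phi> (Y k)) = 0 \<and> ut23 (\<phi> (Y k)) = 0" for k
    using assms(1) by (simp add: graded_def ut_part_TrueD)
  have "ut12 (\<phi> (Y k) ^ n) = 0 \<and> ut23 (\<phi> (Y k) ^ n) = 0" for k n
    by (induction n) (simp_all add: even)
  then show ?thesis
    using assms(2) even by (auto simp: Omega_def ut.ev_mult ut.ev_diff ut.ev_power comm_def power_card)
qed

lemma var_free_alg: "yvar i \<in> free_alg" "zvar i \<in> free_alg"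
  by (simp_all add: free_alg_iff yvar_def zvar_def word_eq_0_iff)

lemma power_free_alg: "f \<in> free_alg \<Longrightarrow> 0 < n \<Longrightarrow> f ^ n \<in> free_alg"
  by (cases n) (auto intro: free_alg_mult)

lemma diff_free_alg: "f \<in> free_alg \<Longrightarrow> g \<in> free_alg \<Longrightarrow> f - g \<in> free_alg"
  by (rule ncpoly.subspace_diff[OF subspace_free_alg])

lemma UT3_gens_subset: "(UT3_gens :: 'f::{finite,field} ncpoly set) \<subseteq> UT3_superids"
proof
  fix f :: "'f ncpoly" assume f: "f \<in> UT3_gens"
  have "w \<in> free_alg" if "w \<in> Omega CARD('f) i j" for w :: "'f ncpoly" and i j
    using that by (auto simp: Omega_def comm_def intro!: diff_free_alg free_alg_mult power_free_alg var_free_alg)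
  then have "f \<in> free_alg"
    using f var_free_alg by (auto simp: UT3_gens_def intro!: free_alg_mult)
  moreover have "ut.ev \<phi> f = 0" if \<phi>: "graded \<phi>" for \<phi>
  proof -
    have odd: "ut11 (\<phi> (Z k)) = 0 \<and> ut22 (\<phi> (Z k)) = 0 \<and> ut33 (\<phi> (Z k)) = 0 \<and> ut13 (\<phi> (Z k)) = 0" for k
      using \<phi> by (simp add: graded_def ut_part_FalseD)
    show ?thesis
      using f odd unfolding UT3_gens_def
      by (auto simp: ut.ev_mult ut_eq_iff dest!: Omega_corner[OF \<phi>])
  qed
  ultimately show "f \<in> UT3_superids"
    by (simp add: UT3_superids_iff)
qed

definition UT3_ideal :: "'f::{finite,field} ncpoly set" where
  "UT3_ideal = T2_ideal hull UT3_gens"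

lemma T2_ideal_UT3_ideal: "T2_ideal (UT3_ideal :: 'f::{finite,field} ncpoly set)"
  unfolding UT3_ideal_def by (rule T2_ideal_hull[OF T2_ideal_UT3_superids UT3_gens_subset])

lemma UT3_ideal_subset: "(UT3_ideal :: 'f::{finite,field} ncpoly set) \<subseteq> UT3_superids"
  unfolding UT3_ideal_def by (intro hull_minimal UT3_gens_subset T2_ideal_UT3_superids)

lemma subspace_UT3_ideal: "ncpoly.subspace (UT3_ideal :: 'f::{finite,field} ncpoly set)"
  using T2_ideal_UT3_ideal[where 'f='f] by (simp add: T2_ideal_def)

text \<open>A T2-ideal absorbs factors from the non-unital algebra; the constant term of
  \<open>g\<close> is left to the subspace property. This makes the quotient of the unital algebra a
  ring.\<close>

lemma UT3_ideal_mult: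
  fixes f g :: "'f::{finite,field} ncpoly"
  assumes "f \<in> UT3_ideal"
  shows "f * g \<in> UT3_ideal" "g * f \<in> UT3_ideal"
proof -
  define c where "c = Poly_Mapping.lookup g 0"
  define g' where "g' = g - nc_scale c 1"
  have g: "g = g' + nc_scale c 1" by (simp add: g'_def)
  have "g' \<in> free_alg"
    by (simp add: g'_def free_alg_def c_def lookup_minus)
  then have "f * g' \<in> UT3_ideal" "g' * f \<in> UT3_ideal"
    using T2_ideal_UT3_ideal[where 'f='f] assms unfolding T2_ideal_def by blast+
  moreover have "nc_scale c f \<in> UT3_ideal"
    by (rule ncpoly.subspace_scale[OF subspace_UT3_ideal assms])
  ultimately show "f * g \<in> UT3_ideal" "g * f \<in> UT3_ideal"
    unfolding g by (simp_all add: distrib_left distrib_right nc_scale_mult_left nc_scale_mult_right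
        ncpoly.subspace_add[OF subspace_UT3_ideal])
qed

lemma UT3_gens_subst:
  assumes "f \<in> UT3_gens" "\<And>i. \<phi> (Y i) \<in> free_even" "\<And>i. \<phi> (Z i) \<in> free_odd"
  shows "nc.ev \<phi> f \<in> UT3_ideal"
  using T2_ideal_UT3_ideal super_endo_ev[of \<phi>] assms hull_subset[of UT3_gens T2_ideal]
  unfolding T2_ideal_def UT3_ideal_def by blast

section \<open>The quotient of the unital free algebra by the generated ideal\<close>

definition cong_ideal :: "'f::{finite,field} ncpoly \<Rightarrow> 'f ncpoly \<Rightarrow> bool" where
  "cong_ideal f g \<longleftrightarrow> f - g \<in> UT3_ideal"

lemma equivp_cong_ideal: "equivp (cong_ideal :: 'f::{finite,field} ncpoly \<Rightarrow> _)"
proof (rule equivpI)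
  note sub = subspace_UT3_ideal[where 'f='f]
  show "reflp (cong_ideal :: 'f ncpoly \<Rightarrow> _)"
    by (simp add: reflp_def cong_ideal_def ncpoly.subspace_0[OF sub])
  show "symp (cong_ideal :: 'f ncpoly \<Rightarrow> _)"
  proof (rule sympI)
    show "cong_ideal g f" if "cong_ideal f g" for f g :: "'f ncpoly"
      using ncpoly.subspace_neg[OF sub, of "f - g"] that by (simp add: cong_ideal_def)
  qed
  show "transp (cong_ideal :: 'f ncpoly \<Rightarrow> _)"
  proof (rule transpI)
    show "cong_ideal f h" if "cong_ideal f g" "cong_ideal g h" for f g h :: "'f ncpoly"
      using ncpoly.subspace_add[OF sub, of "f - g" "g - h"] that by (simp add: cong_ideal_def)
  qed
qed

quotient_type (overloaded) 'f quot = "'f::{finite,field} ncpoly" / cong_ideal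
  by (rule equivp_cong_ideal)

instantiation quot :: ("{finite,field}") ring_1
begin

lift_definition zero_quot :: "'a quot" is 0 .
lift_definition one_quot :: "'a quot" is 1 .

lift_definition plus_quot :: "'a quot \<Rightarrow> 'a quot \<Rightarrow> 'a quot" is "(+)"
proof -
  fix f f' g g' :: "'a ncpoly"
  assume "cong_ideal f f'" "cong_ideal g g'"
  then show "cong_ideal (f + g) (f' + g')"
    using ncpoly.subspace_add[OF subspace_UT3_ideal, of "f - f'" "g - g'"]
    by (simp add: cong_ideal_def add_diff_add)
qed

lift_definition uminus_quot :: "'a quot \<Rightarrow> 'a quot" is uminus
proof -
  fix f f' :: "'a ncpoly"
  assume "cong_ideal f f'"
  then show "cong_ideal (- f) (- f')"
    using ncpoly.subspace_neg[OF subspace_UT3_ideal, of "f - f'"] by (simp add: cong_ideal_def)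
qed

lift_definition minus_quot :: "'a quot \<Rightarrow> 'a quot \<Rightarrow> 'a quot" is "(-)"
proof -
  fix f f' g g' :: "'a ncpoly"
  assume "cong_ideal f f'" "cong_ideal g g'"
  then show "cong_ideal (f - g) (f' - g')"
    using ncpoly.subspace_diff[OF subspace_UT3_ideal, of "f - f'" "g - g'"]
    by (simp add: cong_ideal_def algebra_simps)
qed

lift_definition times_quot :: "'a quot \<Rightarrow> 'a quot \<Rightarrow> 'a quot" is "(*)"
proof -
  fix f f' g g' :: "'a ncpoly"
  assume "cong_ideal f f'" "cong_ideal g g'"
  then have "(f - f') * g + f' * (g - g') \<in> UT3_ideal"
    by (intro ncpoly.subspace_add[OF subspace_UT3_ideal] UT3_ideal_mult) (simp_all add: cong_ideal_def)
  then show "cong_ideal (f * g) (f' * g')"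
    by (simp add: cong_ideal_def algebra_simps)
qed

instance
proof
  note refl = equivp_reflp[OF equivp_cong_ideal]
  fix a b c :: "'a quot"
  show "a + b + c = a + (b + c)" by transfer (simp add: add.assoc refl)
  show "a + b = b + a" by transfer (simp add: add.commute refl)
  show "0 + a = a" by transfer (simp add: refl)
  show "- a + a = 0" by transfer (simp add: refl)
  show "a - b = a + - b" by transfer (simp add: refl)
  show "a * b * c = a * (b * c)" by transfer (simp add: mult.assoc refl)
  show "(a + b) * c = a * c + b * c" by transfer (simp add: distrib_right refl)
  show "a * (b + c) = a * b + a * c" by transfer (simp add: distrib_left refl)
  show "1 * a = a" by transfer (simp add: refl)
  show "a * 1 = a" by transfer (simp add: refl)
  \<comment> \<open>The ideal lies in \<open>free_alg\<close>, whose elements have constant term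
    0.\<close>
  have "(1 :: 'a ncpoly) \<notin> UT3_ideal"
    using T2_ideal_UT3_ideal[where 'f='a] by (auto simp: T2_ideal_def free_alg_def)
  then show "(0 :: 'a quot) \<noteq> 1"
    using ncpoly.subspace_neg[OF subspace_UT3_ideal[where 'f='a], of "- 1"]
    by transfer (auto simp: cong_ideal_def)
qed

end

lemma quot_hom:
  "abs_quot (f + g) = abs_quot f + abs_quot g" "abs_quot (f - g) = abs_quot f - abs_quot g"
  "abs_quot (f * g) = abs_quot f * abs_quot g" "abs_quot 0 = 0" "abs_quot 1 = 1"
  by (simp_all add: plus_quot.abs_eq minus_quot.abs_eq times_quot.abs_eq zero_quot_def one_quot_def)

lemma quot_eq_iff: "abs_quot f = abs_quot g \<longleftrightarrow> f - g \<in> UT3_ideal"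
  by (simp add: quot.abs_eq_iff cong_ideal_def)

lemma quot_surj: obtains f where "x = abs_quot f"
  using Quotient3_abs_rep[OF Quotient3_quot, of x] by metis

lemma quot_comm: "abs_quot (comm f g) = comm (abs_quot f) (abs_quot g)"
  by (simp add: comm_def quot_hom)

lemma quot_lcomm: "abs_quot (lcomm f gs) = lcomm (abs_quot f) (map abs_quot gs)"
  by (induction gs arbitrary: f) (simp_all add: quot_comm)

lemma quot_power: "abs_quot (f ^ n) = abs_quot f ^ n"
  by (induction n) (simp_all add: quot_hom)

lemma quot_ypow: "abs_quot (ypow yvar xs) = ypow (\<lambda>i. abs_quot (yvar i)) xs"
  by (induction xs) (simp_all add: quot_hom)

lemma quot_form:
  "abs_quot (form q yvar zvar ix) = form q (\<lambda>i. abs_quot (yvar i)) (\<lambda>i. abs_quot (zvar i)) ix"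
  by (cases ix) (simp_all add: quot_hom quot_lcomm quot_ypow quot_power comp_def)

lemma ncpoly_lcomm_power:
  fixes f g :: "'f::{finite,field} ncpoly"
  shows "lcomm f (replicate CARD('f) g) = comm f (g ^ CARD('f))"
proof (rule lcomm_replicate_eq_comm_power)
  have power: "Poly_Mapping.single (0 :: word) (c :: 'f) ^ n = Poly_Mapping.single 0 (c ^ n)" for c n
    by (induction n) (simp_all add: mult_single)
  show "(- 1) ^ CARD('f) = (- 1 :: 'f ncpoly)"
    using power[of "- 1" "CARD('f)"] by (simp add: power_card single_uminus)
  show "of_nat (CARD('f) choose k) = (0 :: 'f ncpoly)" if "0 < k" "k < CARD('f)" for k
  proof -
    have "(of_nat (CARD('f) choose k) :: 'f ncpoly) = Poly_Mapping.single 0 (of_nat (CARD('f) choose k))"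
      by simp
    also have "\<dots> = 0"
      using of_nat_card_choose[where 'f='f] that by (simp del: single_of_nat)
    finally show ?thesis .
  qed
qed (use card_field_ge_2[where 'f='f] in simp)

text \<open>The relations for arbitrary even and odd elements come from the generators by
  substitution, under which the ideal is invariant.\<close>

lemma graded_quotient_quot:
  fixes V :: "'f::{finite,field} quot set"
  defines "y \<equiv> (\<lambda>i. abs_quot (yvar i))" and "z \<equiv> (\<lambda>i. abs_quot (zvar i))"
  assumes V: "0 \<in> V" "\<And>a b. a \<in> V \<Longrightarrow> b \<in> V \<Longrightarrow> a + b \<in> V" "\<And>a b. a \<in> V \<Longrightarrow> b \<in> V \<Longrightarrow> a - b \<in> V"
    "\<And>ix. valid CARD('f) ix \<Longrightarrow> form CARD('f) y z ix \<in> V"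
  shows "graded_quotient CARD('f) y z (abs_quot ` parity_part True) (abs_quot ` parity_part False)
    ({comm u v | u v. u \<in> abs_quot ` parity_part True \<and> v \<in> abs_quot ` parity_part True} \<union>
     {y i ^ CARD('f) - y i | i. True}) V"
    (is "graded_quotient ?q y z ?Ev ?Od ?Om V")
proof -
  note closed = parity_part_closed parity_part_diff
  \<comment> \<open>One pair u, v serves both alternatives, so a single substitution y_1 -> u, y_2
    -> v treats both elements of \<open>Omega\<close>.\<close>
  have Om: "\<exists>u\<in>free_even. \<exists>v\<in>free_even. w = abs_quot (comm u v) \<or> w = abs_quot (v ^ ?q - v)"
    if w: "w \<in> ?Om" for w :: "'f quot"
  proof -
    consider (1) u v where "w = comm (abs_quot u) (abs_quot v)" "u \<in> parity_part True" "v \<in> parity_part True"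
      | (2) i where "w = y i ^ ?q - y i"
      using w by blast
    then show ?thesis
    proof cases
      case (1 u v)
      \<comment> \<open>Admissible substitutions have no constant term; dropping constants leaves a
        commutator unchanged.\<close>
      define r where "r f = f - Poly_Mapping.single 0 (Poly_Mapping.lookup f 0)" for f :: "'f ncpoly"
      have r: "r f \<in> free_even" if "f \<in> parity_part True" for f
        using that by (auto simp: free_even_eq r_def closed free_alg_def lookup_minus)
      have "comm u v = comm (r u) (r v)"
        by (simp add: comm_def r_def algebra_simps mult_single single_0_commute)
      then show ?thesis
        using 1 r by (metis quot_comm)
    next
      case (2 i)
      have "w = abs_quot (yvar i ^ ?q - yvar i)" "yvar i \<in> (free_even :: 'f ncpoly set)"
        by (simp_all add: 2 y_def quot_hom quot_power free_even_eq closed var_free_alg)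
      then show ?thesis by blast
    qed
  qed
  have gens: "abs_quot (nc.ev \<phi> f) = 0"
    if "f \<in> UT3_gens" "\<And>i. \<phi> (Y i) \<in> free_even" "\<And>i. \<phi> (Z i) \<in> free_odd" for \<phi> and f :: "'f ncpoly"
    using UT3_gens_subst[OF that] quot_eq_iff[of "nc.ev \<phi> f" 0] by (simp add: quot_hom)
  have even0: "yvar 0 \<in> (free_even :: 'f ncpoly set)" and odd0: "zvar 0 \<in> (free_odd :: 'f ncpoly set)"
    by (simp_all add: free_even_eq free_odd_eq closed var_free_alg)
  have Omega: "comm (yvar i) (yvar j) \<in> Omega ?q i j" "yvar j ^ ?q - yvar j \<in> Omega ?q i j" for i j
    by (simp_all add: Omega_def)
  show ?thesis
  proof
    show "2 \<le> ?q" by (rule card_field_ge_2)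
    show "lcomm u (replicate ?q v) = comm u (v ^ ?q)" for u v :: "'f quot"
    proof -
      obtain f g where "u = abs_quot f" "v = abs_quot g"
        by (metis quot_surj)
      then show ?thesis
        using arg_cong[OF ncpoly_lcomm_power[of f g], of abs_quot]
        by (simp add: quot_comm quot_lcomm quot_power)
    qed
    show "1 \<in> ?Ev"
      using closed(4)[of 1] by (force simp flip: quot_hom(5))
    show "y i \<in> ?Ev" "z i \<in> ?Od" for i
      by (auto simp: y_def z_def closed)
    show "e - e' \<in> ?Ev" "e * e' \<in> ?Ev" if "e \<in> ?Ev" "e' \<in> ?Ev" for e e'
      using that closed(3)[of _ True _ True]
      by (auto simp flip: quot_hom intro!: imageI closed(7))
    show "o1 - o2 \<in> ?Od" if "o1 \<in> ?Od" "o2 \<in> ?Od" for o1 o2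
      using that by (auto simp flip: quot_hom intro!: imageI closed(7))
    show "e * o1 \<in> ?Od" "o1 * e \<in> ?Od" if "e \<in> ?Ev" "o1 \<in> ?Od" for e o1
      using that closed(3)[of _ True _ False] closed(3)[of _ False _ True]
      by (auto simp flip: quot_hom intro!: imageI)
    show "o1 * o2 * o3 = 0" if "o1 \<in> ?Od" "o2 \<in> ?Od" "o3 \<in> ?Od" for o1 o2 o3
    proof -
      from that obtain f1 f2 f3 where f: "o1 = abs_quot f1" "o2 = abs_quot f2" "o3 = abs_quot f3"
        "f1 \<in> free_odd" "f2 \<in> free_odd" "f3 \<in> free_odd"
        unfolding free_odd_eq by blast
      define \<phi> where "\<phi> r = (case r of Y _ \<Rightarrow> yvar 0 | Z i \<Rightarrow> if i = 0 then f1 else if i = 1 then f2 else f3)"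
        for r
      have "abs_quot (nc.ev \<phi> (zvar 0 * zvar 1 * zvar 2)) = 0"
        by (rule gens) (auto simp: \<phi>_def even0 f UT3_gens_def)
      then show ?thesis
        by (simp add: nc.ev_mult \<phi>_def f quot_hom)
    qed
    show "o1 * w = 0" "w * o1 = 0" if ow: "o1 \<in> ?Od" "w \<in> ?Om" for o1 w
    proof -
      from ow(1) obtain f where f: "o1 = abs_quot f" "f \<in> free_odd"
        unfolding free_odd_eq by blast
      obtain u v where uv: "u \<in> free_even" "v \<in> free_even" "w = abs_quot (comm u v) \<or> w = abs_quot (v ^ ?q - v)"
        using Om[OF ow(2)] by blast
      define \<phi> where "\<phi> r = (case r of Y i \<Rightarrow> if i = 0 then u else v | Z _ \<Rightarrow> f)" for r
      have \<phi>: "\<phi> (Y i) \<in> free_even" "\<phi> (Z i) \<in> free_odd" for i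
        by (auto simp: \<phi>_def uv f)
      have "abs_quot (nc.ev \<phi> (zvar 0 * w1)) = 0" "abs_quot (nc.ev \<phi> (w1 * zvar 0)) = 0"
        if "w1 \<in> Omega ?q 0 1" for w1
        using that by (intro gens \<phi>; auto simp: UT3_gens_def)+
      from this[OF Omega(1)] this[OF Omega(2)] show "o1 * w = 0" "w * o1 = 0"
        using uv(3) by (auto simp: nc.ev_mult nc.ev_comm nc.ev_diff nc.ev_power \<phi>_def f quot_hom)
    qed
    show "w * w' = 0" if ww: "w \<in> ?Om" "w' \<in> ?Om" for w w'
    proof -
      obtain u v where uv: "u \<in> free_even" "v \<in> free_even" "w = abs_quot (comm u v) \<or> w = abs_quot (v ^ ?q - v)"
        using Om[OF ww(1)] by blast
      obtain u' v' where uv': "u' \<in> free_even" "v' \<in> free_even"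
        "w' = abs_quot (comm u' v') \<or> w' = abs_quot (v' ^ ?q - v')"
        using Om[OF ww(2)] by blast
      define \<phi> where "\<phi> r = (case r of
          Y i \<Rightarrow> if i = 0 then u else if i = 1 then v else if i = 2 then u' else v' | Z _ \<Rightarrow> zvar 0)" for r
      have \<phi>: "\<phi> (Y i) \<in> free_even" "\<phi> (Z i) \<in> free_odd" for i
        by (auto simp: \<phi>_def uv uv' odd0)
      have "abs_quot (nc.ev \<phi> (w1 * w2)) = 0" if "w1 \<in> Omega ?q 0 1" "w2 \<in> Omega ?q 2 3" for w1 w2
        using that by (intro gens \<phi>) (auto simp: UT3_gens_def)
      from this[OF Omega(1) Omega(1)] this[OF Omega(1) Omega(2)] this[OF Omega(2) Omega(1)]
        this[OF Omega(2) Omega(2)]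
      show "w * w' = 0"
        using uv(3) uv'(3) by (auto simp: nc.ev_mult nc.ev_comm nc.ev_diff nc.ev_power \<phi>_def quot_hom)
    qed
  qed (use V in auto)
qed

lemma forms_span_modulo_ideal:
  fixes f :: "'f::{finite,field} ncpoly"
  obtains g where "g \<in> ncpoly.span (form CARD('f) yvar zvar ` Collect (valid CARD('f)))" "f - g \<in> UT3_ideal"
proof -
  let ?q = "CARD('f)"
  let ?S = "ncpoly.span (form ?q yvar zvar ` Collect (valid ?q)) :: 'f ncpoly set"
  let ?y = "\<lambda>i. abs_quot (yvar i :: 'f ncpoly)" and ?z = "\<lambda>i. abs_quot (zvar i :: 'f ncpoly)"
  define V where "V = abs_quot ` ?S"
  have V: "0 \<in> V" "a \<in> V \<Longrightarrow> b \<in> V \<Longrightarrow> a + b \<in> V" "a \<in> V \<Longrightarrow> b \<in> V \<Longrightarrow> a - b \<in> V" for a b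
    unfolding V_def
    by (auto simp: ncpoly.span_zero ncpoly.span_add ncpoly.span_diff simp flip: quot_hom)
  have V_scale: "abs_quot (Poly_Mapping.single 0 c) * a \<in> V" if "a \<in> V" for a c
    using that unfolding V_def
    by (auto simp: ncpoly.span_scale nc_scale_conv_mult[symmetric] simp flip: quot_hom)
  have form_V: "form ?q ?y ?z ix \<in> V" if "valid ?q ix" for ix
    unfolding V_def quot_form[symmetric] using that by (intro imageI ncpoly.span_base) auto
  interpret graded_quotient ?q ?y ?z "abs_quot ` parity_part True" "abs_quot ` parity_part False"
    "{comm u v | u v. u \<in> abs_quot ` parity_part True \<and> v \<in> abs_quot ` parity_part True} \<union>
     {?y i ^ ?q - ?y i | i. True}" V
    by (rule graded_quotient_quot) (use V form_V in auto)
  \<comment> \<open>Right multiplication by \<open>x\<close> is linear, so it suffices to multiply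
    the forms themselves.\<close>
  have step: "a * x \<in> V" if x: "\<And>ix. valid ?q ix \<Longrightarrow> form ?q ?y ?z ix * x \<in> V" and a: "a \<in> V" for a x
  proof -
    have "?S \<subseteq> {h. abs_quot h * x \<in> V}"
    proof (rule ncpoly.span_minimal)
      show "ncpoly.subspace {h. abs_quot h * x \<in> V}"
        unfolding ncpoly.subspace_def
        by (auto simp: quot_hom V distrib_right nc_scale_conv_mult mult.assoc V_scale)
      show "form ?q yvar zvar ` Collect (valid ?q) \<subseteq> {h. abs_quot h * x \<in> V}"
        using x by (auto simp: quot_form)
    qed
    then show ?thesis
      using a unfolding V_def by auto
  qed
  \<comment> \<open>Letters are appended on the right, where the products with forms are known; the
    empty word is \<open>Pow {#}\<close>.\<close>
  have words: "abs_quot (Poly_Mapping.single (Word vs) 1) \<in> V" for vs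
  proof (induction vs rule: rev_induct)
    case Nil
    have "form ?q ?y ?z (Pow {#}) \<in> V"
      using card_field_ge_2[where 'f='f] by (intro form_V) simp
    then show ?case
      by (simp add: quot_hom flip: zero_word_def)
  next
    case (snoc v vs)
    have "Poly_Mapping.single (Word (vs @ [v])) (1 :: 'f) =
        Poly_Mapping.single (Word vs) 1 * Poly_Mapping.single (Word [v]) 1"
      by (simp add: mult_single plus_word_def)
    then have eq: "abs_quot (Poly_Mapping.single (Word (vs @ [v])) (1 :: 'f)) =
        abs_quot (Poly_Mapping.single (Word vs) 1) * abs_quot (Poly_Mapping.single (Word [v]) 1)"
      by (simp add: quot_hom)
    show ?case
      unfolding eq
    proof (rule step[OF _ snoc.IH])
      show "form ?q ?y ?z ix * abs_quot (Poly_Mapping.single (Word [v]) 1) \<in> V" if "valid ?q ix" for ix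
        using form_times_y[OF that] form_times_z[OF that]
        by (cases v) (simp_all add: yvar_def zvar_def)
    qed
  qed
  have "abs_quot f \<in> V"
  proof (induction f rule: ncpoly_induct)
    case (single w c)
    have "abs_quot (Poly_Mapping.single w c) =
        abs_quot (Poly_Mapping.single 0 c) * abs_quot (Poly_Mapping.single (Word (letters w)) 1)"
      by (simp add: mult_single flip: quot_hom)
    then show ?case
      by (simp only: V_scale[OF words])
  qed (simp_all add: quot_hom V)
  then show ?thesis
    using that unfolding V_def by (auto simp: quot_eq_iff)
qed

section \<open>Equality of the generated ideal and the superidentities\<close>

lemma span_forms_superids:
  fixes g :: "'f::{finite,field} ncpoly"
  assumes "g \<in> ncpoly.span (form CARD('f) yvar zvar ` Collect (valid CARD('f)))" "g \<in> UT3_superids"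
  shows "g = 0"
proof -
  let ?form = "form CARD('f) yvar zvar :: index \<Rightarrow> 'f ncpoly"
  obtain t r where t: "finite t" "t \<subseteq> ?form ` Collect (valid CARD('f))" "g = (\<Sum>a\<in>t. nc_scale (r a) a)"
    using assms(1) unfolding ncpoly.span_explicit by blast
  \<comment> \<open>One index is chosen for each polynomial in \<open>t\<close>, which turns the sum
    over polynomials into a sum over indices.\<close>
  obtain J where J: "J \<subseteq> Collect (valid CARD('f))" "inj_on ?form J" "t = ?form ` J"
    using t(2) by (metis subset_image_inj)
  have "finite J" using t(1) J by (metis finite_imageD)
  have g: "g = (\<Sum>ix\<in>J. nc_scale (r (?form ix)) (?form ix))"
    unfolding t(3) J(3) by (simp add: sum.reindex[OF J(2)])
  have "r (?form ix) = 0" if "ix \<in> J" for ix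
    using forms_independent[of J "\<lambda>ix. r (?form ix)" ix] that \<open>finite J\<close> J(1) assms(2) g by auto
  then show ?thesis by (simp add: g)
qed

text \<open>Modulo the ideal a superidentity is a combination of forms; this combination is again a
  superidentity, hence 0 by independence.\<close>

lemma UT3_ideal_eq: "UT3_ideal = (UT3_superids :: 'f::{finite,field} ncpoly set)"
proof (rule antisym[OF UT3_ideal_subset subsetI])
  fix f :: "'f ncpoly" assume f: "f \<in> UT3_superids"
  obtain g where g: "g \<in> ncpoly.span (form CARD('f) yvar zvar ` Collect (valid CARD('f)))" "f - g \<in> UT3_ideal"
    by (rule forms_span_modulo_ideal)
  have "f - (f - g) \<in> UT3_superids"
    by (rule ncpoly.subspace_diff[OF subspace_UT3_superids f subsetD[OF UT3_ideal_subset g(2)]])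
  then have "g = 0"
    using span_forms_superids[OF g(1)] by simp
  then show "f \<in> UT3_ideal" using g(2) by simp
qed


section \<open>The basis of the relatively free algebra\<close>

lemma cong_UT3_refl: "f \<in> free_alg \<Longrightarrow> cong_UT3 f f"
  by (simp add: cong_UT3_def ncpoly.subspace_0[OF subspace_UT3_superids])

lemma relfree_eq_iff:
  "f \<in> free_alg \<Longrightarrow> g \<in> free_alg \<Longrightarrow> abs_relfree f = abs_relfree g \<longleftrightarrow> f - g \<in> UT3_superids"
  using Quotient3_rel[OF Quotient3_relfree, of f g] by (auto simp: cong_UT3_refl) (auto simp: cong_UT3_def)

lemma relfree_hom:
  "f \<in> free_alg \<Longrightarrow> g \<in> free_alg \<Longrightarrow> abs_relfree (f + g) = abs_relfree f + abs_relfree g"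
  "f \<in> free_alg \<Longrightarrow> abs_relfree (nc_scale c f) = relfree_scale c (abs_relfree f)"
  "abs_relfree 0 = 0"
  by (simp_all add: plus_relfree.abs_eq relfree_scale.abs_eq cong_UT3_refl zero_relfree_def)

lemma relfree_sum:
  assumes "\<And>t. t \<in> T \<Longrightarrow> g t \<in> free_alg"
  shows "(\<Sum>t\<in>T. relfree_scale (c t) (abs_relfree (g t))) = abs_relfree (\<Sum>t\<in>T. nc_scale (c t) (g t))"
  using assms
proof (induction T rule: infinite_finite_induct)
  case (insert t T)
  have "(\<Sum>t\<in>T. nc_scale (c t) (g t)) \<in> free_alg"
    using insert.prems by (intro ncpoly.subspace_sum[OF subspace_free_alg] ncpoly.subspace_scale[OF subspace_free_alg]) auto
  then show ?case
    using insert by (simp add: relfree_hom ncpoly.subspace_scale[OF subspace_free_alg])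
qed (simp_all add: relfree_hom)

lemma relfree_surj:
  obtains f where "f \<in> free_alg" "x = abs_relfree f"
  using Quotient3_abs_rep[OF Quotient3_relfree, of x] Quotient3_rep_reflp[OF Quotient3_relfree, of x]
  by (metis cong_UT3_def)

lemma lcomm_free_alg: "f \<in> free_alg \<Longrightarrow> lcomm f gs \<in> free_alg"
  by (induction gs arbitrary: f) (simp_all add: comm_def diff_free_alg free_alg_mult)

text \<open>Apart from the unit each form has a factor without constant term, and by
  \<open>free_alg_mult\<close> one such factor is enough.\<close>

lemma form_free_alg:
  assumes "valid q ix" "ix \<noteq> Pow {#}" "2 \<le> q"
  shows "form q yvar zvar ix \<in> free_alg"
proof (cases ix)
  case (Pow M)
  then have "slist M \<noteq> []"
    using assms(2) by (metis mset_sorted_list_of_multiset mset.simps(1))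
  then show ?thesis
    using Pow by (cases "slist M") (auto intro: free_alg_mult var_free_alg)
qed (use assms(3) in \<open>auto intro!: free_alg_mult lcomm_free_alg diff_free_alg power_free_alg var_free_alg\<close>)

theorem theorem3:
  fixes q :: nat
    and \<Omega>1 \<Omega>2 gens forms :: "'f::{finite,field} ncpoly set"
  defines "q \<equiv> CARD('f)"
    and "\<Omega>1 \<equiv> Omega q 0 1"
    and "\<Omega>2 \<equiv> Omega q 2 3"
    and "gens \<equiv> {zvar 0 * zvar 1 * zvar 2}
           \<union> {zvar 0 * w1 | w1. w1 \<in> \<Omega>1}
           \<union> {w1 * zvar 0 | w1. w1 \<in> \<Omega>1}
           \<union> {w1 * w2 | w1 w2. w1 \<in> \<Omega>1 \<and> w2 \<in> \<Omega>2}"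
    and "forms \<equiv> normal_forms q"
  shows "T2_ideal hull gens = superids UT3_even UT3_odd
    \<and> inj_on abs_relfree forms
    \<and> relfree.independent (abs_relfree ` forms)
    \<and> relfree.span (abs_relfree ` forms) = UNIV"
proof -
  have q: "2 \<le> q"
    unfolding q_def by (rule card_field_ge_2)
  have "gens = UT3_gens"
    unfolding gens_def UT3_gens_def \<Omega>1_def \<Omega>2_def q_def ..
  then have 1: "T2_ideal hull gens = superids UT3_even UT3_odd"
    using UT3_ideal_eq[where 'f='f] by (simp add: UT3_ideal_def)
  define I where "I = {ix. valid q ix \<and> ix \<noteq> Pow {#}}"
  define B where "B = (form q yvar zvar :: index \<Rightarrow> 'f ncpoly)"
  have forms: "forms = B ` I"
    unfolding forms_def I_def B_def by (rule normal_forms_eq[OF q])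
  have free: "B ix \<in> free_alg" if "ix \<in> I" for ix
    using that form_free_alg q by (auto simp: B_def I_def)
  have indep: "c ix = 0" if "finite T" "T \<subseteq> I" "(\<Sum>ix\<in>T. nc_scale (c ix) (B ix)) \<in> UT3_superids" "ix \<in> T" for T c ix
    using forms_independent[of T c ix] that by (auto simp: B_def I_def q_def)
  have inj: "inj_on (\<lambda>ix. abs_relfree (B ix)) I"
  proof (rule inj_onI, rule ccontr)
    fix ix ix' assume ix: "ix \<in> I" "ix' \<in> I" "abs_relfree (B ix) = abs_relfree (B ix')" "ix \<noteq> ix'"
    then have "B ix - B ix' \<in> UT3_superids"
      using relfree_eq_iff free by blast
    \<comment> \<open>Two forms with the same image give a relation with coefficients 1 and
      -1.\<close>
    then have "(\<Sum>i\<in>{ix, ix'}. nc_scale (if i = ix then 1 else - 1) (B i)) \<in> UT3_superids"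
      using ix(4) by simp
    from indep[OF _ _ this, of ix] show False
      using ix by simp
  qed
  then have 2: "inj_on abs_relfree forms"
    unfolding forms by (auto simp: inj_on_def)
  have 3: "relfree.independent (abs_relfree ` forms)"
    unfolding relfree.independent_explicit_module
  proof (intro allI impI)
    fix t u v assume t: "finite t" "t \<subseteq> abs_relfree ` forms" "(\<Sum>v\<in>t. relfree_scale (u v) v) = 0" "v \<in> t"
    have "t \<subseteq> (\<lambda>ix. abs_relfree (B ix)) ` I"
      using t(2) by (auto simp: forms)
    then obtain J where J: "J \<subseteq> I" "inj_on (\<lambda>ix. abs_relfree (B ix)) J" "t = (\<lambda>ix. abs_relfree (B ix)) ` J"
      by (metis subset_image_inj)
    have "finite J" using t(1) J by (metis finite_imageD)
    let ?c = "\<lambda>ix. u (abs_relfree (B ix))"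
    have "abs_relfree (\<Sum>ix\<in>J. nc_scale (?c ix) (B ix)) = (\<Sum>ix\<in>J. relfree_scale (?c ix) (abs_relfree (B ix)))"
      using J(1) free by (intro relfree_sum[symmetric]) auto
    also have "\<dots> = abs_relfree 0"
      using t(3) by (simp add: J(3) sum.reindex[OF J(2)] relfree_hom)
    finally have "(\<Sum>ix\<in>J. nc_scale (?c ix) (B ix)) \<in> UT3_superids"
      using relfree_eq_iff[of "\<Sum>ix\<in>J. nc_scale (?c ix) (B ix)" 0] J(1) free
      by (auto simp: ncpoly.subspace_0[OF subspace_free_alg]
          intro!: ncpoly.subspace_sum[OF subspace_free_alg] ncpoly.subspace_scale[OF subspace_free_alg])
    then have "?c ix = 0" if "ix \<in> J" for ix
      using indep[of J ?c ix] \<open>finite J\<close> J(1) that by blast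
    then show "u v = 0"
      using t(4) J(3) by auto
  qed
  have "x \<in> relfree.span (abs_relfree ` forms)" for x :: "'f relfree"
  proof -
    obtain f where f: "f \<in> free_alg" "x = abs_relfree f"
      by (rule relfree_surj)
    obtain g where g: "g \<in> ncpoly.span (form q yvar zvar ` Collect (valid q))" "f - g \<in> UT3_ideal"
      unfolding q_def by (rule forms_span_modulo_ideal)
    have fg: "f - g \<in> UT3_superids"
      using g(2) UT3_ideal_subset by auto
    then have "f - g \<in> free_alg"
      by (simp add: UT3_superids_iff)
    then have g_free: "g \<in> free_alg"
      using diff_free_alg[OF f(1), of "f - g"] by simp
    \<comment> \<open>The reduction also produced multiples of the unit. As g and all other forms
      lie in \<open>free_alg\<close>, the constant term forces the coefficient \<open>k\<close> of
      the unit to vanish.\<close>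
    have "Collect (valid q) = insert (Pow {#}) I"
      using q by (auto simp: I_def)
    then have "g \<in> ncpoly.span (insert 1 forms)"
      using g(1) by (simp add: forms B_def)
    then obtain k where k: "g - nc_scale k 1 \<in> ncpoly.span forms"
      using ncpoly.span_breakdown_eq by blast
    have span_free: "ncpoly.span forms \<subseteq> free_alg"
      using free by (intro ncpoly.span_minimal subspace_free_alg) (auto simp: forms)
    with k have "g - nc_scale k 1 \<in> free_alg" by blast
    then have "k = 0"
      using g_free by (simp add: free_alg_def lookup_minus)
    then have "g \<in> ncpoly.span forms"
      using k by simp
    moreover have "ncpoly.span forms \<subseteq> {h \<in> free_alg. abs_relfree h \<in> relfree.span (abs_relfree ` forms)}"
    proof (rule ncpoly.span_minimal)
      show "forms \<subseteq> {h \<in> free_alg. abs_relfree h \<in> relfree.span (abs_relfree ` forms)}"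
        using free by (auto simp: forms intro: relfree.span_base)
      show "ncpoly.subspace {h \<in> free_alg. abs_relfree h \<in> relfree.span (abs_relfree ` forms)}"
        unfolding ncpoly.subspace_def
        by (auto simp: relfree_hom relfree.span_zero ncpoly.subspace_0[OF subspace_free_alg]
            intro: relfree.span_add relfree.span_scale ncpoly.subspace_add[OF subspace_free_alg]
              ncpoly.subspace_scale[OF subspace_free_alg])
    qed
    ultimately have "abs_relfree g \<in> relfree.span (abs_relfree ` forms)" by blast
    moreover have "abs_relfree f = abs_relfree g"
      using relfree_eq_iff[OF f(1) g_free] fg by blast
    ultimately show ?thesis using f(2) by simp
  qed
  then have "relfree.span (abs_relfree ` forms) = UNIV" by blast
  with 1 2 3 show ?thesis by blast
qed

end
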